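(* In the market equilibrium of the production economy with time inconsistent preferences described in the context, the stochastic discount factor $M$ (identified up to a multiplicative constant) is determined by $$d(\ln M_t)=\partial_{t,x}\ln f_x(t,X_t,t,X_t),$$ where the partial differential $\partial_{t,x}$ only operates on the variables $(t,x)$ in $f_x(t,x,s,y)$. Alternatively, one can write $$M_t=U_c(t,X_t,t,\hat c_t)\cdot e^{Z_t},$$ where $Z$ is determined by $$dZ_t=\partial_{t,x}\ln f_x(t,X_t,t,X_t)-d\ln f_x(t,X_t,t,X_t).$$
   Context: Economy: production technology $dS_t=\alpha S_tdt+S_t\sigma dW_t$ ($\alpha,\sigma$ constants, $W$ a scalar Wiener process under $P$; only non-negative investment allowed), and a risk free asset in zero net supply $dB_t=r_tB_tdt$ with endogenous short rate $r_t=r(t,X_t)$. The representative agent's wealth is $dX_t=X_tu_t(\alpha-r_t)dt+(r_tX_t-c_t)dt+X_tu_t\sigma dW_t$ with $u\ge0$ the weight on production, $c\ge0$ consumption, and at each $(t,x)$ the agent has reward functional $E_{t,x}[\int_t^TU(t,x,s,c_s)ds]$ (a time inconsistent problem treated via subgame perfect Nash, "intrapersonal", equilibrium). Intrapersonal equilibrium given $r$: with $f(t,x,s,y)=f^{sy}(t,x)$, $$\sup_{u\ge0,c\ge0}\{U(t,x,t,c)+\mathbf A^{u,c}f^{tx}(t,x)\}=0,\qquad \mathbf A^{\hat{\mathbf u},\hat{\mathbf c}}f^{sy}(t,x)+U(s,y,t,\hat c(t,x))=0,$$ $$f^{sy}(t,x)=E_{t,x}\Big[\int_t^TU(s,y,\tau,\hat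 c(\tau,X_\tau))d\tau\Big],$$ where $\mathbf A^{u,c}f^{sy}=f_t+xu(\alpha-r)f_x+(rx-c)f_x+\frac12x^2u^2\sigma^2f_{xx}$ at $(t,x,s,y)$, and $\mathbf A^{u,c}f^{tx}(t,x)$ is its value at $(s,y)=(t,x)$; subscripts $t,x$ on $f$ are derivatives in the first and second arguments of $f(t,x,s,y)$; $\hat u,\hat c$ realize the supremum, and the optimum is interior, so $U_c(t,x,t,\hat c)=f_x(t,x,t,x)$ and $\hat u=-\frac{\alpha-r}{\sigma^2}\frac{f_x(t,x,t,x)}{xf_{xx}(t,x,t,x)}$. All functions are assumed smooth enough for the expressions involved. Market equilibrium: additionally $\hat u(t,x)\equiv1$. Consequently $r(t,x)=\alpha+\sigma^2\frac{xf_{xx}(t,x,t,x)}{f_x(t,x,t,x)}$, and the equilibrium wealth satisfies $dX_t=(\alpha X_t-\hat c_t)dt+X_t\sigma dW_t$, $\hat c_t=\hat c(t,X_t)$. Stochastic discount factor: the equilibrium martingale measure $Q$ has likelihood process $L=dQ/dP$ with $dL_t=L_t\varphi_tdW_t$, where $\varphi_t=\varphi(t,X_t)$ (the Girsanov kernel) satisfies $r(t,x)=\alpha+\varphi(t,x)\sigma$, so $\varphi(t,x)=\sigma\frac{xf_{xx}(t,x,t,x)}{f_x(t,x,t,x)}$. Then $M_t=e^{-\int_0^tr_sds}L_t$, i.e. $dM_t=-r_tM_tdt+M_t\varphi_tdW_t$; $M$ is only identified up to a multiplicative constant. Partial stochastic differential: for a semimartingale $X$, an optional process $Y$ and a $C^2$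 function $k(x,y)$, $\partial_xk(X_t,Y_t)$ is defined as $dk(X_t,y)$ (with $y$ held fixed) evaluated at $y=Y_t$. Thus $\partial_{t,x}\ln f_x(t,X_t,t,X_t)$ is the Itô differential of $t\mapsto\ln f_x(t,X_t,s,y)$ with $(s,y)$ fixed, evaluated at $(s,y)=(t,X_t)$, whereas $d\ln f_x(t,X_t,t,X_t)$ is the differential of the whole process $t\mapsto\ln f_x(t,X_t,t,X_t)$. *)

theory Defs
  imports "HOL-Probability.Probability"
begin

section \<open>Stochastic integration with respect to a scalar Wiener process\<close>

locale wiener_process = prob_space P + filtration "space P" F
  for P :: "'a measure" and F :: "real \<Rightarrow> 'a measure" +
  fixes W :: "real \<Rightarrow> 'a \<Rightarrow> real"
  assumes subalgebra_F: "subalgebra P (F t)"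
    and adapted: "0 \<le> t \<Longrightarrow> W t \<in> borel_measurable (F t)"
    and initial: "\<omega> \<in> space P \<Longrightarrow> W 0 \<omega> = 0"
    and continuous_paths: "\<omega> \<in> space P \<Longrightarrow> continuous_on {0..} (\<lambda>t. W t \<omega>)"
    and gaussian_increments: "0 \<le> s \<Longrightarrow> s < t \<Longrightarrow>
      distributed P lborel (\<lambda>\<omega>. W t \<omega> - W s \<omega>) (normal_density 0 (sqrt (t - s)))"
    and independent_increments: "0 \<le> s \<Longrightarrow> s < t \<Longrightarrow>
      indep_set (sets (F s)) {(\<lambda>\<omega>. W t \<omega> - W s \<omega>) -` B \<inter> space P | B. B \<in> sets borel}"

definition progressive_on ::
  "(real \<Rightarrow> 'a measure) \<Rightarrow> real \<Rightarrow> real \<Rightarrow> (real \<Rightarrow> 'a \<Rightarrow> real) \<Rightarrow> bool" where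
  "progressive_on F t0 t H \<longleftrightarrow>
     (\<lambda>(s, \<omega>). H s \<omega>) \<in> borel_measurable (restrict_space borel {t0..t} \<Otimes>\<^sub>M F t)"

text \<open>A triple \<open>(n, \<tau>, \<xi>)\<close> encodes the simple process equal to \<open>\<xi> i\<close> on
  \<open>(\<tau> i, \<tau> (i + 1)]\<close> for \<open>i < n\<close>.\<close>

definition simple_integrand ::
  "(real \<Rightarrow> 'a measure) \<Rightarrow> real \<Rightarrow> real \<Rightarrow> nat \<Rightarrow> (nat \<Rightarrow> real) \<Rightarrow> (nat \<Rightarrow> 'a \<Rightarrow> real) \<Rightarrow> bool" where
  "simple_integrand F t0 t n \<tau> \<xi> \<longleftrightarrow>
     \<tau> 0 = t0 \<and> \<tau> n = t \<and>
     (\<forall>i<n. \<tau> i \<le> \<tau> (Suc i) \<and> \<xi> i \<in> borel_measurable (F (\<tau> i)) \<and>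
            (\<exists>C. \<forall>\<omega>\<in>space (F (\<tau> i)). \<bar>\<xi> i \<omega>\<bar> \<le> C))"

definition simple_process ::
  "nat \<Rightarrow> (nat \<Rightarrow> real) \<Rightarrow> (nat \<Rightarrow> 'a \<Rightarrow> real) \<Rightarrow> real \<Rightarrow> 'a \<Rightarrow> real" where
  "simple_process n \<tau> \<xi> s \<omega> = (\<Sum>i<n. \<xi> i \<omega> * indicator {\<tau> i<..\<tau> (Suc i)} s)"

definition simple_integral ::
  "(real \<Rightarrow> 'a \<Rightarrow> real) \<Rightarrow> nat \<Rightarrow> (nat \<Rightarrow> real) \<Rightarrow> (nat \<Rightarrow> 'a \<Rightarrow> real) \<Rightarrow> 'a \<Rightarrow> real" where
  "simple_integral W n \<tau> \<xi> \<omega> = (\<Sum>i<n. \<xi> i \<omega> * (W (\<tau> (Suc i)) \<omega> - W (\<tau> i) \<omega>))"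

text \<open>The random variable \<open>I\<close> is (a version of) the It\^o integral of \<open>H\<close> over \<open>[t0, t]\<close>:
  there are simple processes converging to \<open>H\<close> in \<open>L\<^sup>2[t0, t]\<close> in probability whose
  elementary integrals converge to \<open>I\<close> in probability.\<close>

definition has_ito_integral ::
  "'a measure \<Rightarrow> (real \<Rightarrow> 'a measure) \<Rightarrow> (real \<Rightarrow> 'a \<Rightarrow> real) \<Rightarrow> real \<Rightarrow> real
     \<Rightarrow> (real \<Rightarrow> 'a \<Rightarrow> real) \<Rightarrow> ('a \<Rightarrow> real) \<Rightarrow> bool" where
  "has_ito_integral P F W t0 t H I \<longleftrightarrow>
     progressive_on F t0 t H \<and> I \<in> borel_measurable P \<and>
     (\<exists>n \<tau> \<xi>. (\<forall>k. simple_integrand F t0 t (n k) (\<tau> k) (\<xi> k)) \<and>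
       (\<forall>\<epsilon>>0. (\<lambda>k. measure P {\<omega> \<in> space P.
          (\<integral>\<^sup>+ s\<in>{t0..t}. ennreal ((simple_process (n k) (\<tau> k) (\<xi> k) s \<omega> - H s \<omega>)\<^sup>2) \<partial>lborel)
            > ennreal \<epsilon>}) \<longlonglongrightarrow> 0) \<and>
       (\<forall>\<epsilon>>0. (\<lambda>k. measure P {\<omega> \<in> space P.
          \<bar>simple_integral W (n k) (\<tau> k) (\<xi> k) \<omega> - I \<omega>\<bar> > \<epsilon>}) \<longlonglongrightarrow> 0))"

text \<open>\<open>dZ = a dt + b dW\<close> on the time interval \<open>[t0, T)\<close>.\<close>

definition has_ito_differential ::
  "'a measure \<Rightarrow> (real \<Rightarrow> 'a measure) \<Rightarrow> (real \<Rightarrow> 'a \<Rightarrow> real) \<Rightarrow> real \<Rightarrow> real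
     \<Rightarrow> (real \<Rightarrow> 'a \<Rightarrow> real) \<Rightarrow> (real \<Rightarrow> 'a \<Rightarrow> real) \<Rightarrow> (real \<Rightarrow> 'a \<Rightarrow> real) \<Rightarrow> bool" where
  "has_ito_differential P F W t0 T Z a b \<longleftrightarrow>
     (\<forall>t\<in>{t0..<T}. Z t \<in> borel_measurable (F t)) \<and>
     (\<forall>\<omega>\<in>space P. continuous_on {t0..<T} (\<lambda>t. Z t \<omega>)) \<and>
     (\<forall>t\<in>{t0..<T}.
        progressive_on F t0 t a \<and> progressive_on F t0 t b \<and>
        (AE \<omega> in P. set_integrable lborel {t0..t} (\<lambda>s. a s \<omega>)) \<and>
        (AE \<omega> in P. set_integrable lborel {t0..t} (\<lambda>s. (b s \<omega>)\<^sup>2)) \<and>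
        has_ito_integral P F W t0 t b
          (\<lambda>\<omega>. Z t \<omega> - Z t0 \<omega> - (LINT s:{t0..t}|lborel. a s \<omega>)))"

text \<open>\<open>dA = \<partial>\<^sub>x k(\<Xi>, \<Upsilon>)\<close> on \<open>[0, T)\<close>: for each fixed \<open>y\<close> in the parameter set \<open>E\<close> the process
  \<open>k(\<Xi>\<^sub>t, y)\<close> has an It\^o differential \<open>a\<^sub>t(y) dt + b\<^sub>t(y) dW\<^sub>t\<close>, and \<open>dA\<close> is this
  differential evaluated at \<open>y = \<Upsilon>\<^sub>t\<close>. For each single \<open>y\<close> the coefficients are determined only
  up to null sets, so evaluation at the random point \<open>\<Upsilon>\<^sub>t\<close> needs versions that
  are jointly continuous in \<open>(t, y)\<close>.\<close>

definition has_partial_differential ::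
  "'a measure \<Rightarrow> (real \<Rightarrow> 'a measure) \<Rightarrow> (real \<Rightarrow> 'a \<Rightarrow> real) \<Rightarrow> real
     \<Rightarrow> ('x \<Rightarrow> 'y::topological_space \<Rightarrow> real) \<Rightarrow> 'y set
     \<Rightarrow> (real \<Rightarrow> 'a \<Rightarrow> 'x) \<Rightarrow> (real \<Rightarrow> 'a \<Rightarrow> 'y) \<Rightarrow> (real \<Rightarrow> 'a \<Rightarrow> real) \<Rightarrow> bool" where
  "has_partial_differential P F W T k E \<Xi> \<Upsilon> A \<longleftrightarrow>
     (\<exists>a b :: 'y \<Rightarrow> real \<Rightarrow> 'a \<Rightarrow> real.
        (\<forall>\<omega>\<in>space P. continuous_on ({0..<T} \<times> E) (\<lambda>(t, y). a y t \<omega>) \<and>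
                     continuous_on ({0..<T} \<times> E) (\<lambda>(t, y). b y t \<omega>)) \<and>
        (\<forall>y\<in>E. has_ito_differential P F W 0 T (\<lambda>t \<omega>. k (\<Xi> t \<omega>) y) (a y) (b y)) \<and>
        has_ito_differential P F W 0 T A (\<lambda>t \<omega>. a (\<Upsilon> t \<omega>) t \<omega>) (\<lambda>t \<omega>. b (\<Upsilon> t \<omega>) t \<omega>))"

text \<open>\<open>dZ = dA - dY\<close> on \<open>[0, T)\<close>, in integrated form.\<close>

definition differential_diff ::
  "'a measure \<Rightarrow> real \<Rightarrow> (real \<Rightarrow> 'a \<Rightarrow> real) \<Rightarrow> (real \<Rightarrow> 'a \<Rightarrow> real) \<Rightarrow> (real \<Rightarrow> 'a \<Rightarrow> real) \<Rightarrow> bool" where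
  "differential_diff P T Z A Y \<longleftrightarrow>
     (AE \<omega> in P. \<forall>t\<in>{0..<T}. Z t \<omega> - Z 0 \<omega> = (A t \<omega> - A 0 \<omega>) - (Y t \<omega> - Y 0 \<omega>))"


section \<open>The production economy\<close>

text \<open>Time runs through \<open>[0, T)\<close> and wealth through \<open>(0, \<infinity>)\<close>; the parameter pairs \<open>(s, y)\<close> of
  \<open>f(t, x, s, y)\<close> range over the same set. The horizon \<open>T\<close> itself is excluded
  because wealth may be exhausted there.\<close>

definition state_space :: "real \<Rightarrow> (real \<times> real) set" where
  "state_space T = {0..<T} \<times> {0<..}"

text \<open>\<open>Y\<close> is the wealth process started at wealth \<open>x0\<close> at time \<open>t0\<close> under the feedback controls
  \<open>u\<close> (weight on production) and \<open>c\<close> (consumption), the short rate being \<open>r\<close>.\<close>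

definition wealth_process ::
  "'a measure \<Rightarrow> (real \<Rightarrow> 'a measure) \<Rightarrow> (real \<Rightarrow> 'a \<Rightarrow> real) \<Rightarrow> real \<Rightarrow> real \<Rightarrow> real
     \<Rightarrow> (real \<Rightarrow> real \<Rightarrow> real) \<Rightarrow> (real \<Rightarrow> real \<Rightarrow> real) \<Rightarrow> (real \<Rightarrow> real \<Rightarrow> real)
     \<Rightarrow> real \<Rightarrow> real \<Rightarrow> (real \<Rightarrow> 'a \<Rightarrow> real) \<Rightarrow> bool" where
  "wealth_process P F W T \<alpha> \<sigma> r u c t0 x0 Y \<longleftrightarrow>
     (\<forall>\<omega>\<in>space P. Y t0 \<omega> = x0 \<and> (\<forall>t\<in>{t0..<T}. Y t \<omega> > 0)) \<and>
     has_ito_differential P F W t0 T Y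
       (\<lambda>t \<omega>. Y t \<omega> * u t (Y t \<omega>) * (\<alpha> - r t (Y t \<omega>)) + (r t (Y t \<omega>) * Y t \<omega> - c t (Y t \<omega>)))
       (\<lambda>t \<omega>. Y t \<omega> * u t (Y t \<omega>) * \<sigma>)"

text \<open>The regularity used throughout: \<open>ft\<close>, \<open>fx\<close>, \<open>fxx\<close>, \<open>fxxx\<close>, \<open>ftx\<close> are the indicated partial
  derivatives of \<open>f\<close> in its first two arguments (one-sided in time at \<open>0\<close>), jointly continuous in
  all four arguments. Positivity of \<open>fx\<close> is what makes \<open>ln f\<^sub>x(t, x, s, y)\<close> meaningful.\<close>

locale smooth_value =
  fixes T :: real
    and f ft fx fxx fxxx ftx :: "real \<Rightarrow> real \<Rightarrow> real \<Rightarrow> real \<Rightarrow> real"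
  assumes f_t: "\<And>t x s y. (t, x) \<in> state_space T \<Longrightarrow> (s, y) \<in> state_space T \<Longrightarrow>
        ((\<lambda>t. f t x s y) has_real_derivative ft t x s y) (at t within {0..<T})"
    and f_x: "\<And>t x s y. (t, x) \<in> state_space T \<Longrightarrow> (s, y) \<in> state_space T \<Longrightarrow>
        ((\<lambda>x. f t x s y) has_real_derivative fx t x s y) (at x)"
    and f_xx: "\<And>t x s y. (t, x) \<in> state_space T \<Longrightarrow> (s, y) \<in> state_space T \<Longrightarrow>
        ((\<lambda>x. fx t x s y) has_real_derivative fxx t x s y) (at x)"
    and f_xxx: "\<And>t x s y. (t, x) \<in> state_space T \<Longrightarrow> (s, y) \<in> state_space T \<Longrightarrow>
        ((\<lambda>x. fxx t x s y) has_real_derivative fxxx t x s y) (at x)"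
    and f_tx: "\<And>t x s y. (t, x) \<in> state_space T \<Longrightarrow> (s, y) \<in> state_space T \<Longrightarrow>
        ((\<lambda>x. ft t x s y) has_real_derivative ftx t x s y) (at x)"
    and f_xt: "\<And>t x s y. (t, x) \<in> state_space T \<Longrightarrow> (s, y) \<in> state_space T \<Longrightarrow>
        ((\<lambda>t. fx t x s y) has_real_derivative ftx t x s y) (at t within {0..<T})"
    and continuous_derivatives: "\<And>g. g \<in> {f, ft, fx, fxx, fxxx, ftx} \<Longrightarrow>
        continuous_on (state_space T \<times> state_space T) (\<lambda>((t, x), (s, y)). g t x s y)"
    and fx_pos: "\<And>t x s y. (t, x) \<in> state_space T \<Longrightarrow> (s, y) \<in> state_space T \<Longrightarrow> fx t x s y > 0"

text \<open>Intrapersonal equilibrium for a given short rate \<open>r\<close>. \<open>U t x s c\<close> is the utility, for the agent at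
  \<open>(t, x)\<close>, of consuming at rate \<open>c\<close> at time \<open>s\<close>; \<open>Uc\<close> is its derivative in \<open>c\<close>. The
  supremum is formed in the extended reals, so that boundedness is part of the assertion.
  The expectation \<open>E\<^sub>t\<^sub>x\<close> is taken over equilibrium wealth started at \<open>(t, x)\<close>.\<close>

locale intrapersonal_equilibrium =
  wiener_process P F W + smooth_value T f ft fx fxx fxxx ftx
  for P :: "'a measure" and F :: "real \<Rightarrow> 'a measure" and W :: "real \<Rightarrow> 'a \<Rightarrow> real"
    and T :: real and f ft fx fxx fxxx ftx :: "real \<Rightarrow> real \<Rightarrow> real \<Rightarrow> real \<Rightarrow> real" +
  fixes \<alpha> \<sigma> :: real
    and U Uc :: "real \<Rightarrow> real \<Rightarrow> real \<Rightarrow> real \<Rightarrow> real"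
    and r u_hat c_hat :: "real \<Rightarrow> real \<Rightarrow> real"
  assumes T_pos: "T > 0"
    and sigma_nonzero: "\<sigma> \<noteq> 0"
    and U_c: "\<And>t x s c. (t, x) \<in> state_space T \<Longrightarrow> s \<in> {0..<T} \<Longrightarrow> c > 0 \<Longrightarrow>
        ((\<lambda>c. U t x s c) has_real_derivative Uc t x s c) (at c)"
    and c_hat_continuous: "continuous_on (state_space T) (\<lambda>(t, x). c_hat t x)"
    and c_hat_differentiable: "\<And>t x. (t, x) \<in> state_space T \<Longrightarrow> (\<lambda>x. c_hat t x) differentiable at x"
    and interior: "\<And>t x. (t, x) \<in> state_space T \<Longrightarrow> u_hat t x > 0 \<and> c_hat t x > 0"
  fixes A :: "real \<Rightarrow> real \<Rightarrow> real \<Rightarrow> real \<Rightarrow> real \<Rightarrow> real \<Rightarrow> real"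
  defines "A u c t x s y \<equiv> ft t x s y + x * u * (\<alpha> - r t x) * fx t x s y
             + (r t x * x - c) * fx t x s y + 1 / 2 * x\<^sup>2 * u\<^sup>2 * \<sigma>\<^sup>2 * fxx t x s y"
  assumes sup_eq_0: "\<And>t x. (t, x) \<in> state_space T \<Longrightarrow>
        (SUP (u, c) \<in> {0..} \<times> {0..}. ereal (U t x t c + A u c t x t x)) = 0"
    and sup_attained: "\<And>t x. (t, x) \<in> state_space T \<Longrightarrow>
        U t x t (c_hat t x) + A (u_hat t x) (c_hat t x) t x t x = 0"
    and value_equation: "\<And>t x s y. (t, x) \<in> state_space T \<Longrightarrow> (s, y) \<in> state_space T \<Longrightarrow>
        A (u_hat t x) (c_hat t x) t x s y + U s y t (c_hat t x) = 0"
    and wealth_exists: "\<And>t x. (t, x) \<in> state_space T \<Longrightarrow>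
        \<exists>Y. wealth_process P F W T \<alpha> \<sigma> r u_hat c_hat t x Y"
    and value_integrable: "\<And>t x s y Y. (t, x) \<in> state_space T \<Longrightarrow> (s, y) \<in> state_space T \<Longrightarrow>
        wealth_process P F W T \<alpha> \<sigma> r u_hat c_hat t x Y \<Longrightarrow>
        (AE \<omega> in P. set_integrable lborel {t..<T} (\<lambda>\<tau>. U s y \<tau> (c_hat \<tau> (Y \<tau> \<omega>)))) \<and>
        integrable P (\<lambda>\<omega>. LINT \<tau>:{t..<T}|lborel. U s y \<tau> (c_hat \<tau> (Y \<tau> \<omega>)))"
    and value_representation: "\<And>t x s y Y. (t, x) \<in> state_space T \<Longrightarrow> (s, y) \<in> state_space T \<Longrightarrow>
        wealth_process P F W T \<alpha> \<sigma> r u_hat c_hat t x Y \<Longrightarrow>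
        f t x s y = (LINT \<omega>|P. (LINT \<tau>:{t..<T}|lborel. U s y \<tau> (c_hat \<tau> (Y \<tau> \<omega>))))"

text \<open>Market clearing: the risk free asset is in zero net supply, so all wealth net of consumption
  is invested in production.\<close>

locale market_equilibrium = intrapersonal_equilibrium +
  assumes market_clearing: "\<And>t x. (t, x) \<in> state_space T \<Longrightarrow> u_hat t x = 1"

text \<open>\<open>Q\<close> is the martingale measure with likelihood process \<open>L\<close> (with respect to \<open>P\<close>, on \<open>F\<^sub>t\<close>) and
  Girsanov kernel \<open>\<phi>\<close>; \<open>M\<close> is \<open>L\<close> discounted by the short rate,
  up to a positive multiplicative constant.\<close>

locale stochastic_discount_factor =
  fixes P :: "'a measure" and F :: "real \<Rightarrow> 'a measure" and W :: "real \<Rightarrow> 'a \<Rightarrow> real"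
    and T \<alpha> \<sigma> :: real and r :: "real \<Rightarrow> real \<Rightarrow> real" and X :: "real \<Rightarrow> 'a \<Rightarrow> real"
    and Q :: "'a measure" and L :: "real \<Rightarrow> 'a \<Rightarrow> real" and \<phi> :: "real \<Rightarrow> real \<Rightarrow> real"
    and M :: "real \<Rightarrow> 'a \<Rightarrow> real"
  assumes prob_Q: "prob_space Q" and sets_Q: "sets Q = sets P"
    and likelihood_pos: "\<And>t \<omega>. t \<in> {0..<T} \<Longrightarrow> \<omega> \<in> space P \<Longrightarrow> L t \<omega> > 0"
    and likelihood_initial: "\<And>\<omega>. \<omega> \<in> space P \<Longrightarrow> L 0 \<omega> = 1"
    and likelihood: "\<And>t B. t \<in> {0..<T} \<Longrightarrow> B \<in> sets (F t) \<Longrightarrow>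
        emeasure Q B = (\<integral>\<^sup>+ \<omega>\<in>B. ennreal (L t \<omega>) \<partial>P)"
    and likelihood_dynamics:
      "has_ito_differential P F W 0 T L (\<lambda>t \<omega>. 0) (\<lambda>t \<omega>. L t \<omega> * \<phi> t (X t \<omega>))"
    and martingale_condition: "\<And>t x. (t, x) \<in> state_space T \<Longrightarrow> r t x = \<alpha> + \<phi> t x * \<sigma>"
    and discounting: "\<exists>k>0. \<forall>\<omega>\<in>space P. \<forall>t\<in>{0..<T}.
        M t \<omega> = k * exp (- (LINT s:{0..t}|lborel. r s (X s \<omega>))) * L t \<omega>"

text \<open>Equality of two processes up to a positive constant and up to indistinguishability.\<close>

definition proportional_processes ::
  "'a measure \<Rightarrow> real \<Rightarrow> (real \<Rightarrow> 'a \<Rightarrow> real) \<Rightarrow> (real \<Rightarrow> 'a \<Rightarrow> real) \<Rightarrow> bool" where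
  "proportional_processes P T N M \<longleftrightarrow>
     (\<exists>k>0. AE \<omega> in P. \<forall>t\<in>{0..<T}. N t \<omega> = k * M t \<omega>)"

end

theory Submission
  imports Defs
begin

text \<open>Since integrals of continuous adapted integrands are limits in probability of left Riemann
  sums, It\^o's formula and the uniqueness of the It\^o decomposition reduce to estimates of
  martingale transforms of Wiener increments. Given these, the theorem is the following
  computation. Interiority and \<open>u_hat = 1\<close> give \<open>r = \<alpha> + \<sigma>\<^sup>2 x fxx / fx\<close> and \<open>Uc = fx\<close> on the
  diagonal \<open>(s, y) = (t, x)\<close>. Differentiating the value equation in \<open>x\<close> at fixed \<open>(s, y)\<close> and then
  passing to the diagonal shows that the drift of \<open>ln fx(t, X, s, y)\<close> becomes \<open>- r - \<phi>\<^sup>2 / 2\<close>, while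
  its volatility becomes \<open>\<phi>\<close>; these are the coefficients of \<open>ln M\<close>. Conversely the coefficients
  in the partial differential are unique, so \<open>ln M\<close> is determined up to its initial value.\<close>

text \<open>The definition of the integral fixes one time and asks only for some approximating
  simple processes, so neither uniqueness nor additivity over intervals comes for free, and no
  moments are available. \<open>ito_integral_left_sums\<close> shows that every version is the limit
  of the sums along the uniform grid, \<open>ito_integral_of_left_sums\<close> is the converse;
  after that only sums have to be handled. Missing moments are replaced by stopping finitely many
  coefficients and by discarding events of small probability. The main obstacle is
  \<open>ito_error\<close>, the difference between an increment of the integral process and its
  one-step approximation: its squares must sum to something negligible, and the quadratic variation,
  Ito's formula and uniqueness all rest on this. On the economic side \<open>u_hat = 1\<close> acts
  twice. It turns the first order condition for \<open>u\<close> into a formula for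
  \<open>r\<close>, and it removes \<open>r\<close> from the value equation before that equation is
  differentiated, so that no derivative of \<open>r\<close> occurs.\<close>

abbreviation grid :: "real \<Rightarrow> nat \<Rightarrow> nat \<Rightarrow> real" where
  "grid u n i \<equiv> u * real i / real n"

abbreviation incr :: "(real \<Rightarrow> 'a \<Rightarrow> real) \<Rightarrow> real \<Rightarrow> nat \<Rightarrow> nat \<Rightarrow> 'a \<Rightarrow> real" where
  "incr X u n i \<omega> \<equiv> X (grid u n (Suc i)) \<omega> - X (grid u n i) \<omega>"

section \<open>Convergence in probability\<close>

text \<open>Exceptional sets are only required to be contained in a small event, so that no
  measurability is needed to combine such statements.\<close>

definition mostly :: "'a measure \<Rightarrow> real \<Rightarrow> ('a \<Rightarrow> bool) \<Rightarrow> bool" where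
  "mostly M \<eta> Q \<longleftrightarrow> (\<exists>B\<in>sets M. measure M B \<le> \<eta> \<and> (\<forall>\<omega>\<in>space M - B. Q \<omega>))"

definition null_in_prob :: "'a measure \<Rightarrow> (nat \<Rightarrow> 'a \<Rightarrow> real) \<Rightarrow> bool" where
  "null_in_prob M X \<longleftrightarrow>
     (\<forall>\<epsilon>>0. \<forall>\<eta>>0. eventually (\<lambda>n. mostly M \<eta> (\<lambda>\<omega>. \<bar>X n \<omega>\<bar> \<le> \<epsilon>)) sequentially)"

definition bounded_in_prob :: "'a measure \<Rightarrow> (nat \<Rightarrow> 'a \<Rightarrow> real) \<Rightarrow> bool" where
  "bounded_in_prob M X \<longleftrightarrow>
     (\<forall>\<eta>>0. \<exists>C. eventually (\<lambda>n. mostly M \<eta> (\<lambda>\<omega>. \<bar>X n \<omega>\<bar> \<le> C)) sequentially)"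

lemma mostly_mono:
  "mostly M \<eta> Q \<Longrightarrow> \<eta> \<le> \<eta>' \<Longrightarrow> (\<And>\<omega>. \<omega> \<in> space M \<Longrightarrow> Q \<omega> \<Longrightarrow> Q' \<omega>) \<Longrightarrow> mostly M \<eta>' Q'"
  unfolding mostly_def by (meson DiffE order_trans)

lemma mostly_true: "0 \<le> \<eta> \<Longrightarrow> (\<And>\<omega>. \<omega> \<in> space M \<Longrightarrow> Q \<omega>) \<Longrightarrow> mostly M \<eta> Q"
  unfolding mostly_def by (rule bexI[of _ "{}"]) auto

lemma (in finite_measure) mostly_conj:
  assumes "mostly M \<eta> Q" "mostly M \<eta>' Q'"
  shows "mostly M (\<eta> + \<eta>') (\<lambda>\<omega>. Q \<omega> \<and> Q' \<omega>)"
proof -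
  obtain B B' where B: "B \<in> sets M" "measure M B \<le> \<eta>" "\<forall>\<omega>\<in>space M - B. Q \<omega>"
    and B': "B' \<in> sets M" "measure M B' \<le> \<eta>'" "\<forall>\<omega>\<in>space M - B'. Q' \<omega>"
    using assms unfolding mostly_def by blast
  have "measure M (B \<union> B') \<le> \<eta> + \<eta>'"
    using measure_Un_le[OF B(1) B'(1)] B(2) B'(2) by linarith
  then show ?thesis
    unfolding mostly_def using B B' by (intro bexI[of _ "B \<union> B'"]) auto
qed

lemma (in finite_measure) mostly_conj_mono:
  assumes "mostly M \<eta> Q" "mostly M \<eta>' Q'" "\<eta> + \<eta>' \<le> \<eta>''"
    and "\<And>\<omega>. \<omega> \<in> space M \<Longrightarrow> Q \<omega> \<Longrightarrow> Q' \<omega> \<Longrightarrow> Q'' \<omega>"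
  shows "mostly M \<eta>'' Q''"
  using mostly_conj[OF assms(1,2)] by (rule mostly_mono) (use assms in auto)

text \<open>Union bound. It is applied to all points of a grid, with a level divided by their
  number.\<close>

lemma (in finite_measure) mostly_ball:
  fixes \<eta> :: real
  assumes "finite J" "\<And>j. j \<in> J \<Longrightarrow> mostly M \<eta> (Q j)"
  shows "mostly M (card J * \<eta>) (\<lambda>\<omega>. \<forall>j\<in>J. Q j \<omega>)"
  using assms
proof (induction J rule: finite_induct)
  case empty
  show ?case by (rule mostly_true) auto
next
  case (insert j J)
  have "mostly M (\<eta> + card J * \<eta>) (\<lambda>\<omega>. Q j \<omega> \<and> (\<forall>j\<in>J. Q j \<omega>))"
    by (rule mostly_conj) (use insert in auto)
  then show ?case
    by (rule mostly_mono) (use insert in \<open>auto simp: algebra_simps\<close>)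
qed

lemma mostly_AE:
  assumes "AE \<omega> in M. Q \<omega>" "0 \<le> \<eta>"
  shows "mostly M \<eta> Q"
proof -
  obtain N where "{\<omega> \<in> space M. \<not> Q \<omega>} \<subseteq> N" "emeasure M N = 0" "N \<in> sets M"
    using assms(1) by (rule AE_E)
  then show ?thesis
    unfolding mostly_def using assms(2) by (intro bexI[of _ N]) (auto simp: measure_def)
qed

lemma (in finite_measure) mostly_measure:
  "mostly M \<eta> Q \<Longrightarrow> measure M {\<omega> \<in> space M. \<not> Q \<omega>} \<le> \<eta>"
  unfolding mostly_def by (auto intro: order_trans[OF finite_measure_mono])

lemma measure_mostly:
  "{\<omega> \<in> space M. \<not> Q \<omega>} \<in> sets M \<Longrightarrow> measure M {\<omega> \<in> space M. \<not> Q \<omega>} \<le> \<eta> \<Longrightarrow> mostly M \<eta> Q"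
  unfolding mostly_def by (intro bexI[of _ "{\<omega> \<in> space M. \<not> Q \<omega>}"]) auto

text \<open>The intersection of exceptional events of measure at most \<open>1 / (n + 1)\<close> is
  a null set, and a point outside it avoids at least one of them.\<close>

lemma (in finite_measure) AE_mostly:
  assumes "\<And>\<eta>. \<eta> > 0 \<Longrightarrow> mostly M \<eta> Q"
  shows "AE \<omega> in M. Q \<omega>"
proof -
  have "\<exists>B. B \<in> sets M \<and> measure M B \<le> inverse (Suc n) \<and> (\<forall>\<omega>\<in>space M - B. Q \<omega>)" for n
    using assms[of "inverse (Suc n)"] unfolding mostly_def by auto
  then obtain B where B: "\<And>n. B n \<in> sets M" "\<And>n. measure M (B n) \<le> inverse (Suc n)"
    "\<And>n \<omega>. \<omega> \<in> space M \<Longrightarrow> \<omega> \<notin> B n \<Longrightarrow> Q \<omega>"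
    by (metis Diff_iff)
  have "measure M (\<Inter>n. B n) \<le> inverse (Suc n)" for n
    using B(2)[of n] finite_measure_mono[of "\<Inter>n. B n" "B n"] B(1) by force
  then have "measure M (\<Inter>n. B n) \<le> 0"
    by (intro LIMSEQ_le_const[OF LIMSEQ_inverse_real_of_nat]) auto
  then have "(\<Inter>n. B n) \<in> null_sets M"
    using B(1) by (auto simp: null_sets_def emeasure_eq_measure measure_nonneg order_antisym)
  then show ?thesis
    by (rule AE_I') (use B(3) in blast)
qed

context finite_measure
begin

lemma null_in_prob_mono:
  assumes "null_in_prob M X" "\<And>n \<omega>. \<omega> \<in> space M \<Longrightarrow> \<bar>Y n \<omega>\<bar> \<le> \<bar>X n \<omega>\<bar>"
  shows "null_in_prob M Y"
  unfolding null_in_prob_def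
proof (intro allI impI)
  fix \<epsilon> \<eta> :: real assume "\<epsilon> > 0" "\<eta> > 0"
  then have "eventually (\<lambda>n. mostly M \<eta> (\<lambda>\<omega>. \<bar>X n \<omega>\<bar> \<le> \<epsilon>)) sequentially"
    using assms(1) unfolding null_in_prob_def by blast
  then show "eventually (\<lambda>n. mostly M \<eta> (\<lambda>\<omega>. \<bar>Y n \<omega>\<bar> \<le> \<epsilon>)) sequentially"
  proof eventually_elim
    case (elim n)
    then show ?case
      by (rule mostly_mono) (auto intro: order_trans[OF assms(2)])
  qed
qed

lemma null_in_prob_cong:
  assumes "null_in_prob M X" "\<And>n \<omega>. \<omega> \<in> space M \<Longrightarrow> Y n \<omega> = X n \<omega>"
  shows "null_in_prob M Y"
  by (rule null_in_prob_mono[OF assms(1)]) (simp add: assms(2))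

lemma null_in_prob_add:
  assumes "null_in_prob M X" "null_in_prob M Y"
  shows "null_in_prob M (\<lambda>n \<omega>. X n \<omega> + Y n \<omega>)"
  unfolding null_in_prob_def
proof (intro allI impI)
  fix \<epsilon> \<eta> :: real assume "\<epsilon> > 0" "\<eta> > 0"
  then have "eventually (\<lambda>n. mostly M (\<eta>/2) (\<lambda>\<omega>. \<bar>X n \<omega>\<bar> \<le> \<epsilon>/2)) sequentially"
    "eventually (\<lambda>n. mostly M (\<eta>/2) (\<lambda>\<omega>. \<bar>Y n \<omega>\<bar> \<le> \<epsilon>/2)) sequentially"
    using assms \<open>\<epsilon> > 0\<close> \<open>\<eta> > 0\<close> unfolding null_in_prob_def by (meson half_gt_zero)+
  then show "eventually (\<lambda>n. mostly M \<eta> (\<lambda>\<omega>. \<bar>X n \<omega> + Y n \<omega>\<bar> \<le> \<epsilon>)) sequentially"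
    by eventually_elim (erule mostly_conj_mono, assumption, auto)
qed

lemma null_in_prob_minus:
  assumes "null_in_prob M X"
  shows "null_in_prob M (\<lambda>n \<omega>. - X n \<omega>)"
  by (rule null_in_prob_mono[OF assms]) simp

lemma null_in_prob_diff:
  assumes "null_in_prob M X" "null_in_prob M Y"
  shows "null_in_prob M (\<lambda>n \<omega>. X n \<omega> - Y n \<omega>)"
  using null_in_prob_add[OF assms(1) null_in_prob_minus[OF assms(2)]] by simp

lemma null_in_prob_mult_bounded:
  assumes "null_in_prob M X" "bounded_in_prob M Y"
  shows "null_in_prob M (\<lambda>n \<omega>. X n \<omega> * Y n \<omega>)"
  unfolding null_in_prob_def
proof (intro allI impI)
  fix \<epsilon> \<eta> :: real assume *: "\<epsilon> > 0" "\<eta> > 0"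
  then obtain C where C: "eventually (\<lambda>n. mostly M (\<eta>/2) (\<lambda>\<omega>. \<bar>Y n \<omega>\<bar> \<le> C)) sequentially"
    using assms(2) unfolding bounded_in_prob_def by (meson half_gt_zero)
  \<comment> \<open>The absolute value allows a \<open>C\<close> of any sign, the \<open>+ 1\<close>
    allows \<open>C = 0\<close>.\<close>
  define \<delta> where "\<delta> = \<epsilon> / (\<bar>C\<bar> + 1)"
  have "\<delta> > 0" "\<delta> * \<bar>C\<bar> \<le> \<epsilon>" using * by (auto simp: \<delta>_def field_simps)
  have "eventually (\<lambda>n. mostly M (\<eta>/2) (\<lambda>\<omega>. \<bar>X n \<omega>\<bar> \<le> \<delta>)) sequentially"
    using assms(1) * \<open>\<delta> > 0\<close> unfolding null_in_prob_def by (meson half_gt_zero)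
  with C show "eventually (\<lambda>n. mostly M \<eta> (\<lambda>\<omega>. \<bar>X n \<omega> * Y n \<omega>\<bar> \<le> \<epsilon>)) sequentially"
  proof eventually_elim
    case (elim n)
    have "\<bar>x * y\<bar> \<le> \<epsilon>" if "\<bar>y\<bar> \<le> C" "\<bar>x\<bar> \<le> \<delta>" for x y
    proof -
      have "\<bar>x * y\<bar> \<le> \<delta> * \<bar>C\<bar>"
        unfolding abs_mult by (rule mult_mono) (use that \<open>\<delta> > 0\<close> in auto)
      then show ?thesis using \<open>\<delta> * \<bar>C\<bar> \<le> \<epsilon>\<close> by linarith
    qed
    then show ?case
      by (intro mostly_conj_mono[OF elim]) auto
  qed
qed

text \<open>No sign condition appears because \<open>sqrt\<close> is an odd function on the reals
  here.\<close>

lemma null_in_prob_sqrt: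
  assumes "null_in_prob M X"
  shows "null_in_prob M (\<lambda>n \<omega>. sqrt (X n \<omega>))"
  unfolding null_in_prob_def
proof (intro allI impI)
  fix \<epsilon> \<eta> :: real assume *: "\<epsilon> > 0" "\<eta> > 0"
  then have "eventually (\<lambda>n. mostly M \<eta> (\<lambda>\<omega>. \<bar>X n \<omega>\<bar> \<le> \<epsilon>\<^sup>2)) sequentially"
    using assms unfolding null_in_prob_def by auto
  then show "eventually (\<lambda>n. mostly M \<eta> (\<lambda>\<omega>. \<bar>sqrt (X n \<omega>)\<bar> \<le> \<epsilon>)) sequentially"
  proof eventually_elim
    case (elim n)
    have "\<bar>sqrt x\<bar> \<le> \<epsilon>" if "\<bar>x\<bar> \<le> \<epsilon>\<^sup>2" for x
    proof -
      have "\<bar>sqrt x\<bar> = sqrt \<bar>x\<bar>"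
        by (cases "x \<ge> 0") (auto simp: real_sqrt_minus)
      also have "\<dots> \<le> \<epsilon>"
        using real_sqrt_le_mono[OF that] * by simp
      finally show ?thesis .
    qed
    then show ?case
      by (intro mostly_mono[OF elim]) auto
  qed
qed

lemma bounded_in_prob_add:
  assumes "bounded_in_prob M X" "bounded_in_prob M Y"
  shows "bounded_in_prob M (\<lambda>n \<omega>. X n \<omega> + Y n \<omega>)"
  unfolding bounded_in_prob_def
proof (intro allI impI)
  fix \<eta> :: real assume *: "\<eta> > 0"
  obtain C D where "eventually (\<lambda>n. mostly M (\<eta>/2) (\<lambda>\<omega>. \<bar>X n \<omega>\<bar> \<le> C)) sequentially"
    "eventually (\<lambda>n. mostly M (\<eta>/2) (\<lambda>\<omega>. \<bar>Y n \<omega>\<bar> \<le> D)) sequentially"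
    using assms * unfolding bounded_in_prob_def by (meson half_gt_zero)
  then have "eventually (\<lambda>n. mostly M \<eta> (\<lambda>\<omega>. \<bar>X n \<omega> + Y n \<omega>\<bar> \<le> C + D)) sequentially"
    by eventually_elim (erule mostly_conj_mono, assumption, auto)
  then show "\<exists>C. eventually (\<lambda>n. mostly M \<eta> (\<lambda>\<omega>. \<bar>X n \<omega> + Y n \<omega>\<bar> \<le> C)) sequentially"
    by blast
qed

lemma null_in_prob_bounded:
  assumes "null_in_prob M X"
  shows "bounded_in_prob M X"
  unfolding bounded_in_prob_def
proof (intro allI impI exI)
  fix \<eta> :: real assume "\<eta> > 0"
  then show "eventually (\<lambda>n. mostly M \<eta> (\<lambda>\<omega>. \<bar>X n \<omega>\<bar> \<le> 1)) sequentially"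
    using assms unfolding null_in_prob_def by simp
qed

text \<open>Tightness of one random variable: the events where its modulus exceeds \<open>n\<close>
  decrease to the empty set.\<close>

lemma mostly_bounded:
  fixes X :: "'a \<Rightarrow> real"
  assumes [measurable]: "X \<in> borel_measurable M" and "\<eta> > 0"
  shows "\<exists>C>0. mostly M \<eta> (\<lambda>\<omega>. \<bar>X \<omega>\<bar> \<le> C)"
proof -
  define A where "A n = {\<omega> \<in> space M. \<bar>X \<omega>\<bar> > real n}" for n
  have [measurable]: "A n \<in> sets M" for n unfolding A_def by measurable
  have "decseq A" unfolding A_def by (rule decseq_SucI) auto
  have "(\<Inter>n. A n) = {}"
    unfolding A_def by (auto simp: not_less) (meson not_less real_arch_simple)
  then have "(\<lambda>n. measure M (A n)) \<longlonglongrightarrow> 0"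
    using finite_Lim_measure_decseq[of A, OF _ \<open>decseq A\<close>] by (simp add: image_subset_iff)
  then have "eventually (\<lambda>n. measure M (A n) < \<eta>) sequentially"
    using \<open>\<eta> > 0\<close> by (rule order_tendstoD(2))
  then obtain n where n: "measure M (A n) < \<eta>"
    using eventually_happens'[OF sequentially_bot] by blast
  have "mostly M \<eta> (\<lambda>\<omega>. \<bar>X \<omega>\<bar> \<le> real n + 1)"
    unfolding mostly_def using n by (intro bexI[of _ "A n"]) (auto simp: A_def)
  then show ?thesis by (intro exI[of _ "real n + 1"]) auto
qed

lemma bounded_in_prob_const:
  assumes "X \<in> borel_measurable M"
  shows "bounded_in_prob M (\<lambda>n. X)"
  unfolding bounded_in_prob_def
proof (intro allI impI)
  fix \<eta> :: real assume "\<eta> > 0"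
  from mostly_bounded[OF assms this] obtain C where "mostly M \<eta> (\<lambda>\<omega>. \<bar>X \<omega>\<bar> \<le> C)" by auto
  then show "\<exists>C. eventually (\<lambda>n::nat. mostly M \<eta> (\<lambda>\<omega>. \<bar>X \<omega>\<bar> \<le> C)) sequentially"
    by (intro exI[of _ C]) simp
qed

text \<open>The tail events \<open>A n\<close> decrease to the empty set; measurability of each
  \<open>X n\<close> makes them events.\<close>

lemma null_in_prob_pathwise:
  assumes [measurable]: "\<And>n. X n \<in> borel_measurable M"
    and lim: "\<And>\<omega>. \<omega> \<in> space M \<Longrightarrow> (\<lambda>n. X n \<omega>) \<longlonglongrightarrow> 0"
  shows "null_in_prob M X"
  unfolding null_in_prob_def
proof (intro allI impI)
  fix \<epsilon> \<eta> :: real assume *: "\<epsilon> > 0" "\<eta> > 0"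
  define A where "A n = {\<omega> \<in> space M. \<exists>j\<ge>n. \<bar>X j \<omega>\<bar> > \<epsilon>}" for n
  have [measurable]: "A n \<in> sets M" for n unfolding A_def by measurable
  have "decseq A" unfolding A_def by (rule decseq_SucI) (auto, meson Suc_leD)
  have "\<exists>n. \<forall>j\<ge>n. \<bar>X j \<omega>\<bar> \<le> \<epsilon>" if "\<omega> \<in> space M" for \<omega>
    using LIMSEQ_D[OF lim[OF that] *(1)] by (auto intro: less_imp_le)
  then have "(\<Inter>n. A n) = {}"
    unfolding A_def by (auto simp: not_less) (meson not_le)
  then have "(\<lambda>n. measure M (A n)) \<longlonglongrightarrow> 0"
    using finite_Lim_measure_decseq[of A, OF _ \<open>decseq A\<close>] by (simp add: image_subset_iff)
  then have "eventually (\<lambda>n. measure M (A n) < \<eta>) sequentially"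
    using \<open>\<eta> > 0\<close> by (rule order_tendstoD(2))
  then show "eventually (\<lambda>n. mostly M \<eta> (\<lambda>\<omega>. \<bar>X n \<omega>\<bar> \<le> \<epsilon>)) sequentially"
  proof eventually_elim
    case (elim n)
    then show ?case
      unfolding mostly_def by (intro bexI[of _ "A n"]) (auto simp: A_def not_less)
  qed
qed

text \<open>This is how limits in probability become almost sure identities: the difference of two
  limits of one sequence appears as a constant sequence.\<close>

lemma null_in_prob_const:
  assumes "null_in_prob M (\<lambda>n. X)"
  shows "AE \<omega> in M. X \<omega> = 0"
proof -
  have "AE \<omega> in M. \<bar>X \<omega>\<bar> \<le> inverse (real (Suc k))" for k
  proof (rule AE_mostly)
    fix \<eta> :: real assume "\<eta> > 0"
    then have "eventually (\<lambda>n::nat. mostly M \<eta> (\<lambda>\<omega>. \<bar>X \<omega>\<bar> \<le> inverse (Suc k))) sequentially"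
      using assms unfolding null_in_prob_def by (meson inverse_positive_iff_positive of_nat_0_less_iff zero_less_Suc)
    then show "mostly M \<eta> (\<lambda>\<omega>. \<bar>X \<omega>\<bar> \<le> inverse (real (Suc k)))"
      using eventually_happens'[OF sequentially_bot] by blast
  qed
  then have "AE \<omega> in M. \<forall>k. \<bar>X \<omega>\<bar> \<le> inverse (real (Suc k))"
    by (simp add: AE_all_countable)
  then show ?thesis
  proof eventually_elim
    case (elim \<omega>)
    then have "\<bar>X \<omega>\<bar> \<le> 0"
      by (intro LIMSEQ_le_const[OF LIMSEQ_inverse_real_of_nat]) auto
    then show ?case by simp
  qed
qed

lemma null_in_prob_AE_cong:
  assumes "null_in_prob M X" "\<And>n. AE \<omega> in M. Y n \<omega> = X n \<omega>"
  shows "null_in_prob M Y"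
  unfolding null_in_prob_def
proof (intro allI impI)
  fix \<epsilon> \<eta> :: real assume "\<epsilon> > 0" "\<eta> > 0"
  then have "eventually (\<lambda>n. mostly M \<eta> (\<lambda>\<omega>. \<bar>X n \<omega>\<bar> \<le> \<epsilon>)) sequentially"
    using assms(1) unfolding null_in_prob_def by blast
  then show "eventually (\<lambda>n. mostly M \<eta> (\<lambda>\<omega>. \<bar>Y n \<omega>\<bar> \<le> \<epsilon>)) sequentially"
  proof eventually_elim
    case (elim n)
    then show ?case
      by (rule mostly_conj_mono[OF _ mostly_AE[OF assms(2)[of n] order_refl]]) auto
  qed
qed

end

text \<open>With \<open>tendsto_mostly\<close>, the passage between \<open>mostly\<close> and the
  convergence of measures in \<open>has_ito_integral\<close>. In this direction the event may be
  non-measurable, since it lies inside a small measurable one.\<close>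

lemma (in finite_measure) mostly_tendsto:
  assumes "\<And>\<eta>. \<eta> > 0 \<Longrightarrow> eventually (\<lambda>n. mostly M \<eta> (Q n)) sequentially"
  shows "(\<lambda>n. measure M {\<omega> \<in> space M. \<not> Q n \<omega>}) \<longlonglongrightarrow> 0"
proof (rule tendstoI)
  fix e :: real assume "e > 0"
  then have "eventually (\<lambda>n. mostly M (e / 2) (Q n)) sequentially" using assms[of "e / 2"] by simp
  then show "eventually (\<lambda>n. dist (measure M {\<omega> \<in> space M. \<not> Q n \<omega>}) 0 < e) sequentially"
  proof eventually_elim
    case (elim n)
    from mostly_measure[OF this] show ?case using \<open>e > 0\<close> measure_nonneg[of M] by (simp add: abs_of_nonneg)
  qed
qed

lemma tendsto_mostly:
  assumes "(\<lambda>n. measure M {\<omega> \<in> space M. \<not> Q n \<omega>}) \<longlonglongrightarrow> 0" "\<And>n. {\<omega> \<in> space M. \<not> Q n \<omega>} \<in> sets M" "\<eta> > 0"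
  shows "eventually (\<lambda>n. mostly M \<eta> (Q n)) sequentially"
  using order_tendstoD(2)[OF assms(1,3)]
proof eventually_elim
  case (elim n)
  then show ?case by (intro measure_mostly assms(2)) simp
qed

lemma (in finite_measure) null_in_prob_eventually_cong:
  assumes "null_in_prob M X" "eventually (\<lambda>n. \<forall>\<omega>\<in>space M. Y n \<omega> = X n \<omega>) sequentially"
  shows "null_in_prob M Y"
  unfolding null_in_prob_def
proof (intro allI impI)
  fix \<epsilon> \<eta> :: real assume "\<epsilon> > 0" "\<eta> > 0"
  then have "eventually (\<lambda>n. mostly M \<eta> (\<lambda>\<omega>. \<bar>X n \<omega>\<bar> \<le> \<epsilon>)) sequentially"
    using assms(1) unfolding null_in_prob_def by simp
  with assms(2) show "eventually (\<lambda>n. mostly M \<eta> (\<lambda>\<omega>. \<bar>Y n \<omega>\<bar> \<le> \<epsilon>)) sequentially"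
  proof eventually_elim
    case (elim n)
    from elim(2) show ?case by (rule mostly_mono) (use elim(1) in auto)
  qed
qed

lemma (in finite_measure) bounded_in_prob_mult:
  assumes "bounded_in_prob M X" "bounded_in_prob M Y"
  shows "bounded_in_prob M (\<lambda>n \<omega>. X n \<omega> * Y n \<omega>)"
  unfolding bounded_in_prob_def
proof (intro allI impI)
  fix \<eta> :: real assume *: "\<eta> > 0"
  obtain C D where "eventually (\<lambda>n. mostly M (\<eta>/2) (\<lambda>\<omega>. \<bar>X n \<omega>\<bar> \<le> C)) sequentially"
    "eventually (\<lambda>n. mostly M (\<eta>/2) (\<lambda>\<omega>. \<bar>Y n \<omega>\<bar> \<le> D)) sequentially"
    using assms * unfolding bounded_in_prob_def by (meson half_gt_zero)
  then have "eventually (\<lambda>n. mostly M \<eta> (\<lambda>\<omega>. \<bar>X n \<omega> * Y n \<omega>\<bar> \<le> C * D)) sequentially"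
  proof eventually_elim
    case (elim n)
    show ?case
      by (rule mostly_conj_mono[OF elim]) (auto simp: abs_mult intro!: mult_mono order_trans[OF abs_ge_zero])
  qed
  then show "\<exists>C. eventually (\<lambda>n. mostly M \<eta> (\<lambda>\<omega>. \<bar>X n \<omega> * Y n \<omega>\<bar> \<le> C)) sequentially"
    by (rule exI)
qed

section \<open>A Chebyshev inequality for martingale transforms\<close>

context prob_space
begin

text \<open>Translates the form of \<open>independent_increments\<close> into
  \<open>indep_var\<close>. The preimages under \<open>Y\<close> already form a sigma algebra, so
  passing to the generated one adds nothing.\<close>

lemma indep_var_subalgebra:
  fixes X Y :: "'a \<Rightarrow> real"
  assumes G: "subalgebra M G" and X: "X \<in> borel_measurable G" and Y: "Y \<in> borel_measurable M"
    and indep: "indep_set (sets G) {Y -` B \<inter> space M | B. B \<in> sets borel}"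
  shows "indep_var borel X borel Y"
proof -
  have sp: "space G = space M" using G by (simp add: subalgebra_def)
  let ?X = "sigma_sets (space M) {X -` A \<inter> space M | A. A \<in> sets borel}"
  let ?Y = "sigma_sets (space M) {Y -` A \<inter> space M | A. A \<in> sets borel}"
  have 1: "?X \<subseteq> sets G"
    unfolding sp[symmetric] by (rule sets.sigma_sets_subset) (use X in \<open>auto intro: measurable_sets\<close>)
  have "sets (vimage_algebra (space M) Y borel) = {Y -` B \<inter> space M | B. B \<in> sets borel}"
    by (rule sets_vimage_algebra2) auto
  then have 2: "?Y = {Y -` B \<inter> space M | B. B \<in> sets borel}"
    using sets.sigma_sets_eq[of "vimage_algebra (space M) Y borel"] by simp
  have "indep_set ?X ?Y"
    unfolding 2 indep_set_def
    by (rule indep_sets_mono_sets[OF indep[unfolded indep_set_def]]) (use 1 in \<open>auto split: bool.split\<close>)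
  then show ?thesis
    unfolding indep_var_eq using measurable_from_subalg[OF G X] Y by (intro conjI)
qed

text \<open>Discrete Ito isometry. In the induction step the cross term has mean zero, because the
  past sum times \<open>\<xi> n\<close> is \<open>G n\<close> measurable while
  \<open>\<zeta> n\<close> is centred and independent of \<open>G n\<close>. The bounds
  \<open>C i\<close> provide the integrability of the products.\<close>

lemma martingale_transform_second_moment:
  fixes \<xi> \<zeta> :: "nat \<Rightarrow> 'a \<Rightarrow> real" and v :: "nat \<Rightarrow> real"
  assumes sub: "\<And>i. i \<le> n \<Longrightarrow> subalgebra M (G i)"
    and mono: "\<And>i. i < n \<Longrightarrow> sets (G i) \<subseteq> sets (G (Suc i))"
    and \<xi>: "\<And>i. i < n \<Longrightarrow> \<xi> i \<in> borel_measurable (G i)" "\<And>i \<omega>. i < n \<Longrightarrow> \<omega> \<in> space M \<Longrightarrow> \<bar>\<xi> i \<omega>\<bar> \<le> C i"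
    and \<zeta>: "\<And>i. i < n \<Longrightarrow> \<zeta> i \<in> borel_measurable (G (Suc i))"
    and indep: "\<And>i. i < n \<Longrightarrow> indep_set (sets (G i)) {\<zeta> i -` B \<inter> space M | B. B \<in> sets borel}"
    and mom: "\<And>i. i < n \<Longrightarrow> integrable M (\<lambda>\<omega>. (\<zeta> i \<omega>)\<^sup>2)" "\<And>i. i < n \<Longrightarrow> expectation (\<zeta> i) = 0"
      "\<And>i. i < n \<Longrightarrow> expectation (\<lambda>\<omega>. (\<zeta> i \<omega>)\<^sup>2) = v i"
  shows "(\<lambda>\<omega>. \<Sum>i<n. \<xi> i \<omega> * \<zeta> i \<omega>) \<in> borel_measurable (G n) \<and>
     integrable M (\<lambda>\<omega>. (\<Sum>i<n. \<xi> i \<omega> * \<zeta> i \<omega>)\<^sup>2) \<and>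
     expectation (\<lambda>\<omega>. (\<Sum>i<n. \<xi> i \<omega> * \<zeta> i \<omega>)\<^sup>2) = expectation (\<lambda>\<omega>. \<Sum>i<n. (\<xi> i \<omega>)\<^sup>2 * v i)"
  using assms
proof (induction n)
  case 0
  then show ?case by simp
next
  case (Suc n)
  define S where "S \<omega> = (\<Sum>i<n. \<xi> i \<omega> * \<zeta> i \<omega>)" for \<omega>
  have IH: "S \<in> borel_measurable (G n)" "integrable M (\<lambda>\<omega>. (S \<omega>)\<^sup>2)"
    "expectation (\<lambda>\<omega>. (S \<omega>)\<^sup>2) = expectation (\<lambda>\<omega>. \<Sum>i<n. (\<xi> i \<omega>)\<^sup>2 * v i)"
    unfolding S_def using Suc.IH Suc.prems by auto
  have sub: "subalgebra M (G n)" "subalgebra M (G (Suc n))" "subalgebra (G (Suc n)) (G n)"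
    using Suc.prems(1)[of n] Suc.prems(1)[of "Suc n"] Suc.prems(2)[of n] by (auto simp: subalgebra_def)
  have \<xi>n: "\<xi> n \<in> borel_measurable (G n)" using Suc.prems by auto
  have [measurable]: "\<xi> n \<in> borel_measurable M" "S \<in> borel_measurable M" "\<zeta> n \<in> borel_measurable M"
    using measurable_from_subalg[OF sub(1)] measurable_from_subalg[OF sub(2)] \<xi>n IH Suc.prems(5)[of n] by auto
  have ind: "indep_set (sets (G n)) {\<zeta> n -` B \<inter> space M | B. B \<in> sets borel}"
    using Suc.prems(6)[of n] by auto
  have \<zeta>sq: "integrable M (\<lambda>\<omega>. (\<zeta> n \<omega>)\<^sup>2)" and \<zeta>0: "expectation (\<zeta> n) = 0"
    and \<zeta>v: "expectation (\<lambda>\<omega>. (\<zeta> n \<omega>)\<^sup>2) = v n"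
    using Suc.prems by auto
  have \<zeta>i: "integrable M (\<zeta> n)"
    using square_integrable_imp_integrable[OF _ \<zeta>sq] by simp
  have Si: "integrable M S"
    using square_integrable_imp_integrable[OF _ IH(2)] by simp
  have bd: "\<And>\<omega>. \<omega> \<in> space M \<Longrightarrow> \<bar>\<xi> n \<omega>\<bar> \<le> C n" using Suc.prems(4) by auto
  have \<xi>i: "integrable M (\<lambda>\<omega>. (\<xi> n \<omega>)\<^sup>2)" "integrable M (\<lambda>\<omega>. \<xi> n \<omega>)"
  proof -
    have "AE \<omega> in M. norm ((\<xi> n \<omega>)\<^sup>2) \<le> (C n)\<^sup>2"
      using bd by (intro AE_I2) (simp add: abs_le_square_iff[symmetric] order_trans[OF _ abs_ge_self])
    then show "integrable M (\<lambda>\<omega>. (\<xi> n \<omega>)\<^sup>2)"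
      by (intro integrable_const_bound) auto
    show "integrable M (\<lambda>\<omega>. \<xi> n \<omega>)"
      by (rule integrable_const_bound[of _ "C n"]) (auto intro!: AE_I2 bd)
  qed
  have S\<xi>: "integrable M (\<lambda>\<omega>. S \<omega> * \<xi> n \<omega>)"
  proof (rule Bochner_Integration.integrable_bound[where f="\<lambda>\<omega>. C n * S \<omega>"])
    show "AE \<omega> in M. norm (S \<omega> * \<xi> n \<omega>) \<le> norm (C n * S \<omega>)"
    proof (rule AE_I2)
      fix \<omega> assume "\<omega> \<in> space M"
      then have "\<bar>\<xi> n \<omega>\<bar> \<le> \<bar>C n\<bar>" using bd[of \<omega>] by linarith
      then show "norm (S \<omega> * \<xi> n \<omega>) \<le> norm (C n * S \<omega>)"
        by (simp add: abs_mult mult.commute[of _ "\<bar>S \<omega>\<bar>"] mult_left_mono)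
    qed
    show "integrable M (\<lambda>\<omega>. C n * S \<omega>)" using Si by simp
    show "(\<lambda>\<omega>. S \<omega> * \<xi> n \<omega>) \<in> borel_measurable M" by measurable
  qed
  have S\<xi>m: "(\<lambda>\<omega>. S \<omega> * \<xi> n \<omega>) \<in> borel_measurable (G n)" using IH(1) \<xi>n by (rule borel_measurable_times)
  have "indep_var borel (\<lambda>\<omega>. S \<omega> * \<xi> n \<omega>) borel (\<zeta> n)"
    by (rule indep_var_subalgebra[OF sub(1) S\<xi>m _ ind]) simp
  note cross = indep_var_integrable[OF this S\<xi> \<zeta>i] indep_var_lebesgue_integral[OF this S\<xi> \<zeta>i]
  have "indep_var borel (\<xi> n) borel (\<zeta> n)"
    by (rule indep_var_subalgebra[OF sub(1) \<xi>n _ ind]) simp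
  then have "indep_var borel ((\<lambda>x. x\<^sup>2) \<circ> \<xi> n) borel ((\<lambda>x. x\<^sup>2) \<circ> \<zeta> n)"
    by (rule indep_var_compose) auto
  then have "indep_var borel (\<lambda>\<omega>. (\<xi> n \<omega>)\<^sup>2) borel (\<lambda>\<omega>. (\<zeta> n \<omega>)\<^sup>2)"
    by (simp add: comp_def)
  note sq = indep_var_integrable[OF this \<xi>i(1) \<zeta>sq] indep_var_lebesgue_integral[OF this \<xi>i(1) \<zeta>sq]
  have eq: "(\<Sum>i<Suc n. \<xi> i \<omega> * \<zeta> i \<omega>)\<^sup>2
      = (S \<omega>)\<^sup>2 + (2 * ((S \<omega> * \<xi> n \<omega>) * \<zeta> n \<omega>) + (\<xi> n \<omega>)\<^sup>2 * (\<zeta> n \<omega>)\<^sup>2)" for \<omega>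
    by (simp add: S_def power2_eq_square algebra_simps)
  have \<xi>2: "integrable M (\<lambda>\<omega>. (\<xi> i \<omega>)\<^sup>2 * v i)" if "i < Suc n" for i
  proof -
    have [measurable]: "\<xi> i \<in> borel_measurable M"
      by (rule measurable_from_subalg[OF Suc.prems(1)[of i] Suc.prems(3)[OF that]]) (use that in simp)
    have "AE \<omega> in M. norm ((\<xi> i \<omega>)\<^sup>2) \<le> (C i)\<^sup>2"
      using Suc.prems(4)[OF that]
      by (intro AE_I2) (simp add: abs_le_square_iff[symmetric] order_trans[OF _ abs_ge_self])
    then have "integrable M (\<lambda>\<omega>. (\<xi> i \<omega>)\<^sup>2)"
      by (intro integrable_const_bound) auto
    then show ?thesis by auto
  qed
  have "(\<lambda>\<omega>. S \<omega> + \<xi> n \<omega> * \<zeta> n \<omega>) \<in> borel_measurable (G (Suc n))"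
    using measurable_from_subalg[OF sub(3)] IH(1) \<xi>n Suc.prems(5)[of n]
    by (intro borel_measurable_add borel_measurable_times) auto
  then have 1: "(\<lambda>\<omega>. \<Sum>i<Suc n. \<xi> i \<omega> * \<zeta> i \<omega>) \<in> borel_measurable (G (Suc n))"
    by (simp add: S_def)
  have 2: "integrable M (\<lambda>\<omega>. (\<Sum>i<Suc n. \<xi> i \<omega> * \<zeta> i \<omega>)\<^sup>2)"
    unfolding eq using IH cross sq by (intro Bochner_Integration.integrable_add) auto
  have 3: "expectation (\<lambda>\<omega>. (\<Sum>i<Suc n. \<xi> i \<omega> * \<zeta> i \<omega>)\<^sup>2)
      = expectation (\<lambda>\<omega>. (S \<omega>)\<^sup>2) + expectation (\<lambda>\<omega>. (\<xi> n \<omega>)\<^sup>2) * v n"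
    unfolding eq using IH cross sq \<zeta>0 \<zeta>v by simp
  have sum: "expectation (\<lambda>\<omega>. \<Sum>i<k. (\<xi> i \<omega>)\<^sup>2 * v i) = (\<Sum>i<k. expectation (\<lambda>\<omega>. (\<xi> i \<omega>)\<^sup>2) * v i)"
    if "k \<le> Suc n" for k
    using \<xi>2 that by (subst Bochner_Integration.integral_sum) auto
  have 4: "expectation (\<lambda>\<omega>. (\<Sum>i<Suc n. \<xi> i \<omega> * \<zeta> i \<omega>)\<^sup>2)
      = expectation (\<lambda>\<omega>. \<Sum>i<Suc n. (\<xi> i \<omega>)\<^sup>2 * v i)"
    unfolding 3 IH(3) sum[OF order_refl] sum[OF le_SucI[OF order_refl]] by simp
  show ?case by (intro conjI 1 2 4)
qed

text \<open>The coefficients are stopped as soon as their quadratic sum exceeds \<open>\<delta>\<close>.\<close>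

lemma martingale_transform_mostly:
  fixes \<xi> \<zeta> :: "nat \<Rightarrow> 'a \<Rightarrow> real" and v :: "nat \<Rightarrow> real"
  assumes sub: "\<And>i. i \<le> n \<Longrightarrow> subalgebra M (G i)"
    and mono: "\<And>i. i < n \<Longrightarrow> sets (G i) \<subseteq> sets (G (Suc i))"
    and \<xi>: "\<And>i. i < n \<Longrightarrow> \<xi> i \<in> borel_measurable (G i)"
    and \<zeta>: "\<And>i. i < n \<Longrightarrow> \<zeta> i \<in> borel_measurable (G (Suc i))"
    and indep: "\<And>i. i < n \<Longrightarrow> indep_set (sets (G i)) {\<zeta> i -` B \<inter> space M | B. B \<in> sets borel}"
    and mom: "\<And>i. i < n \<Longrightarrow> integrable M (\<lambda>\<omega>. (\<zeta> i \<omega>)\<^sup>2)" "\<And>i. i < n \<Longrightarrow> expectation (\<zeta> i) = 0"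
      "\<And>i. i < n \<Longrightarrow> expectation (\<lambda>\<omega>. (\<zeta> i \<omega>)\<^sup>2) = v i"
    and v0: "\<And>i. i < n \<Longrightarrow> v i \<ge> 0" "\<And>i \<omega>. i < n \<Longrightarrow> v i = 0 \<Longrightarrow> \<omega> \<in> space M \<Longrightarrow> \<zeta> i \<omega> = 0"
    and small: "mostly M \<eta> (\<lambda>\<omega>. (\<Sum>i<n. (\<xi> i \<omega>)\<^sup>2 * v i) \<le> \<delta>)"
    and pos: "\<delta> > 0" "\<epsilon> > 0"
  shows "mostly M (\<eta> + \<delta> / \<epsilon>\<^sup>2) (\<lambda>\<omega>. \<bar>\<Sum>i<n. \<xi> i \<omega> * \<zeta> i \<omega>\<bar> \<le> \<epsilon>)"
proof -
  \<comment> \<open>The partial sum includes index \<open>i\<close> itself. It is still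
    \<open>G i\<close> measurable, and therefore the terms kept below never sum to more than
    \<open>\<delta>\<close>.\<close>
  define q where "q i \<omega> = (\<Sum>j<Suc i. (\<xi> j \<omega>)\<^sup>2 * v j)" for i \<omega>
  \<comment> \<open>Dropping the terms with \<open>v i = 0\<close> keeps \<open>X i\<close> bounded
    by \<open>sqrt (\<delta> / v i)\<close>; by \<open>v0\<close> such terms contribute nothing to
    the transform.\<close>
  define X where "X i \<omega> = (if q i \<omega> \<le> \<delta> \<and> v i \<noteq> 0 then \<xi> i \<omega> else 0)" for i \<omega>
  have subij: "subalgebra (G i) (G j)" if "j \<le> i" "i \<le> n" for i j
    using that
  proof (induction i rule: dec_induct)
    case base then show ?case by (simp add: subalgebra_def)
  next
    case (step i)
    then show ?case using mono[of i] sub[of i] sub[of "Suc i"] unfolding subalgebra_def by auto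
  qed
  have \<xi>ij: "\<xi> j \<in> borel_measurable (G i)" if "j \<le> i" "i < n" for i j
    using measurable_from_subalg[OF subij[of j i]] \<xi>[of j] that by auto
  have q[measurable]: "q i \<in> borel_measurable (G i)" if "i < n" for i
    unfolding q_def using that \<xi>ij[of _ i] by (intro borel_measurable_sum borel_measurable_times borel_measurable_power) auto
  have X: "X i \<in> borel_measurable (G i)" if "i < n" for i
    unfolding X_def using q[OF that] \<xi>[OF that] by measurable
  have q0: "(\<xi> i \<omega>)\<^sup>2 * v i \<le> q i \<omega>" if "i < n" for i \<omega>
    unfolding q_def using that v0(1) by (auto intro!: sum_nonneg)
  have Xb: "\<bar>X i \<omega>\<bar> \<le> sqrt (\<delta> / v i)" if "i < n" for i \<omega>
  proof (cases "q i \<omega> \<le> \<delta> \<and> v i \<noteq> 0")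
    case True
    then have "v i > 0" using v0(1)[OF that] by auto
    have "(\<xi> i \<omega>)\<^sup>2 \<le> \<delta> / v i"
      using q0[OF that, of \<omega>] True \<open>v i > 0\<close> by (simp add: field_simps)
    then show ?thesis using True by (simp add: X_def real_le_rsqrt)
  next
    case False
    then show ?thesis using pos v0(1)[OF that] by (auto simp: X_def)
  qed
  have le: "(\<Sum>i<m. (X i \<omega>)\<^sup>2 * v i) \<le> \<delta>" if "m \<le> n" for m \<omega>
    using that
  proof (induction m)
    case 0 then show ?case using pos by simp
  next
    case (Suc m)
    show ?case
    proof (cases "q m \<omega> \<le> \<delta>")
      case True
      have "(\<Sum>i<Suc m. (X i \<omega>)\<^sup>2 * v i) \<le> q m \<omega>"
        unfolding q_def by (rule sum_mono) (use Suc.prems v0(1) in \<open>auto simp: X_def\<close>)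
      then show ?thesis using True by linarith
    next
      case False
      then show ?thesis using Suc by (simp add: X_def)
    qed
  qed
  define S where "S \<omega> = (\<Sum>i<n. X i \<omega> * \<zeta> i \<omega>)" for \<omega>
  have SM: "S \<in> borel_measurable (G n)" "integrable M (\<lambda>\<omega>. (S \<omega>)\<^sup>2)"
    "expectation (\<lambda>\<omega>. (S \<omega>)\<^sup>2) = expectation (\<lambda>\<omega>. \<Sum>i<n. (X i \<omega>)\<^sup>2 * v i)"
    using martingale_transform_second_moment[of n G X "\<lambda>i. sqrt (\<delta> / v i)" \<zeta> v, OF sub mono X Xb \<zeta> indep mom]
    unfolding S_def by auto
  have [measurable]: "S \<in> borel_measurable M"
    using measurable_from_subalg[OF sub[of n] SM(1)] by simp
  have "expectation (\<lambda>\<omega>. \<Sum>i<n. (X i \<omega>)\<^sup>2 * v i) \<le> \<delta>"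
  proof -
    have "expectation (\<lambda>\<omega>. \<Sum>i<n. (X i \<omega>)\<^sup>2 * v i) \<le> expectation (\<lambda>\<omega>. \<delta>)"
      by (rule integral_mono') (use le pos v0 in \<open>auto intro!: sum_nonneg\<close>)
    then show ?thesis by (simp add: prob_space)
  qed
  then have Sv: "expectation (\<lambda>\<omega>. (S \<omega>)\<^sup>2) \<le> \<delta>" using SM(3) by simp
  have "prob {\<omega> \<in> space M. (S \<omega>)\<^sup>2 \<ge> \<epsilon>\<^sup>2} \<le> expectation (\<lambda>\<omega>. (S \<omega>)\<^sup>2) / \<epsilon>\<^sup>2"
    by (rule integral_Markov_inequality_measure[where A="space M - {}"]) (use SM pos in auto)
  also have "\<dots> \<le> \<delta> / \<epsilon>\<^sup>2" using Sv pos by (simp add: divide_right_mono)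
  finally have "prob {\<omega> \<in> space M. (S \<omega>)\<^sup>2 \<ge> \<epsilon>\<^sup>2} \<le> \<delta> / \<epsilon>\<^sup>2" .
  moreover have "{\<omega> \<in> space M. (S \<omega>)\<^sup>2 \<ge> \<epsilon>\<^sup>2} \<in> sets M" by measurable
  moreover have "\<bar>S \<omega>\<bar> \<le> \<epsilon>" if "\<not> (S \<omega>)\<^sup>2 \<ge> \<epsilon>\<^sup>2" for \<omega>
    using that pos abs_le_square_iff[of "S \<omega>" \<epsilon>] by auto
  ultimately have *: "mostly M (\<delta> / \<epsilon>\<^sup>2) (\<lambda>\<omega>. \<bar>S \<omega>\<bar> \<le> \<epsilon>)"
    unfolding mostly_def by (intro bexI[of _ "{\<omega> \<in> space M. (S \<omega>)\<^sup>2 \<ge> \<epsilon>\<^sup>2}"]) auto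
  show ?thesis
  proof (rule mostly_conj_mono[OF small *])
    fix \<omega> assume \<omega>: "\<omega> \<in> space M" "(\<Sum>i<n. (\<xi> i \<omega>)\<^sup>2 * v i) \<le> \<delta>" "\<bar>S \<omega>\<bar> \<le> \<epsilon>"
    \<comment> \<open>On the event \<open>small\<close> no coefficient has been stopped, so
      \<open>S\<close> is the original sum.\<close>
    have "q i \<omega> \<le> \<delta>" if "i < n" for i
    proof -
      have "q i \<omega> \<le> (\<Sum>i<n. (\<xi> i \<omega>)\<^sup>2 * v i)"
        unfolding q_def by (rule sum_mono2) (use that v0(1) in auto)
      then show ?thesis using \<omega> by linarith
    qed
    then have "S \<omega> = (\<Sum>i<n. \<xi> i \<omega> * \<zeta> i \<omega>)"
      unfolding S_def using v0(2) \<omega>(1) by (intro sum.cong) (auto simp: X_def)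
    then show "\<bar>\<Sum>i<n. \<xi> i \<omega> * \<zeta> i \<omega>\<bar> \<le> \<epsilon>" using \<omega> by simp
  qed simp
qed

end

section \<open>Increments of the Wiener process\<close>

lemma mono_upto:
  fixes \<tau> :: "nat \<Rightarrow> 'a::order"
  assumes "\<And>i. i < n \<Longrightarrow> \<tau> i \<le> \<tau> (Suc i)" "i \<le> j" "j \<le> n"
  shows "\<tau> i \<le> \<tau> j"
  using assms(2,3)
proof (induction j rule: dec_induct)
  case (step k)
  then have "\<tau> i \<le> \<tau> k" by simp
  also have "\<tau> k \<le> \<tau> (Suc k)" using assms(1)[of k] step by simp
  finally show ?case .
qed simp

context wiener_process
begin

lemma measurable_F_P: "f \<in> borel_measurable (F t) \<Longrightarrow> f \<in> borel_measurable P"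
  by (rule measurable_from_subalg[OF subalgebra_F])

lemma measurable_F_mono:
  assumes "f \<in> borel_measurable (F s)" "s \<le> t"
  shows "f \<in> borel_measurable (F t)"
proof (rule measurable_from_subalg[OF _ assms(1)])
  show "subalgebra (F t) (F s)"
    unfolding subalgebra_def using sets_F_mono[OF assms(2)] by (simp add: space_F)
qed

lemma W_measurable_F: "0 \<le> s \<Longrightarrow> s \<le> t \<Longrightarrow> W s \<in> borel_measurable (F t)"
  using measurable_F_mono[OF adapted] by simp

lemma W_measurable_P: "0 \<le> s \<Longrightarrow> W s \<in> borel_measurable P"
  by (rule measurable_F_P[OF adapted])

text \<open>The fourth moment yields the variance \<open>2 * (t - s)\<^sup>2\<close> of the squared
  increment, which governs the quadratic variation.\<close>

lemma increment_moments:
  assumes st: "0 \<le> s" "s < t"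
  shows increment_integrable_power: "integrable P (\<lambda>\<omega>. (W t \<omega> - W s \<omega>) ^ k)"
    and increment_expectation: "expectation (\<lambda>\<omega>. W t \<omega> - W s \<omega>) = 0"
    and increment_second_moment: "expectation (\<lambda>\<omega>. (W t \<omega> - W s \<omega>)\<^sup>2) = t - s"
    and increment_fourth_moment: "expectation (\<lambda>\<omega>. (W t \<omega> - W s \<omega>) ^ 4) = 3 * (t - s)\<^sup>2"
proof -
  define \<sigma> where "\<sigma> = sqrt (t - s)"
  have \<sigma>: "\<sigma> > 0" "\<sigma>\<^sup>2 = t - s" using st by (auto simp: \<sigma>_def)
  note D = gaussian_increments[OF st, folded \<sigma>_def]
  have nn: "\<And>x. 0 \<le> normal_density 0 \<sigma> x" by simp
  have int: "integrable P (\<lambda>\<omega>. (W t \<omega> - W s \<omega>) ^ k)" for k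
    using distributed_integrable[OF D, of "\<lambda>x. x ^ k"] integrable_normal_moment[OF \<sigma>(1), of 0 k] by simp
  show "integrable P (\<lambda>\<omega>. (W t \<omega> - W s \<omega>) ^ k)" by (rule int)
  have ex: "expectation (\<lambda>\<omega>. (W t \<omega> - W s \<omega>) ^ k) = (\<integral>x. normal_density 0 \<sigma> x * x ^ k \<partial>lborel)" for k
    using distributed_integral[OF D, of "\<lambda>x. x ^ k"] by simp
  show "expectation (\<lambda>\<omega>. W t \<omega> - W s \<omega>) = 0"
    using ex[of 1] integral_normal_moment_odd[OF \<sigma>(1), of 0 0] by simp
  show "expectation (\<lambda>\<omega>. (W t \<omega> - W s \<omega>)\<^sup>2) = t - s"
    using ex[of 2] integral_normal_moment_even[OF \<sigma>(1), of 0 1] \<sigma> by simp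
  show "expectation (\<lambda>\<omega>. (W t \<omega> - W s \<omega>) ^ 4) = 3 * (t - s)\<^sup>2"
    using ex[of 4] integral_normal_moment_even[OF \<sigma>(1), of 0 2] st
    by (simp add: \<sigma>(2) fact_numeral power_divide)
qed

lemma increment_compose_indep:
  assumes st: "0 \<le> s" "s < t" and h: "h \<in> borel_measurable borel"
  shows "indep_set (sets (F s)) {(\<lambda>\<omega>. h (W t \<omega> - W s \<omega>)) -` B \<inter> space P | B. B \<in> sets borel}"
proof -
  have "{(\<lambda>\<omega>. h (W t \<omega> - W s \<omega>)) -` B \<inter> space P | B. B \<in> sets borel}
    \<subseteq> {(\<lambda>\<omega>. W t \<omega> - W s \<omega>) -` B \<inter> space P | B. B \<in> sets borel}"
  proof (rule subsetI)
    fix A assume "A \<in> {(\<lambda>\<omega>. h (W t \<omega> - W s \<omega>)) -` B \<inter> space P | B. B \<in> sets borel}"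
    then obtain B where B: "B \<in> sets borel" "A = (\<lambda>\<omega>. h (W t \<omega> - W s \<omega>)) -` B \<inter> space P" by auto
    have "h -` B \<inter> space borel \<in> sets borel" using h B(1) by (rule measurable_sets)
    moreover have "A = (\<lambda>\<omega>. W t \<omega> - W s \<omega>) -` (h -` B \<inter> space borel) \<inter> space P"
      using B(2) by auto
    ultimately show "A \<in> {(\<lambda>\<omega>. W t \<omega> - W s \<omega>) -` B \<inter> space P | B. B \<in> sets borel}" by auto
  qed
  then show ?thesis
    using independent_increments[OF st] unfolding indep_set_def
    by (elim indep_sets_mono_sets) (auto split: bool.split)
qed

text \<open>For cells of length zero: partitions in \<open>simple_integrand\<close> increase only
  weakly, while \<open>independent_increments\<close> speaks about \<open>s < t\<close>.\<close>

lemma indep_set_trivial: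
  assumes "\<And>\<omega>. \<omega> \<in> space P \<Longrightarrow> Z \<omega> = 0"
  shows "indep_set (sets (F s)) {Z -` B \<inter> space P | B. B \<in> sets borel}"
proof (rule indep_setI)
  have e: "Z -` B \<inter> space P = (if 0 \<in> B then space P else {})" for B
    using assms by auto
  show "sets (F s) \<subseteq> events" using subalgebra_F[of s] by (simp add: subalgebra_def)
  show "{Z -` B \<inter> space P |B. B \<in> sets borel} \<subseteq> events"
    unfolding e by auto
  fix a b assume a: "a \<in> sets (F s)" and "b \<in> {Z -` B \<inter> space P |B. B \<in> sets borel}"
  then have "b = space P \<or> b = {}" unfolding e by (auto split: if_splits)
  moreover have "a \<inter> space P = a" using sets.sets_into_space[OF a] by (auto simp: space_F)
  ultimately show "prob (a \<inter> b) = prob a * prob b" by (auto simp: prob_space)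
qed

text \<open>An inequality of Lenglart type. It replaces the Ito isometry when the quadratic sum of
  the integrand is controlled in probability only.\<close>

lemma wiener_sum_mostly:
  assumes \<tau>: "0 \<le> \<tau> 0" "\<And>i. i < n \<Longrightarrow> \<tau> i \<le> \<tau> (Suc i)"
    and \<xi>: "\<And>i. i < n \<Longrightarrow> \<xi> i \<in> borel_measurable (F (\<tau> i))"
    and small: "mostly P \<eta> (\<lambda>\<omega>. (\<Sum>i<n. (\<xi> i \<omega>)\<^sup>2 * (\<tau> (Suc i) - \<tau> i)) \<le> \<delta>)"
    and pos: "\<delta> > 0" "\<epsilon> > 0"
  shows "mostly P (\<eta> + \<delta> / \<epsilon>\<^sup>2) (\<lambda>\<omega>. \<bar>\<Sum>i<n. \<xi> i \<omega> * (W (\<tau> (Suc i)) \<omega> - W (\<tau> i) \<omega>)\<bar> \<le> \<epsilon>)"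
proof -
  have nonneg: "0 \<le> \<tau> i" if "i \<le> n" for i
    using mono_upto[of n \<tau> 0 i] \<tau> that by simp
  show ?thesis
  proof (rule martingale_transform_mostly[where G="\<lambda>i. F (\<tau> i)", OF _ _ \<xi> _ _ _ _ _ _ _ small pos])
    fix i assume i: "i < n"
    have le: "0 \<le> \<tau> i" "0 \<le> \<tau> (Suc i)" "\<tau> i \<le> \<tau> (Suc i)" using nonneg \<tau>(2) i by auto
    show "sets (F (\<tau> i)) \<subseteq> sets (F (\<tau> (Suc i)))" using sets_F_mono le by simp
    show "(\<lambda>\<omega>. W (\<tau> (Suc i)) \<omega> - W (\<tau> i) \<omega>) \<in> borel_measurable (F (\<tau> (Suc i)))"
      by (intro borel_measurable_diff W_measurable_F le order_refl)
    show "0 \<le> \<tau> (Suc i) - \<tau> i" using le by simp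
    consider "\<tau> i = \<tau> (Suc i)" | "\<tau> i < \<tau> (Suc i)" using le by linarith
    then have "indep_set (sets (F (\<tau> i))) {(\<lambda>\<omega>. W (\<tau> (Suc i)) \<omega> - W (\<tau> i) \<omega>) -` B \<inter> space P |B. B \<in> sets borel}
      \<and> integrable P (\<lambda>\<omega>. (W (\<tau> (Suc i)) \<omega> - W (\<tau> i) \<omega>)\<^sup>2)
      \<and> expectation (\<lambda>\<omega>. W (\<tau> (Suc i)) \<omega> - W (\<tau> i) \<omega>) = 0
      \<and> expectation (\<lambda>\<omega>. (W (\<tau> (Suc i)) \<omega> - W (\<tau> i) \<omega>)\<^sup>2) = \<tau> (Suc i) - \<tau> i"
    proof cases
      case 1
      have "indep_set (sets (F (\<tau> i))) {(\<lambda>\<omega>. W (\<tau> (Suc i)) \<omega> - W (\<tau> i) \<omega>) -` B \<inter> space P |B. B \<in> sets borel}"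
        by (rule indep_set_trivial) (simp add: 1)
      then show ?thesis using 1 by simp
    next
      case 2
      show ?thesis
        by (intro conjI independent_increments increment_moments le(1) 2)
    qed
    then show "indep_set (sets (F (\<tau> i))) {(\<lambda>\<omega>. W (\<tau> (Suc i)) \<omega> - W (\<tau> i) \<omega>) -` B \<inter> space P |B. B \<in> sets borel}"
      "integrable P (\<lambda>\<omega>. (W (\<tau> (Suc i)) \<omega> - W (\<tau> i) \<omega>)\<^sup>2)"
      "expectation (\<lambda>\<omega>. W (\<tau> (Suc i)) \<omega> - W (\<tau> i) \<omega>) = 0"
      "expectation (\<lambda>\<omega>. (W (\<tau> (Suc i)) \<omega> - W (\<tau> i) \<omega>)\<^sup>2) = \<tau> (Suc i) - \<tau> i"
      by auto
  qed (use subalgebra_F in auto)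
qed

text \<open>The compensated squares of the increments are again centred and independent of the past,
  with variance twice the squared step, so the same inequality applies to them.\<close>

lemma wiener_square_sum_mostly:
  assumes \<tau>: "0 \<le> \<tau> 0" "\<And>i. i < n \<Longrightarrow> \<tau> i < \<tau> (Suc i)"
    and \<xi>: "\<And>i. i < n \<Longrightarrow> \<xi> i \<in> borel_measurable (F (\<tau> i))"
    and small: "mostly P \<eta> (\<lambda>\<omega>. (\<Sum>i<n. (\<xi> i \<omega>)\<^sup>2 * (2 * (\<tau> (Suc i) - \<tau> i)\<^sup>2)) \<le> \<delta>)"
    and pos: "\<delta> > 0" "\<epsilon> > 0"
  shows "mostly P (\<eta> + \<delta> / \<epsilon>\<^sup>2)
    (\<lambda>\<omega>. \<bar>\<Sum>i<n. \<xi> i \<omega> * ((W (\<tau> (Suc i)) \<omega> - W (\<tau> i) \<omega>)\<^sup>2 - (\<tau> (Suc i) - \<tau> i))\<bar> \<le> \<epsilon>)"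
proof -
  have nonneg: "0 \<le> \<tau> i" if "i \<le> n" for i
    using mono_upto[of n \<tau> 0 i] \<tau> that by (simp add: less_imp_le)
  show ?thesis
  proof (rule martingale_transform_mostly[where G="\<lambda>i. F (\<tau> i)", OF _ _ \<xi> _ _ _ _ _ _ _ small pos])
    fix i assume i: "i < n"
    have le: "0 \<le> \<tau> i" "0 \<le> \<tau> (Suc i)" "\<tau> i < \<tau> (Suc i)" using nonneg \<tau>(2) i by auto
    define h where "h = \<tau> (Suc i) - \<tau> i"
    let ?w = "\<lambda>\<omega>. W (\<tau> (Suc i)) \<omega> - W (\<tau> i) \<omega>"
    note mom = increment_moments[OF le(1,3)]
    show "sets (F (\<tau> i)) \<subseteq> sets (F (\<tau> (Suc i)))" using sets_F_mono le by simp
    show "(\<lambda>\<omega>. (?w \<omega>)\<^sup>2 - (\<tau> (Suc i) - \<tau> i)) \<in> borel_measurable (F (\<tau> (Suc i)))"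
      by (intro borel_measurable_diff borel_measurable_power W_measurable_F le order_refl borel_measurable_const less_imp_le)
    show "indep_set (sets (F (\<tau> i))) {(\<lambda>\<omega>. (?w \<omega>)\<^sup>2 - (\<tau> (Suc i) - \<tau> i)) -` B \<inter> space P |B. B \<in> sets borel}"
      using increment_compose_indep[OF le(1,3), of "\<lambda>x. x\<^sup>2 - (\<tau> (Suc i) - \<tau> i)"] by simp
    have eq: "((?w \<omega>)\<^sup>2 - (\<tau> (Suc i) - \<tau> i))\<^sup>2 = ?w \<omega> ^ 4 - 2 * h * (?w \<omega>)\<^sup>2 + h\<^sup>2" for \<omega>
      by (simp add: h_def power2_eq_square power4_eq_xxxx algebra_simps)
    show "integrable P (\<lambda>\<omega>. ((?w \<omega>)\<^sup>2 - (\<tau> (Suc i) - \<tau> i))\<^sup>2)"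
      unfolding eq using mom(1)[of 4] mom(1)[of 2] by simp
    show "expectation (\<lambda>\<omega>. (?w \<omega>)\<^sup>2 - (\<tau> (Suc i) - \<tau> i)) = 0"
      using mom(1)[of 2] mom(3) by (simp add: prob_space)
    show "expectation (\<lambda>\<omega>. ((?w \<omega>)\<^sup>2 - (\<tau> (Suc i) - \<tau> i))\<^sup>2) = 2 * (\<tau> (Suc i) - \<tau> i)\<^sup>2"
      unfolding eq using mom(1)[of 4] mom(1)[of 2] mom(3,4)
      by (simp add: prob_space h_def[symmetric]) (simp add: power2_eq_square)
  next
    show "(W (\<tau> (Suc i)) \<omega> - W (\<tau> i) \<omega>)\<^sup>2 - (\<tau> (Suc i) - \<tau> i) = 0"
      if "i < n" "2 * (\<tau> (Suc i) - \<tau> i)\<^sup>2 = 0" for i \<omega>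
      using that \<tau>(2)[of i] by simp
  qed (use subalgebra_F in simp_all)
qed

end

section \<open>Comparison of two simple processes\<close>

text \<open>The intervals are open on the left, so a cell lies inside one exactly if its right end
  point does; what remains telescopes.\<close>

lemma sum_grid_interval:
  fixes p :: "nat \<Rightarrow> real" and w :: "real \<Rightarrow> real"
  assumes p: "\<And>i j. i < j \<Longrightarrow> j \<le> N \<Longrightarrow> p i < p j" and ab: "a \<le> b" "b \<le> N"
  shows "(\<Sum>j<N. indicator {p a<..p b} (p (Suc j)) * (w (p (Suc j)) - w (p j))) = w (p b) - w (p a)"
proof -
  have lt: "p i < p j \<longleftrightarrow> i < j" if "i \<le> N" "j \<le> N" for i j
    using p[of i j] p[of j i] that by (metis less_asym less_irrefl nat_neq_iff)
  have le: "p i \<le> p j \<longleftrightarrow> i \<le> j" if "i \<le> N" "j \<le> N" for i j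
    using lt[OF that(2,1)] by (simp add: not_less[symmetric])
  have "(\<Sum>j<N. indicator {p a<..p b} (p (Suc j)) * (w (p (Suc j)) - w (p j)))
      = (\<Sum>j<N. if j \<in> {a..<b} then w (p (Suc j)) - w (p j) else 0)"
    by (rule sum.cong) (use ab in \<open>auto simp: indicator_def lt le\<close>)
  also have "\<dots> = (\<Sum>j\<in>{a..<b}. w (p (Suc j)) - w (p j))"
    using ab by (subst sum.inter_restrict[symmetric]) (auto intro!: sum.cong)
  also have "\<dots> = w (p b) - w (p a)"
    using ab(1) by (rule sum_Suc_diff')
  finally show ?thesis .
qed

text \<open>Rewrites an elementary integral on a finer partition, so that two simple processes can
  be compared cell by cell. The value on a cell is read off at its right end point.\<close>

lemma simple_integral_refine:
  assumes p: "\<And>i j. i < j \<Longrightarrow> j \<le> N \<Longrightarrow> p i < p j"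
    and sub: "\<tau> ` {..n} \<subseteq> p ` {..N}" and \<tau>: "\<And>i. i < n \<Longrightarrow> \<tau> i \<le> \<tau> (Suc i)"
  shows "simple_integral W n \<tau> \<xi> \<omega>
    = (\<Sum>j<N. simple_process n \<tau> \<xi> (p (Suc j)) \<omega> * (W (p (Suc j)) \<omega> - W (p j) \<omega>))"
proof -
  have "(\<Sum>j<N. indicator {\<tau> i<..\<tau> (Suc i)} (p (Suc j)) * (W (p (Suc j)) \<omega> - W (p j) \<omega>))
      = W (\<tau> (Suc i)) \<omega> - W (\<tau> i) \<omega>" if i: "i < n" for i
  proof -
    have "\<tau> i \<in> p ` {..N}" "\<tau> (Suc i) \<in> p ` {..N}" using sub i by auto
    then obtain a b where ab: "\<tau> i = p a" "\<tau> (Suc i) = p b" "a \<le> N" "b \<le> N" by auto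
    have "a \<le> b"
    proof (rule ccontr)
      assume "\<not> a \<le> b"
      then have "p b < p a" using p[of b a] ab by simp
      then show False using \<tau>[OF i] ab by simp
    qed
    then show ?thesis unfolding ab using sum_grid_interval[of N p a b "\<lambda>t. W t \<omega>", OF p] ab by simp
  qed
  then have "simple_integral W n \<tau> \<xi> \<omega>
      = (\<Sum>i<n. \<Sum>j<N. \<xi> i \<omega> * (indicator {\<tau> i<..\<tau> (Suc i)} (p (Suc j)) * (W (p (Suc j)) \<omega> - W (p j) \<omega>)))"
    unfolding simple_integral_def by (simp flip: sum_distrib_left)
  also have "\<dots> = (\<Sum>j<N. simple_process n \<tau> \<xi> (p (Suc j)) \<omega> * (W (p (Suc j)) \<omega> - W (p j) \<omega>))"
    unfolding simple_process_def by (subst sum.swap) (simp only: sum_distrib_right mult.assoc)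
  finally show ?thesis .
qed

text \<open>No point of \<open>\<tau>\<close> lies strictly between \<open>p j\<close> and
  \<open>p (Suc j)\<close>, so the indicators cannot change inside the cell.\<close>

lemma simple_process_refine:
  assumes p: "\<And>i j. i < j \<Longrightarrow> j \<le> N \<Longrightarrow> p i < p j"
    and sub: "\<tau> ` {..n} \<subseteq> p ` {..N}" and j: "j < N" "p j < s" "s \<le> p (Suc j)"
  shows "simple_process n \<tau> \<xi> s \<omega> = simple_process n \<tau> \<xi> (p (Suc j)) \<omega>"
proof -
  have lt: "x < s \<longleftrightarrow> x < p (Suc j)" if "x \<in> p ` {..N}" for x
  proof -
    obtain a where a: "a \<le> N" "x = p a" using \<open>x \<in> p ` {..N}\<close> by auto
    have "x \<le> p j \<or> p (Suc j) \<le> x"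
      using a p[of a j] p[of "Suc j" a] j(1) by (cases "a < j"; cases "a = j"; cases "a = Suc j") auto
    then show ?thesis using j by linarith
  qed
  have "indicator {\<tau> i<..\<tau> (Suc i)} s = (indicator {\<tau> i<..\<tau> (Suc i)} (p (Suc j)) :: real)" if "i < n" for i
  proof -
    have "\<tau> i \<in> p ` {..N}" "\<tau> (Suc i) \<in> p ` {..N}" using sub that by auto
    from this[THEN lt] show ?thesis by (auto simp: indicator_def not_less[symmetric])
  qed
  then show ?thesis unfolding simple_process_def by simp
qed

text \<open>Although evaluated at the right end point, the value is known at the left one: an
  interval of \<open>\<tau>\<close> that contains \<open>p (Suc j)\<close> starts no later than
  \<open>p j\<close>.\<close>

lemma simple_process_refine_measurable:
  assumes p: "\<And>i j. i < j \<Longrightarrow> j \<le> N \<Longrightarrow> p i < p j"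
    and sub: "\<tau> ` {..n} \<subseteq> p ` {..N}" and j: "j < N"
    and \<xi>: "\<And>i. i < n \<Longrightarrow> \<tau> i \<le> p j \<Longrightarrow> \<xi> i \<in> borel_measurable M"
  shows "simple_process n \<tau> \<xi> (p (Suc j)) \<in> borel_measurable M"
  unfolding simple_process_def
proof (rule borel_measurable_sum)
  fix i assume i: "i \<in> {..<n}"
  show "(\<lambda>\<omega>. \<xi> i \<omega> * indicator {\<tau> i<..\<tau> (Suc i)} (p (Suc j))) \<in> borel_measurable M"
  proof (cases "\<tau> i < p (Suc j)")
    case True
    have "\<tau> i \<in> p ` {..N}" using sub i by auto
    then obtain a where a: "a \<le> N" "\<tau> i = p a" by auto
    have "\<tau> i \<le> p j"
      using a p[of a j] p[of "Suc j" a] j True by (cases "a < j"; cases "a = j"; cases "a = Suc j") auto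
    then show ?thesis using \<xi>[of i] i by simp
  qed simp
qed

text \<open>The sum is the integral of the step function that agrees with \<open>g\<close> on the
  disjoint cells and vanishes elsewhere.\<close>

lemma sum_le_nn_integral_grid:
  fixes p :: "nat \<Rightarrow> real" and g :: "real \<Rightarrow> real"
  assumes p: "\<And>i j. i < j \<Longrightarrow> j \<le> N \<Longrightarrow> p i < p j"
    and g: "\<And>j s. j < N \<Longrightarrow> p j < s \<Longrightarrow> s \<le> p (Suc j) \<Longrightarrow> g s = g (p (Suc j))" "\<And>s. g s \<ge> 0"
    and bnd: "t0 \<le> p 0" "p N \<le> t"
  shows "ennreal (\<Sum>j<N. g (p (Suc j)) * (p (Suc j) - p j)) \<le> (\<integral>\<^sup>+ s\<in>{t0..t}. ennreal (g s) \<partial>lborel)"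
proof -
  have pl: "p i \<le> p j" if "i \<le> j" "j \<le> N" for i j using p[of i j] that by (cases "i = j") auto
  have "ennreal (\<Sum>j<N. g (p (Suc j)) * (p (Suc j) - p j))
      = (\<Sum>j<N. ennreal (g (p (Suc j)) * (p (Suc j) - p j)))"
    by (rule sum_ennreal[symmetric]) (use g(2) pl in auto)
  also have "\<dots> = (\<Sum>j<N. \<integral>\<^sup>+ s. ennreal (g (p (Suc j))) * indicator {p j<..p (Suc j)} s \<partial>lborel)"
    by (rule sum.cong[OF refl], subst nn_integral_cmult_indicator) (use g(2) pl in \<open>auto simp: ennreal_mult\<close>)
  also have "\<dots> = (\<integral>\<^sup>+ s. (\<Sum>j<N. ennreal (g (p (Suc j))) * indicator {p j<..p (Suc j)} s) \<partial>lborel)"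
    by (rule nn_integral_sum[symmetric]) auto
  also have "\<dots> \<le> (\<integral>\<^sup>+ s\<in>{t0..t}. ennreal (g s) \<partial>lborel)"
  proof (rule nn_integral_mono)
    fix s
    show "(\<Sum>j<N. ennreal (g (p (Suc j))) * indicator {p j<..p (Suc j)} s) \<le> ennreal (g s) * indicator {t0..t} s"
    proof (cases "\<exists>j<N. p j < s \<and> s \<le> p (Suc j)")
      case True
      then obtain j where j: "j < N" "p j < s" "s \<le> p (Suc j)" by auto
      have "(\<Sum>k<N. ennreal (g (p (Suc k))) * indicator {p k<..p (Suc k)} s)
          = (\<Sum>k<N. if k = j then ennreal (g s) else 0)"
      proof (rule sum.cong[OF refl])
        fix k assume k: "k \<in> {..<N}"
        have "\<not> (p k < s \<and> s \<le> p (Suc k))" if "k \<noteq> j"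
          using that j k pl[of "Suc k" j] pl[of "Suc j" k] by (cases "k < j") auto
        then show "ennreal (g (p (Suc k))) * indicator {p k<..p (Suc k)} s = (if k = j then ennreal (g s) else 0)"
          using g(1)[OF j] j by (auto simp: indicator_def)
      qed
      also have "\<dots> = ennreal (g s)" using j by simp
      also have "\<dots> = ennreal (g s) * indicator {t0..t} s"
        using j bnd pl[of 0 j] pl[of "Suc j" N] by (auto simp: indicator_def)
      finally show ?thesis by simp
    next
      case False
      then have "(\<Sum>j<N. ennreal (g (p (Suc j))) * indicator {p j<..p (Suc j)} s) = (0::ennreal)"
        by (intro sum.neutral) (auto simp: indicator_def)
      then show ?thesis by simp
    qed
  qed
  finally show ?thesis .
qed

context wiener_process
begin

text \<open>On the union of both partitions the difference is a single elementary integral of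
  \<open>D\<close>, whose quadratic sum is at most the squared \<open>L\<^sup>2\<close> distance in
  time; \<open>wiener_sum_mostly\<close> then applies.\<close>

lemma simple_integral_diff_mostly:
  assumes t0: "0 \<le> t0"
    and \<tau>: "\<tau> 0 = t0" "\<tau> n = t" "\<And>i. i < n \<Longrightarrow> \<tau> i \<le> \<tau> (Suc i)" "\<And>i. i < n \<Longrightarrow> \<xi> i \<in> borel_measurable (F (\<tau> i))"
    and \<rho>: "\<rho> 0 = t0" "\<rho> m = t" "\<And>i. i < m \<Longrightarrow> \<rho> i \<le> \<rho> (Suc i)" "\<And>i. i < m \<Longrightarrow> \<theta> i \<in> borel_measurable (F (\<rho> i))"
    and small: "mostly P \<eta> (\<lambda>\<omega>. (\<integral>\<^sup>+ s\<in>{t0..t}. ennreal ((simple_process n \<tau> \<xi> s \<omega> - simple_process m \<rho> \<theta> s \<omega>)\<^sup>2) \<partial>lborel) \<le> ennreal \<delta>)"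
    and pos: "\<delta> > 0" "\<epsilon> > 0"
  shows "mostly P (\<eta> + \<delta> / \<epsilon>\<^sup>2) (\<lambda>\<omega>. \<bar>simple_integral W n \<tau> \<xi> \<omega> - simple_integral W m \<rho> \<theta> \<omega>\<bar> \<le> \<epsilon>)"
proof -
  define S where "S = \<tau> ` {..n} \<union> \<rho> ` {..m}"
  \<comment> \<open>Sorting the set of all partition points removes repetitions, which gives the
    strictly increasing points \<open>p 0\<close> to \<open>p N\<close>.\<close>
  define N where "N = card S - 1"
  define p where "p j = sorted_list_of_set S ! j" for j
  have S: "finite S" "S \<noteq> {}" by (auto simp: S_def)
  then have len: "length (sorted_list_of_set S) = Suc N"
    by (simp add: N_def card_gt_0_iff)
  have p: "p i < p j" if "i < j" "j \<le> N" for i j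
    unfolding p_def using that len strict_sorted_list_of_set[of S] by (simp add: sorted_wrt_iff_nth_less)
  have "set (sorted_list_of_set S) = p ` {..N}"
    unfolding set_conv_nth len p_def by (auto simp: less_Suc_eq_le)
  then have pS: "p ` {..N} = S" using S by simp
  have sub: "\<tau> ` {..n} \<subseteq> p ` {..N}" "\<rho> ` {..m} \<subseteq> p ` {..N}" unfolding pS S_def by auto
  have mono1: "\<tau> i \<le> \<tau> j" if "i \<le> j" "j \<le> n" for i j
    using \<tau>(3) that by (rule mono_upto)
  have mono2: "\<rho> i \<le> \<rho> j" if "i \<le> j" "j \<le> m" for i j
    using \<rho>(3) that by (rule mono_upto)
  have bd: "t0 \<le> x \<and> x \<le> t" if "x \<in> S" for x
    using that mono1[of 0] mono1[of _ n] mono2[of 0] mono2[of _ m] \<tau>(1,2) \<rho>(1,2) by (auto simp: S_def)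
  have ends: "t0 \<le> p 0" "p N \<le> t" using bd pS by auto
  define D where "D s \<omega> = simple_process n \<tau> \<xi> s \<omega> - simple_process m \<rho> \<theta> s \<omega>" for s \<omega>
  have "mostly P \<eta> (\<lambda>\<omega>. (\<Sum>j<N. (D (p (Suc j)) \<omega>)\<^sup>2 * (p (Suc j) - p j)) \<le> \<delta>)"
  proof (rule mostly_mono[OF small order_refl])
    fix \<omega> assume *: "(\<integral>\<^sup>+ s\<in>{t0..t}. ennreal ((simple_process n \<tau> \<xi> s \<omega> - simple_process m \<rho> \<theta> s \<omega>)\<^sup>2) \<partial>lborel) \<le> ennreal \<delta>"
    have "ennreal (\<Sum>j<N. (D (p (Suc j)) \<omega>)\<^sup>2 * (p (Suc j) - p j)) \<le> (\<integral>\<^sup>+ s\<in>{t0..t}. ennreal ((D s \<omega>)\<^sup>2) \<partial>lborel)"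
    proof (rule sum_le_nn_integral_grid[OF p _ _ ends])
      fix j s assume j: "j < N" "p j < s" "s \<le> p (Suc j)"
      show "(D s \<omega>)\<^sup>2 = (D (p (Suc j)) \<omega>)\<^sup>2"
        using simple_process_refine[of N p \<tau> n j s \<xi> \<omega>, OF p sub(1) j]
          simple_process_refine[of N p \<rho> m j s \<theta> \<omega>, OF p sub(2) j] by (simp add: D_def)
    qed auto
    also have "\<dots> \<le> ennreal \<delta>" using * unfolding D_def .
    finally show "(\<Sum>j<N. (D (p (Suc j)) \<omega>)\<^sup>2 * (p (Suc j) - p j)) \<le> \<delta>"
      using pos by (simp add: ennreal_le_iff)
  qed
  then have "mostly P (\<eta> + \<delta> / \<epsilon>\<^sup>2) (\<lambda>\<omega>. \<bar>\<Sum>j<N. D (p (Suc j)) \<omega> * (W (p (Suc j)) \<omega> - W (p j) \<omega>)\<bar> \<le> \<epsilon>)"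
  proof (rule wiener_sum_mostly[rotated 3, OF _ pos])
    show "0 \<le> p 0" using ends t0 by simp
    fix j assume j: "j < N"
    then show "p j \<le> p (Suc j)" using p[of j "Suc j"] by simp
    have "D (p (Suc j)) = (\<lambda>\<omega>. simple_process n \<tau> \<xi> (p (Suc j)) \<omega> - simple_process m \<rho> \<theta> (p (Suc j)) \<omega>)"
      by (simp add: D_def fun_eq_iff)
    moreover have "simple_process n \<tau> \<xi> (p (Suc j)) \<in> borel_measurable (F (p j))"
      by (rule simple_process_refine_measurable[of N p, OF p sub(1) j]; simp add: measurable_F_mono[OF \<tau>(4)])
    moreover have "simple_process m \<rho> \<theta> (p (Suc j)) \<in> borel_measurable (F (p j))"
      by (rule simple_process_refine_measurable[of N p, OF p sub(2) j]; simp add: measurable_F_mono[OF \<rho>(4)])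
    ultimately show "D (p (Suc j)) \<in> borel_measurable (F (p j))" by simp
  qed
  then show ?thesis
  proof (rule mostly_mono[OF _ order_refl])
    fix \<omega>
    have "simple_integral W n \<tau> \<xi> \<omega> = (\<Sum>j<N. simple_process n \<tau> \<xi> (p (Suc j)) \<omega> * (W (p (Suc j)) \<omega> - W (p j) \<omega>))"
      by (rule simple_integral_refine[OF p sub(1) \<tau>(3)])
    moreover have "simple_integral W m \<rho> \<theta> \<omega> = (\<Sum>j<N. simple_process m \<rho> \<theta> (p (Suc j)) \<omega> * (W (p (Suc j)) \<omega> - W (p j) \<omega>))"
      by (rule simple_integral_refine[OF p sub(2) \<rho>(3)])
    ultimately have "simple_integral W n \<tau> \<xi> \<omega> - simple_integral W m \<rho> \<theta> \<omega>
       = (\<Sum>j<N. D (p (Suc j)) \<omega> * (W (p (Suc j)) \<omega> - W (p j) \<omega>))"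
      by (simp add: D_def sum_subtractf left_diff_distrib)
    moreover assume "\<bar>\<Sum>j<N. D (p (Suc j)) \<omega> * (W (p (Suc j)) \<omega> - W (p j) \<omega>)\<bar> \<le> \<epsilon>"
    ultimately show "\<bar>simple_integral W n \<tau> \<xi> \<omega> - simple_integral W m \<rho> \<theta> \<omega>\<bar> \<le> \<epsilon>" by simp
  qed
qed

end

section \<open>Continuous adapted processes\<close>

text \<open>A rational approximation from the left, given by one formula for all \<open>s\<close>.
  It serves both joint measurability and the passage from rational to all times.\<close>

lemma floor_approx: "(\<lambda>n. of_int \<lfloor>real (Suc n) * s\<rfloor> / real (Suc n)) \<longlonglongrightarrow> s"
proof (rule tendsto_sandwich)
  show "eventually (\<lambda>n. s - inverse (real (Suc n)) \<le> of_int \<lfloor>real (Suc n) * s\<rfloor> / real (Suc n)) sequentially"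
  proof (rule always_eventually, rule allI)
    fix n
    have "real (Suc n) * s - 1 \<le> of_int \<lfloor>real (Suc n) * s\<rfloor>" by linarith
    then have "(real (Suc n) * s - 1) / real (Suc n) \<le> of_int \<lfloor>real (Suc n) * s\<rfloor> / real (Suc n)"
      by (rule divide_right_mono) simp
    moreover have "(real (Suc n) * s - 1) / real (Suc n) = s - inverse (real (Suc n))"
      by (simp add: diff_divide_distrib inverse_eq_divide del: of_nat_Suc)
    ultimately show "s - inverse (real (Suc n)) \<le> of_int \<lfloor>real (Suc n) * s\<rfloor> / real (Suc n)" by simp
  qed
  show "eventually (\<lambda>n. of_int \<lfloor>real (Suc n) * s\<rfloor> / real (Suc n) \<le> s) sequentially"
    by (intro always_eventually allI) (simp add: divide_le_eq mult.commute del: of_nat_Suc)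
  show "(\<lambda>n. s - inverse (real (Suc n))) \<longlonglongrightarrow> s"
    using tendsto_diff[OF tendsto_const LIMSEQ_inverse_real_of_nat, of s] by simp
qed simp

lemma floor_approx_bounds:
  assumes "0 \<le> s"
  shows "0 \<le> of_int \<lfloor>real (Suc n) * s\<rfloor> / real (Suc n)" "of_int \<lfloor>real (Suc n) * s\<rfloor> / real (Suc n) \<le> s"
  using assms by (auto simp: divide_le_eq mult.commute simp del: of_nat_Suc)

lemma grid_cell:
  fixes u s :: real
  assumes "0 < s" "s \<le> u" "0 < n"
  shows "\<exists>i<n. grid u n i < s \<and> s \<le> grid u n (Suc i)"
proof -
  define x where "x = s * n / u"
  have x: "0 < x" "x \<le> n" using assms by (auto simp: x_def field_simps)
  \<comment> \<open>Ceiling minus one instead of floor: cells are open on the left, so a grid point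
    belongs to the cell that ends there.\<close>
  define i where "i = nat (\<lceil>x\<rceil> - 1)"
  have i: "real i = of_int \<lceil>x\<rceil> - 1" using x unfolding i_def by simp
  have "real i < x" "x \<le> real (Suc i)" using i by linarith+
  then have "i < n" using x by simp
  moreover have "u * real i / n < s" "s \<le> u * real (Suc i) / n"
    using \<open>real i < x\<close> \<open>x \<le> real (Suc i)\<close> assms unfolding x_def by (auto simp: field_simps simp del: of_nat_Suc)
  ultimately show ?thesis by auto
qed

text \<open>This includes \<open>n = 0\<close>, where division by zero places every grid point at
  \<open>0\<close>.\<close>

lemma grid_in: "0 \<le> u \<Longrightarrow> i \<le> n \<Longrightarrow> grid u n i \<in> {0..u}" for u :: real
  by (cases "n = 0") (auto simp: divide_le_eq mult_left_mono)

lemma grid_mono: "0 \<le> u \<Longrightarrow> i \<le> j \<Longrightarrow> grid u n i \<le> grid u n j" for u :: real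
  by (intro divide_right_mono mult_left_mono) auto

context wiener_process
begin

definition continuous_adapted :: "real \<Rightarrow> (real \<Rightarrow> 'a \<Rightarrow> real) \<Rightarrow> bool" where
  "continuous_adapted T H \<longleftrightarrow> (\<forall>t\<in>{0..<T}. H t \<in> borel_measurable (F t)) \<and>
     (\<forall>\<omega>\<in>space P. continuous_on {0..<T} (\<lambda>t. H t \<omega>))"

lemma continuous_adaptedD:
  assumes "continuous_adapted T H"
  shows "0 \<le> t \<Longrightarrow> t < T \<Longrightarrow> H t \<in> borel_measurable (F t)"
    and "0 \<le> t \<Longrightarrow> t < T \<Longrightarrow> H t \<in> borel_measurable P"
    and "u < T \<Longrightarrow> \<omega> \<in> space P \<Longrightarrow> continuous_on {0..u} (\<lambda>t. H t \<omega>)"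
proof -
  assume "0 \<le> t" "t < T"
  then show "H t \<in> borel_measurable (F t)" using assms unfolding continuous_adapted_def by simp
  then show "H t \<in> borel_measurable P" by (rule measurable_F_P)
next
  assume u: "u < T" "\<omega> \<in> space P"
  then have "continuous_on {0..<T} (\<lambda>t. H t \<omega>)" using assms unfolding continuous_adapted_def by simp
  then show "continuous_on {0..u} (\<lambda>t. H t \<omega>)"
    by (rule continuous_on_subset) (use u in auto)
qed

text \<open>The set \<open>J\<close> stands for domains such as \<open>{0<..}\<close>, outside which
  nothing is known about \<open>g\<close>; measurability is therefore taken in the restricted
  space.\<close>

lemma continuous_adapted_compose:
  assumes H: "continuous_adapted T H" and g: "continuous_on ({0..<T} \<times> J) (\<lambda>(t, x). g t x)"
    and J: "J \<in> sets borel" "\<And>t \<omega>. 0 \<le> t \<Longrightarrow> t < T \<Longrightarrow> \<omega> \<in> space P \<Longrightarrow> H t \<omega> \<in> J"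
  shows "continuous_adapted T (\<lambda>t \<omega>. g t (H t \<omega>))"
  unfolding continuous_adapted_def
proof (intro conjI ballI)
  fix t assume t: "t \<in> {0..<T}"
  have "continuous_on J (\<lambda>x. g t x)"
  proof -
    have "continuous_on J (\<lambda>x. (t, x))" "(\<lambda>x. (t, x)) ` J \<subseteq> {0..<T} \<times> J"
      using t by (auto intro!: continuous_on_Pair continuous_on_id)
    from continuous_on_compose2[OF g this] show ?thesis by simp
  qed
  then have "g t \<in> borel_measurable (restrict_space borel J)"
    by (rule borel_measurable_continuous_on_restrict)
  moreover have "H t \<in> measurable (F t) (restrict_space borel J)"
    using continuous_adaptedD(1)[OF H, of t] t J by (intro measurable_restrict_space2) (auto simp: space_F)
  ultimately show "(\<lambda>\<omega>. g t (H t \<omega>)) \<in> borel_measurable (F t)"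
    by (rule measurable_compose[rotated])
next
  fix \<omega> assume "\<omega> \<in> space P"
  then have "continuous_on {0..<T} (\<lambda>t. (t, H t \<omega>))"
    using H unfolding continuous_adapted_def by (intro continuous_on_Pair) auto
  then show "continuous_on {0..<T} (\<lambda>t. g t (H t \<omega>))"
    using continuous_on_compose2[OF g, of "{0..<T}" "\<lambda>t. (t, H t \<omega>)"] J(2) \<open>\<omega> \<in> space P\<close>
    by (simp add: image_subset_iff)
qed

lemma continuous_adapted_mult:
  "continuous_adapted T H \<Longrightarrow> continuous_adapted T G \<Longrightarrow> continuous_adapted T (\<lambda>t \<omega>. H t \<omega> * G t \<omega>)"
  unfolding continuous_adapted_def
  by (intro conjI ballI continuous_on_mult borel_measurable_times) simp_all

lemma continuous_adapted_add:
  "continuous_adapted T H \<Longrightarrow> continuous_adapted T G \<Longrightarrow> continuous_adapted T (\<lambda>t \<omega>. H t \<omega> + G t \<omega>)"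
  unfolding continuous_adapted_def
  by (intro conjI ballI continuous_on_add borel_measurable_add) simp_all

lemma continuous_adapted_diff:
  "continuous_adapted T H \<Longrightarrow> continuous_adapted T G \<Longrightarrow> continuous_adapted T (\<lambda>t \<omega>. H t \<omega> - G t \<omega>)"
  unfolding continuous_adapted_def
  by (intro conjI ballI continuous_on_diff borel_measurable_diff) simp_all

lemma continuous_adapted_power:
  "continuous_adapted T H \<Longrightarrow> continuous_adapted T (\<lambda>t \<omega>. H t \<omega> ^ k)"
  unfolding continuous_adapted_def
  by (intro conjI ballI continuous_on_power borel_measurable_power) simp_all

lemma continuous_adapted_const: "continuous_adapted T (\<lambda>t \<omega>. c)"
  unfolding continuous_adapted_def by auto

lemma continuous_adapted_progressive:
  assumes H: "continuous_adapted T H" and t: "0 \<le> t" "t < T"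
  shows "progressive_on F 0 t H"
  unfolding progressive_on_def
proof (rule borel_measurable_LIMSEQ_real)
  let ?M = "restrict_space borel {0..t} \<Otimes>\<^sub>M F t"
  define q where "q n s = of_int \<lfloor>real (Suc n) * s\<rfloor> / real (Suc n)" for n s
  fix n
  \<comment> \<open>Time enters only through the integer \<open>i\<close>, so a countable case
    distinction gives joint measurability. Clamping to the interval from \<open>0\<close> to
    \<open>t\<close> keeps each \<open>h i\<close> measurable for \<open>F t\<close> at all
    integers.\<close>
  define h where "h i p = H (max 0 (min t (of_int i / real (Suc n)))) (snd p)" for i :: int and p :: "real \<times> 'a"
  have "(\<lambda>p. h \<lfloor>real (Suc n) * fst p\<rfloor> p) \<in> borel_measurable ?M"
  proof (rule measurable_compose_countable)
    fix i :: int
    have "H (max 0 (min t (of_int i / real (Suc n)))) \<in> borel_measurable (F t)"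
      by (rule measurable_F_mono[OF continuous_adaptedD(1)[OF H]]) (use t in auto)
    then show "h i \<in> borel_measurable ?M" unfolding h_def by (rule measurable_compose[OF measurable_snd])
    have "(\<lambda>p. real (Suc n) * fst p) \<in> borel_measurable ?M"
      by (intro borel_measurable_times borel_measurable_const)
         (rule measurable_compose[OF measurable_fst measurable_restrict_space1], simp)
    then show "(\<lambda>p. \<lfloor>real (Suc n) * fst p\<rfloor>) \<in> measurable ?M (count_space UNIV)"
      by measurable
  qed
  then show "(\<lambda>p. h \<lfloor>real (Suc n) * fst p\<rfloor> p) \<in> borel_measurable ?M" .
next
  fix p :: "real \<times> 'a" assume p: "p \<in> space (restrict_space borel {0..t} \<Otimes>\<^sub>M F t)"
  then have s: "0 \<le> fst p" "fst p \<le> t" and \<omega>: "snd p \<in> space P"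
    by (auto simp: space_pair_measure space_restrict_space space_F)
  define q where "q n = of_int \<lfloor>real (Suc n) * fst p\<rfloor> / real (Suc n)" for n
  have "q \<longlonglongrightarrow> fst p" unfolding q_def by (rule floor_approx)
  moreover have q: "q n \<in> {0..t}" "max 0 (min t (q n)) = q n" for n
    using floor_approx_bounds[OF s(1), of n] s(2) unfolding q_def by auto
  ultimately have "(\<lambda>n. H (q n) (snd p)) \<longlonglongrightarrow> H (fst p) (snd p)"
    using continuous_on_tendsto_compose[OF continuous_adaptedD(3)[OF H t(2) \<omega>], of q "fst p" sequentially] s by simp
  then show "(\<lambda>n. H (max 0 (min t (of_int \<lfloor>real (Suc n) * fst p\<rfloor> / real (Suc n)))) (snd p)) \<longlonglongrightarrow> (case p of (s, \<omega>) \<Rightarrow> H s \<omega>)"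
    using q(2) unfolding q_def by (simp add: case_prod_beta)
qed

text \<open>Each path is uniformly continuous on a compact interval; continuity of the measure from
  above makes the modulus independent of \<omega> outside a small event. Oscillations are tested at
  rational times only, which keeps the events \<open>A n\<close> measurable.\<close>

lemma mostly_uniformly_continuous:
  assumes H: "continuous_adapted T H" and u: "0 \<le> u" "u < T" and pos: "\<epsilon> > 0" "\<eta> > 0"
  shows "\<exists>d>0. mostly P \<eta> (\<lambda>\<omega>. \<forall>s\<in>{0..u}. \<forall>s'\<in>{0..u}. \<bar>s - s'\<bar> \<le> d \<longrightarrow> \<bar>H s \<omega> - H s' \<omega>\<bar> \<le> \<epsilon>)"
proof -
  define D where "D = {0..u} \<inter> \<rat>"
  have D: "countable D" "D \<subseteq> {0..u}" unfolding D_def using countable_rat by auto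
  define A where "A n = {\<omega> \<in> space P. \<exists>s\<in>D. \<exists>s'\<in>D. \<bar>s - s'\<bar> < inverse (real (Suc n)) \<and> \<bar>H s \<omega> - H s' \<omega>\<bar> > \<epsilon>}" for n
  have A: "A n \<in> sets P" for n
  proof -
    have "{\<omega> \<in> space P. \<bar>s - s'\<bar> < inverse (real (Suc n)) \<and> \<bar>H s \<omega> - H s' \<omega>\<bar> > \<epsilon>} \<in> sets P" if "s \<in> D" "s' \<in> D" for s s'
    proof -
      have [measurable]: "H s \<in> borel_measurable P" "H s' \<in> borel_measurable P"
        using that D(2) u continuous_adaptedD(2)[OF H] by auto
      show ?thesis by measurable
    qed
    then have "(\<Union>s\<in>D. \<Union>s'\<in>D. {\<omega> \<in> space P. \<bar>s - s'\<bar> < inverse (real (Suc n)) \<and> \<bar>H s \<omega> - H s' \<omega>\<bar> > \<epsilon>}) \<in> sets P"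
      by (intro sets.countable_UN'' D(1))
    also have "(\<Union>s\<in>D. \<Union>s'\<in>D. {\<omega> \<in> space P. \<bar>s - s'\<bar> < inverse (real (Suc n)) \<and> \<bar>H s \<omega> - H s' \<omega>\<bar> > \<epsilon>}) = A n"
      unfolding A_def by (auto simp only: UN_iff mem_Collect_eq)
    finally show ?thesis .
  qed
  have dec: "decseq A"
  proof (rule decseq_SucI, rule subsetI)
    fix n \<omega> assume "\<omega> \<in> A (Suc n)"
    then obtain s s' where *: "\<omega> \<in> space P" "s \<in> D" "s' \<in> D" "\<bar>s - s'\<bar> < inverse (real (Suc (Suc n)))" "\<bar>H s \<omega> - H s' \<omega>\<bar> > \<epsilon>"
      unfolding A_def by auto
    have "inverse (real (Suc (Suc n))) \<le> inverse (real (Suc n))" by (rule le_imp_inverse_le) auto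
    with *(4) have "\<bar>s - s'\<bar> < inverse (real (Suc n))" by (rule less_le_trans)
    then show "\<omega> \<in> A n" unfolding A_def using * by auto
  qed
  have "(\<Inter>n. A n) = {}"
  proof (rule ccontr)
    assume "(\<Inter>n. A n) \<noteq> {}"
    then obtain \<omega> where \<omega>: "\<And>n. \<omega> \<in> A n" by auto
    then have "\<omega> \<in> space P" by (auto simp: A_def)
    then have "uniformly_continuous_on {0..u} (\<lambda>t. H t \<omega>)"
      using continuous_adaptedD(3)[OF H u(2)] by (intro compact_uniformly_continuous) auto
    then obtain d where d: "d > 0" "\<And>s s'. s \<in> {0..u} \<Longrightarrow> s' \<in> {0..u} \<Longrightarrow> dist s' s < d \<Longrightarrow> dist (H s' \<omega>) (H s \<omega>) < \<epsilon>"
      using pos(1) unfolding uniformly_continuous_on_def by blast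
    obtain n where "inverse (real (Suc n)) < d" using reals_Archimedean[OF d(1)] by auto
    moreover obtain s s' where "s \<in> D" "s' \<in> D" "\<bar>s - s'\<bar> < inverse (real (Suc n))" "\<bar>H s \<omega> - H s' \<omega>\<bar> > \<epsilon>"
      using \<omega>[of n] unfolding A_def by auto
    ultimately show False
      using d(2)[of s' s] subsetD[OF D(2), of s] subsetD[OF D(2), of s'] by (simp add: dist_real_def)
  qed
  then have "(\<lambda>n. prob (A n)) \<longlonglongrightarrow> 0"
    using finite_Lim_measure_decseq[OF _ dec] A by (simp add: image_subset_iff)
  then have "eventually (\<lambda>n. prob (A n) < \<eta>) sequentially"
    using pos(2) by (rule order_tendstoD(2))
  then obtain n where n: "prob (A n) < \<eta>" using eventually_happens'[OF sequentially_bot] by auto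
  \<comment> \<open>Half the threshold, so that rational approximations of \<open>s\<close> and
    \<open>s'\<close> are eventually still strictly closer than the threshold.\<close>
  define d where "d = inverse (real (Suc n)) / 2"
  have d: "d > 0" "d < inverse (real (Suc n))" by (auto simp: d_def)
  have "\<bar>H s \<omega> - H s' \<omega>\<bar> \<le> \<epsilon>" if \<omega>: "\<omega> \<in> space P" "\<omega> \<notin> A n" and s: "s \<in> {0..u}" "s' \<in> {0..u}" "\<bar>s - s'\<bar> \<le> d" for \<omega> s s'
  proof -
    define q where "q s k = of_int \<lfloor>real (Suc k) * s\<rfloor> / real (Suc k)" for s k
    have q: "q s \<longlonglongrightarrow> s" "q s' \<longlonglongrightarrow> s'" unfolding q_def by (rule floor_approx)+
    have qD: "q s k \<in> D" "q s' k \<in> D" for k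
      using floor_approx_bounds[of s k] floor_approx_bounds[of s' k] s unfolding q_def D_def
      by (auto intro!: Rats_divide)
    have lim: "(\<lambda>k. \<bar>H (q s k) \<omega> - H (q s' k) \<omega>\<bar>) \<longlonglongrightarrow> \<bar>H s \<omega> - H s' \<omega>\<bar>"
    proof -
      have in_u: "q s k \<in> {0..u}" "q s' k \<in> {0..u}" for k using subsetD[OF D(2) qD(1)] subsetD[OF D(2) qD(2)] .
      note c = continuous_on_tendsto_compose[OF continuous_adaptedD(3)[OF H u(2) \<omega>(1)]]
      have "(\<lambda>k. H (q s k) \<omega>) \<longlonglongrightarrow> H s \<omega>" by (rule c[OF q(1) s(1)]) (simp only: in_u eventually_True)
      moreover have "(\<lambda>k. H (q s' k) \<omega>) \<longlonglongrightarrow> H s' \<omega>" by (rule c[OF q(2) s(2)]) (simp only: in_u eventually_True)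
      ultimately show ?thesis by (rule tendsto_rabs[OF tendsto_diff])
    qed
    have "(\<lambda>k. \<bar>q s k - q s' k\<bar>) \<longlonglongrightarrow> \<bar>s - s'\<bar>" by (rule tendsto_rabs[OF tendsto_diff[OF q]])
    then have "eventually (\<lambda>k. \<bar>q s k - q s' k\<bar> < inverse (real (Suc n))) sequentially"
      by (rule order_tendstoD(2)) (use s(3) d(2) in linarith)
    then have "eventually (\<lambda>k. \<bar>H (q s k) \<omega> - H (q s' k) \<omega>\<bar> \<le> \<epsilon>) sequentially"
    proof eventually_elim
      case (elim k)
      have "\<bar>H x \<omega> - H y \<omega>\<bar> \<le> \<epsilon>" if "x \<in> D" "y \<in> D" "\<bar>x - y\<bar> < inverse (real (Suc n))" for x y
      proof (rule ccontr)
        assume "\<not> \<bar>H x \<omega> - H y \<omega>\<bar> \<le> \<epsilon>"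
        then have "\<omega> \<in> A n" unfolding A_def using \<omega>(1) that by (auto simp only: not_le mem_Collect_eq)
        then show False using \<omega>(2) by simp
      qed
      from this[OF qD elim] show ?case .
    qed
    then show ?thesis by (rule tendsto_upperbound[OF lim _ sequentially_bot])
  qed
  then have "mostly P \<eta> (\<lambda>\<omega>. \<forall>s\<in>{0..u}. \<forall>s'\<in>{0..u}. \<bar>s - s'\<bar> \<le> d \<longrightarrow> \<bar>H s \<omega> - H s' \<omega>\<bar> \<le> \<epsilon>)"
    unfolding mostly_def using A n by (intro bexI[of _ "A n"]) auto
  then show ?thesis using d(1) by auto
qed

text \<open>A bound at finitely many grid points of mesh at most \<open>d\<close> extends to the
  whole interval, at the price of one oscillation of size 1.\<close>

lemma mostly_pathwise_bounded:
  assumes H: "continuous_adapted T H" and u: "0 \<le> u" "u < T" and pos: "\<eta> > 0"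
  shows "\<exists>C>0. mostly P \<eta> (\<lambda>\<omega>. \<forall>s\<in>{0..u}. \<bar>H s \<omega>\<bar> \<le> C)"
proof -
  obtain d where d: "d > 0"
    "mostly P (\<eta> / 2) (\<lambda>\<omega>. \<forall>s\<in>{0..u}. \<forall>s'\<in>{0..u}. \<bar>s - s'\<bar> \<le> d \<longrightarrow> \<bar>H s \<omega> - H s' \<omega>\<bar> \<le> 1)"
    using mostly_uniformly_continuous[OF H u, of 1 "\<eta> / 2"] pos by auto
  obtain n where n: "u / d < real n" using reals_Archimedean2 by blast
  then have n0: "n > 0" using u(1) d(1) by (cases n) (auto simp: divide_less_0_iff not_less)
  then have un: "u / n \<le> d" using n d(1) by (simp add: field_simps)
  define Y where "Y \<omega> = (\<Sum>i\<le>n. \<bar>H (u * real i / n) \<omega>\<bar>)" for \<omega>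
  have "Y \<in> borel_measurable P"
    unfolding Y_def using grid_in[OF u(1)] u
    by (intro borel_measurable_sum borel_measurable_abs continuous_adaptedD(2)[OF H]) (fastforce intro: le_less_trans)+
  then obtain C where C: "C > 0" "mostly P (\<eta> / 2) (\<lambda>\<omega>. \<bar>Y \<omega>\<bar> \<le> C)"
    using mostly_bounded[of Y "\<eta> / 2"] pos by auto
  have "mostly P \<eta> (\<lambda>\<omega>. \<forall>s\<in>{0..u}. \<bar>H s \<omega>\<bar> \<le> C + 1)"
  proof (rule mostly_conj_mono[OF d(2) C(2)])
    fix \<omega> assume *: "\<forall>s\<in>{0..u}. \<forall>s'\<in>{0..u}. \<bar>s - s'\<bar> \<le> d \<longrightarrow> \<bar>H s \<omega> - H s' \<omega>\<bar> \<le> 1" "\<bar>Y \<omega>\<bar> \<le> C"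
    show "\<forall>s\<in>{0..u}. \<bar>H s \<omega>\<bar> \<le> C + 1"
    proof
      fix s assume s: "s \<in> {0..u}"
      have "\<exists>i\<le>n. \<bar>s - u * real i / n\<bar> \<le> d"
      proof (cases "s = 0")
        case True
        then show ?thesis using d(1) by (intro exI[of _ 0]) auto
      next
        case False
        then obtain i where "i < n" "grid u n i < s" "s \<le> grid u n (Suc i)"
          using grid_cell[of s u n] s n0 by auto
        moreover have "grid u n (Suc i) = u * real i / n + u / n"
          by (simp add: field_simps add_divide_distrib)
        ultimately show ?thesis using un by (intro exI[of _ i]) auto
      qed
      then obtain i where i: "i \<le> n" "\<bar>s - u * real i / n\<bar> \<le> d" by auto
      have "\<bar>H s \<omega> - H (u * real i / n) \<omega>\<bar> \<le> 1" using *(1) s i grid_in[OF u(1) i(1)] by auto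
      moreover have "\<bar>H (u * real i / n) \<omega>\<bar> \<le> Y \<omega>"
        unfolding Y_def using i(1) by (intro member_le_sum) auto
      ultimately show "\<bar>H s \<omega>\<bar> \<le> C + 1" using *(2) by linarith
    qed
  qed simp
  then show ?thesis using C(1) by (intro exI[of _ "C + 1"]) auto
qed

section \<open>It\^o integrals as limits of left Riemann sums\<close>

definition left_sum :: "(real \<Rightarrow> 'a \<Rightarrow> real) \<Rightarrow> real \<Rightarrow> nat \<Rightarrow> 'a \<Rightarrow> real" where
  "left_sum H u n \<omega> =
     (\<Sum>i<n. H (grid u n i) \<omega> * (incr W u n i \<omega>))"

lemma left_sum_simple_integral:
  "left_sum H u n = simple_integral W n (\<lambda>i. grid u n i) (\<lambda>i. H (grid u n i))"
  by (simp add: left_sum_def simple_integral_def fun_eq_iff)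

lemma simple_process_grid:
  assumes "0 < s" "s \<le> u" "0 < n"
  shows "\<exists>i<n. simple_process n (\<lambda>i. grid u n i) \<xi> s \<omega> = \<xi> i \<omega> \<and> \<bar>s - grid u n i\<bar> \<le> u / n"
proof -
  obtain i where i: "i < n" "grid u n i < s" "s \<le> grid u n (Suc i)"
    using grid_cell[OF assms] by auto
  have u: "0 \<le> u" using assms by simp
  have "simple_process n (\<lambda>i. grid u n i) \<xi> s \<omega> = (\<Sum>j<n. if j = i then \<xi> i \<omega> else 0)"
    unfolding simple_process_def
  proof (rule sum.cong[OF refl])
    fix j assume "j \<in> {..<n}"
    have "\<not> (grid u n j < s \<and> s \<le> grid u n (Suc j))" if "j \<noteq> i"
      using that i grid_mono[OF u, of "Suc j" i n] grid_mono[OF u, of "Suc i" j n] by (cases "j < i") auto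
    then show "\<xi> j \<omega> * indicat_real {grid u n j<..grid u n (Suc j)} s = (if j = i then \<xi> i \<omega> else 0)"
      using i by (auto simp: indicator_def)
  qed
  also have "\<dots> = \<xi> i \<omega>" using i by simp
  finally have "simple_process n (\<lambda>i. grid u n i) \<xi> s \<omega> = \<xi> i \<omega>" .
  moreover have "grid u n (Suc i) = u * real i / n + u / n"
    by (simp add: field_simps add_divide_distrib)
  ultimately show ?thesis using i by (intro exI[of _ i]) auto
qed

lemma simple_process_grid_close:
  assumes u: "0 \<le> u" "0 < n" "u / n \<le> d"
    and \<xi>: "\<And>i. i < n \<Longrightarrow> \<xi> i \<omega> = H (grid u n i) \<omega>"
    and H: "\<And>s s'. s \<in> {0..u} \<Longrightarrow> s' \<in> {0..u} \<Longrightarrow> \<bar>s - s'\<bar> \<le> d \<Longrightarrow> \<bar>H s \<omega> - H s' \<omega>\<bar> \<le> \<epsilon>"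
    and s: "0 < s" "s \<le> u"
  shows "(simple_process n (\<lambda>i. grid u n i) \<xi> s \<omega> - H s \<omega>)\<^sup>2 \<le> \<epsilon>\<^sup>2"
proof -
  obtain i where i: "i < n" "simple_process n (\<lambda>i. grid u n i) \<xi> s \<omega> = \<xi> i \<omega>" "\<bar>s - grid u n i\<bar> \<le> u / n"
    using simple_process_grid[OF s u(2), of \<xi> \<omega>] by auto
  have "\<bar>H (grid u n i) \<omega> - H s \<omega>\<bar> \<le> \<epsilon>"
    using i u s grid_in[OF u(1), of i n] by (intro H) auto
  then show ?thesis unfolding i(2) \<xi>[OF i(1)] by (simp add: abs_le_square_iff[symmetric])
qed

text \<open>Progressive measurability is what permits integrating out time here. The result makes
  the deviation events measurable, as \<open>tendsto_mostly\<close> requires.\<close>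

lemma L2_distance_measurable:
  assumes \<tau>: "\<tau> n = t" "\<And>i. i < n \<Longrightarrow> \<tau> i \<le> \<tau> (Suc i)" "\<And>i. i < n \<Longrightarrow> \<xi> i \<in> borel_measurable (F (\<tau> i))"
    and H: "progressive_on F t0 t H"
  shows "(\<lambda>\<omega>. \<integral>\<^sup>+ s\<in>{t0..t}. ennreal ((simple_process n \<tau> \<xi> s \<omega> - H s \<omega>)\<^sup>2) \<partial>lborel) \<in> borel_measurable P"
proof -
  let ?R = "restrict_space lborel {t0..t}"
  interpret R: sigma_finite_measure ?R
    by (rule sigma_finite_measure_restrict_space[OF sigma_finite_lborel]) simp
  have \<xi>: "\<xi> i \<in> borel_measurable (F t)" if "i < n" for i
    using \<tau>(3)[OF that] mono_upto[of n \<tau> i n, OF \<tau>(2)] \<tau>(1) that by (auto intro: measurable_F_mono)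
  have sets: "sets ?R = sets (restrict_space borel {t0..t})"
    by (simp add: sets_restrict_space)
  have H1: "(\<lambda>(\<omega>, s). H s \<omega>) \<in> borel_measurable (F t \<Otimes>\<^sub>M ?R)"
  proof -
    have "(\<lambda>(s, \<omega>). H s \<omega>) \<in> borel_measurable (?R \<Otimes>\<^sub>M F t)"
      using H unfolding progressive_on_def
      by (subst measurable_cong_sets[OF sets_pair_measure_cong[OF sets refl] refl])
    from measurable_compose[OF measurable_pair_swap' this] show ?thesis by (simp add: case_prod_beta)
  qed
  have S1: "(\<lambda>p. simple_process n \<tau> \<xi> (snd p) (fst p)) \<in> borel_measurable (F t \<Otimes>\<^sub>M ?R)"
    unfolding simple_process_def
  proof (intro borel_measurable_sum borel_measurable_times)
    fix i assume "i \<in> {..<n}"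
    then show "(\<lambda>p. \<xi> i (fst p)) \<in> borel_measurable (F t \<Otimes>\<^sub>M ?R)"
      by (intro measurable_compose[OF measurable_fst \<xi>]) simp
    have "indicat_real {\<tau> i<..\<tau> (Suc i)} \<in> borel_measurable ?R"
      by (rule measurable_restrict_space1) simp
    then show "(\<lambda>p. indicat_real {\<tau> i<..\<tau> (Suc i)} (snd p)) \<in> borel_measurable (F t \<Otimes>\<^sub>M ?R)"
      by (rule measurable_compose[OF measurable_snd])
  qed
  have "(\<lambda>p. ennreal ((simple_process n \<tau> \<xi> (snd p) (fst p) - H (snd p) (fst p))\<^sup>2)) \<in> borel_measurable (F t \<Otimes>\<^sub>M ?R)"
    using S1 H1 unfolding case_prod_beta
    by (intro measurable_compose[OF _ measurable_ennreal] borel_measurable_power borel_measurable_diff)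
  then have "(\<lambda>\<omega>. \<integral>\<^sup>+ s. ennreal ((simple_process n \<tau> \<xi> s \<omega> - H s \<omega>)\<^sup>2) \<partial>?R) \<in> borel_measurable (F t)"
    by (intro R.borel_measurable_nn_integral) (simp add: case_prod_beta)
  then have "(\<lambda>\<omega>. \<integral>\<^sup>+ s\<in>{t0..t}. ennreal ((simple_process n \<tau> \<xi> s \<omega> - H s \<omega>)\<^sup>2) \<partial>lborel) \<in> borel_measurable (F t)"
    by (subst (asm) nn_integral_restrict_space) auto
  then show ?thesis by (rule measurable_from_subalg[OF subalgebra_F])
qed

text \<open>The bound is asked for \<open>s > 0\<close> only, because time \<open>0\<close> lies in
  no cell open on the left, and a point has measure zero.\<close>

lemma nn_integral_interval_const:
  fixes g :: "real \<Rightarrow> real"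
  assumes "0 \<le> u" "\<And>s. 0 < s \<Longrightarrow> s \<le> u \<Longrightarrow> g s \<le> c" "0 \<le> c"
  shows "(\<integral>\<^sup>+ s\<in>{0..u}. ennreal (g s) \<partial>lborel) \<le> ennreal (c * u)"
proof -
  have "(\<integral>\<^sup>+ s\<in>{0..u}. ennreal (g s) \<partial>lborel) \<le> (\<integral>\<^sup>+ s. ennreal c * indicator {0..u} s \<partial>lborel)"
  proof (rule nn_integral_mono_AE)
    show "AE s in lborel. ennreal (g s) * indicator {0..u} s \<le> ennreal c * indicator {0..u} s"
      using AE_lborel_singleton[of 0]
    proof eventually_elim
      case (elim s)
      then show ?case using assms(2)[of s] assms(3) by (auto simp: indicator_def intro!: ennreal_leI)
    qed
  qed
  also have "\<dots> = ennreal (c * u)"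
    using assms by (subst nn_integral_cmult_indicator) (auto simp: ennreal_mult)
  finally show ?thesis .
qed

text \<open>The given approximants and the grid approximants are both close to \<open>H\<close>,
  hence to each other, and the comparison of elementary integrals carries the limit over. One fixed
  member of the given sequence serves all sufficiently fine grids.\<close>

theorem ito_integral_left_sums:
  assumes H: "continuous_adapted T H" and u: "0 \<le> u" "u < T" and I: "has_ito_integral P F W 0 u H I"
  shows "null_in_prob P (\<lambda>n \<omega>. left_sum H u n \<omega> - I \<omega>)"
  unfolding null_in_prob_def
proof (intro allI impI)
  fix \<epsilon> \<eta> :: real assume pos: "\<epsilon> > 0" "\<eta> > 0"
  \<comment> \<open>Chosen so that comparing elementary integrals at threshold
    \<open>\<epsilon> / 2\<close> costs exactly \<open>\<eta> / 8\<close>.\<close>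
  define \<delta> where "\<delta> = (\<epsilon> / 2)\<^sup>2 * (\<eta> / 8)"
  have \<delta>: "\<delta> > 0" "\<delta> / (\<epsilon> / 2)\<^sup>2 = \<eta> / 8" using pos by (auto simp: \<delta>_def)
  obtain n \<tau> \<xi> where simple: "\<And>k. simple_integrand F 0 u (n k) (\<tau> k) (\<xi> k)"
    and conv1: "\<And>\<epsilon>. \<epsilon> > 0 \<Longrightarrow> (\<lambda>k. measure P {\<omega> \<in> space P.
          (\<integral>\<^sup>+ s\<in>{0..u}. ennreal ((simple_process (n k) (\<tau> k) (\<xi> k) s \<omega> - H s \<omega>)\<^sup>2) \<partial>lborel) > ennreal \<epsilon>}) \<longlonglongrightarrow> 0"
    and conv2: "\<And>\<epsilon>. \<epsilon> > 0 \<Longrightarrow> (\<lambda>k. measure P {\<omega> \<in> space P. \<bar>simple_integral W (n k) (\<tau> k) (\<xi> k) \<omega> - I \<omega>\<bar> > \<epsilon>}) \<longlonglongrightarrow> 0"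
    and prog: "progressive_on F 0 u H" and Im: "I \<in> borel_measurable P"
    using I unfolding has_ito_integral_def by blast
  have \<tau>: "\<tau> k 0 = 0" "\<tau> k (n k) = u" "\<And>i. i < n k \<Longrightarrow> \<tau> k i \<le> \<tau> k (Suc i)"
    "\<And>i. i < n k \<Longrightarrow> \<xi> k i \<in> borel_measurable (F (\<tau> k i))" for k
    using simple[of k] unfolding simple_integrand_def by auto
  have \<tau>0: "0 \<le> \<tau> k i" if "i \<le> n k" for k i
    using mono_upto[of "n k" "\<tau> k" 0 i, OF \<tau>(3)] \<tau>(1)[of k] that by simp
  have SI: "simple_integral W (n k) (\<tau> k) (\<xi> k) \<in> borel_measurable P" for k
    unfolding simple_integral_def
    by (intro borel_measurable_sum borel_measurable_times borel_measurable_diff W_measurable_P measurable_F_P[OF \<tau>(4)])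
       (auto intro: \<tau>0)
  let ?d = "\<lambda>k \<omega>. \<integral>\<^sup>+ s\<in>{0..u}. ennreal ((simple_process (n k) (\<tau> k) (\<xi> k) s \<omega> - H s \<omega>)\<^sup>2) \<partial>lborel"
  have "eventually (\<lambda>k. mostly P (\<eta> / 8) (\<lambda>\<omega>. ?d k \<omega> \<le> ennreal (\<delta> / 4))) sequentially"
  proof (rule tendsto_mostly)
    have [measurable]: "?d k \<in> borel_measurable P" for k
      by (rule L2_distance_measurable[OF \<tau>(2-4) prog])
    show "{\<omega> \<in> space P. \<not> ?d k \<omega> \<le> ennreal (\<delta> / 4)} \<in> sets P" for k by measurable
    show "(\<lambda>k. measure P {\<omega> \<in> space P. \<not> ?d k \<omega> \<le> ennreal (\<delta> / 4)}) \<longlonglongrightarrow> 0"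
      using conv1[of "\<delta> / 4"] \<delta>(1) by (simp add: not_le)
  qed (use pos in simp)
  moreover have "eventually (\<lambda>k. mostly P (\<eta> / 8) (\<lambda>\<omega>. \<bar>simple_integral W (n k) (\<tau> k) (\<xi> k) \<omega> - I \<omega>\<bar> \<le> \<epsilon> / 2)) sequentially"
  proof (rule tendsto_mostly)
    show "{\<omega> \<in> space P. \<not> \<bar>simple_integral W (n k) (\<tau> k) (\<xi> k) \<omega> - I \<omega>\<bar> \<le> \<epsilon> / 2} \<in> sets P" for k
      using SI[of k] Im by measurable
    show "(\<lambda>k. measure P {\<omega> \<in> space P. \<not> \<bar>simple_integral W (n k) (\<tau> k) (\<xi> k) \<omega> - I \<omega>\<bar> \<le> \<epsilon> / 2}) \<longlonglongrightarrow> 0"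
      using conv2[of "\<epsilon> / 2"] pos by (simp add: not_le)
  qed (use pos in simp)
  ultimately have "eventually (\<lambda>k. mostly P (\<eta> / 8) (\<lambda>\<omega>. ?d k \<omega> \<le> ennreal (\<delta> / 4)) \<and>
      mostly P (\<eta> / 8) (\<lambda>\<omega>. \<bar>simple_integral W (n k) (\<tau> k) (\<xi> k) \<omega> - I \<omega>\<bar> \<le> \<epsilon> / 2)) sequentially"
    by (rule eventually_conj)
  from eventually_happens'[OF sequentially_bot this] obtain k where
    k: "mostly P (\<eta> / 8) (\<lambda>\<omega>. ?d k \<omega> \<le> ennreal (\<delta> / 4))"
       "mostly P (\<eta> / 8) (\<lambda>\<omega>. \<bar>simple_integral W (n k) (\<tau> k) (\<xi> k) \<omega> - I \<omega>\<bar> \<le> \<epsilon> / 2)" by auto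
  \<comment> \<open>From \<open>(x - y)\<^sup>2 \<le> 2 * x\<^sup>2 + 2 * y\<^sup>2\<close>, the two
    approximations contribute at most \<open>\<delta> / 2\<close> each. The \<open>u + 1\<close>
    avoids a zero denominator at \<open>u = 0\<close>.\<close>
  define e where "e = sqrt (\<delta> / (4 * (u + 1)))"
  have e: "e > 0" "e\<^sup>2 * u \<le> \<delta> / 4"
    using \<delta>(1) u(1) by (auto simp: e_def field_simps)
  obtain d where d: "d > 0"
    "mostly P (\<eta> / 8) (\<lambda>\<omega>. \<forall>s\<in>{0..u}. \<forall>s'\<in>{0..u}. \<bar>s - s'\<bar> \<le> d \<longrightarrow> \<bar>H s \<omega> - H s' \<omega>\<bar> \<le> e)"
    using mostly_uniformly_continuous[OF H u, of e "\<eta> / 8"] e(1) pos by auto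
  obtain N where N: "u / d < real N" using reals_Archimedean2 by blast
  show "eventually (\<lambda>n. mostly P \<eta> (\<lambda>\<omega>. \<bar>left_sum H u n \<omega> - I \<omega>\<bar> \<le> \<epsilon>)) sequentially"
    using eventually_ge_at_top[of "Suc N"]
  proof eventually_elim
    case (elim m)
    then have m: "0 < m" "u / m \<le> d"
      using N d(1) u(1) by (auto simp: field_simps intro: order_trans[OF less_imp_le mult_left_mono])
    have "mostly P (\<eta> / 8 + \<eta> / 8) (\<lambda>\<omega>. (\<integral>\<^sup>+ s\<in>{0..u}. ennreal ((simple_process (n k) (\<tau> k) (\<xi> k) s \<omega>
        - simple_process m (\<lambda>i. grid u m i) (\<lambda>i. H (grid u m i)) s \<omega>)\<^sup>2) \<partial>lborel) \<le> ennreal \<delta>)"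
    proof (rule mostly_conj_mono[OF k(1) d(2) order_refl])
      fix \<omega> assume \<omega>: "\<omega> \<in> space P" and 1: "?d k \<omega> \<le> ennreal (\<delta> / 4)"
        and 2: "\<forall>s\<in>{0..u}. \<forall>s'\<in>{0..u}. \<bar>s - s'\<bar> \<le> d \<longrightarrow> \<bar>H s \<omega> - H s' \<omega>\<bar> \<le> e"
      let ?S = "\<lambda>s. simple_process (n k) (\<tau> k) (\<xi> k) s \<omega>"
      let ?G = "\<lambda>s. simple_process m (\<lambda>i. grid u m i) (\<lambda>i. H (grid u m i)) s \<omega>"
      have meas: "(\<lambda>s. ennreal ((?S s - H s \<omega>)\<^sup>2) * indicator {0..u} s) \<in> borel_measurable lborel"
      proof -
        have "(\<lambda>s. indicator {0..u} s *\<^sub>R H s \<omega>) \<in> borel_measurable borel"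
          using continuous_adaptedD(3)[OF H u(2) \<omega>] by (intro borel_measurable_continuous_on_indicator) auto
        moreover have "?S \<in> borel_measurable borel" unfolding simple_process_def by measurable
        ultimately have "(\<lambda>s. ennreal ((?S s - indicator {0..u} s *\<^sub>R H s \<omega>)\<^sup>2) * indicator {0..u} s) \<in> borel_measurable lborel"
          by measurable
        also have "(\<lambda>s. ennreal ((?S s - indicator {0..u} s *\<^sub>R H s \<omega>)\<^sup>2) * indicator {0..u} s)
            = (\<lambda>s. ennreal ((?S s - H s \<omega>)\<^sup>2) * indicator {0..u} s)"
          by (auto simp: fun_eq_iff indicator_def)
        finally show ?thesis .
      qed
      have "(\<integral>\<^sup>+ s\<in>{0..u}. ennreal ((?S s - ?G s)\<^sup>2) \<partial>lborel)
          \<le> (\<integral>\<^sup>+ s. 2 * (ennreal ((?S s - H s \<omega>)\<^sup>2) * indicator {0..u} s) + ennreal (2 * e\<^sup>2) * indicator {0..u} s \<partial>lborel)"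
      proof (rule nn_integral_mono_AE)
        show "AE s in lborel. ennreal ((?S s - ?G s)\<^sup>2) * indicator {0..u} s
          \<le> 2 * (ennreal ((?S s - H s \<omega>)\<^sup>2) * indicator {0..u} s) + ennreal (2 * e\<^sup>2) * indicator {0..u} s"
          using AE_lborel_singleton[of 0]
        proof eventually_elim
          case (elim s)
          show ?case
          proof (cases "s \<in> {0..u}")
            case True
            have "(?G s - H s \<omega>)\<^sup>2 \<le> e\<^sup>2"
              using True elim 2 by (intro simple_process_grid_close[OF u(1) m]) auto
            moreover have "(?S s - ?G s)\<^sup>2 \<le> 2 * (?S s - H s \<omega>)\<^sup>2 + 2 * (?G s - H s \<omega>)\<^sup>2"
              using sum_squares_ge_zero[of "?S s + ?G s - 2 * H s \<omega>" 0]
              by (simp add: power2_eq_square algebra_simps)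
            ultimately have "(?S s - ?G s)\<^sup>2 \<le> 2 * (?S s - H s \<omega>)\<^sup>2 + 2 * e\<^sup>2" by linarith
            then have "ennreal ((?S s - ?G s)\<^sup>2) \<le> ennreal (2 * (?S s - H s \<omega>)\<^sup>2 + 2 * e\<^sup>2)"
              by (rule ennreal_leI)
            also have "\<dots> = 2 * ennreal ((?S s - H s \<omega>)\<^sup>2) + ennreal (2 * e\<^sup>2)"
              by (subst ennreal_plus) (auto simp: ennreal_mult)
            finally show ?thesis using True by simp
          qed simp
        qed
      qed
      also have "\<dots> = 2 * ?d k \<omega> + ennreal (2 * e\<^sup>2 * u)"
        using meas u(1) by (subst nn_integral_add) (auto simp: nn_integral_cmult nn_integral_cmult_indicator ennreal_mult)
      also have "\<dots> \<le> 2 * ennreal (\<delta> / 4) + ennreal (\<delta> / 2)"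
        using 1 e(2) by (intro add_mono mult_left_mono ennreal_leI) auto
      also have "\<dots> = ennreal \<delta>"
      proof -
        have "2 * ennreal (\<delta> / 4) = ennreal (2 * (\<delta> / 4))" using \<delta>(1) by (subst ennreal_mult) auto
        then show ?thesis using \<delta>(1) by (simp flip: ennreal_plus)
      qed
      finally show "(\<integral>\<^sup>+ s\<in>{0..u}. ennreal ((?S s - ?G s)\<^sup>2) \<partial>lborel) \<le> ennreal \<delta>" .
    qed
    then have "mostly P (\<eta> / 8 + \<eta> / 8 + \<delta> / (\<epsilon> / 2)\<^sup>2) (\<lambda>\<omega>. \<bar>simple_integral W (n k) (\<tau> k) (\<xi> k) \<omega>
        - simple_integral W m (\<lambda>i. grid u m i) (\<lambda>i. H (grid u m i)) \<omega>\<bar> \<le> \<epsilon> / 2)"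
    proof (rule simple_integral_diff_mostly[rotated -3])
      show "grid u m i \<le> grid u m (Suc i)" for i by (rule grid_mono[OF u(1)]) simp
      show "H (grid u m i) \<in> borel_measurable (F (grid u m i))" if "i < m" for i
        using grid_in[OF u(1), of i m] that u(2) by (intro continuous_adaptedD(1)[OF H]) auto
    qed (use \<tau> \<delta>(1) pos m in auto)
    then have "mostly P (\<eta> / 8 + \<eta> / 8 + \<eta> / 8) (\<lambda>\<omega>. \<bar>simple_integral W (n k) (\<tau> k) (\<xi> k) \<omega> - left_sum H u m \<omega>\<bar> \<le> \<epsilon> / 2)"
      unfolding \<delta>(2) left_sum_simple_integral .
    then show ?case
    proof (rule mostly_conj_mono[OF _ k(2)])
      show "\<eta> / 8 + \<eta> / 8 + \<eta> / 8 + \<eta> / 8 \<le> \<eta>" using pos by simp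
      fix \<omega> assume "\<bar>simple_integral W (n k) (\<tau> k) (\<xi> k) \<omega> - left_sum H u m \<omega>\<bar> \<le> \<epsilon> / 2"
        "\<bar>simple_integral W (n k) (\<tau> k) (\<xi> k) \<omega> - I \<omega>\<bar> \<le> \<epsilon> / 2"
      then show "\<bar>left_sum H u m \<omega> - I \<omega>\<bar> \<le> \<epsilon>" by linarith
    qed
  qed
qed

text \<open>Simple integrands have to be bounded, hence the truncation at level \<open>k\<close>.\<close>

theorem ito_integral_of_left_sums:
  assumes H: "continuous_adapted T H" and u: "0 \<le> u" "u < T"
    and I: "I \<in> borel_measurable P" "null_in_prob P (\<lambda>n \<omega>. left_sum H u n \<omega> - I \<omega>)"
  shows "has_ito_integral P F W 0 u H I"
proof -
  \<comment> \<open>With \<open>Suc k\<close> cells the last grid point is \<open>u\<close> even for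
    \<open>k = 0\<close>.\<close>
  define \<tau> where "\<tau> k i = u * real i / real (Suc k)" for k i
  define \<xi> where "\<xi> k i \<omega> = max (- real k) (min (real k) (H (\<tau> k i) \<omega>))" for k i \<omega>
  have \<tau>in: "\<tau> k i \<in> {0..u}" if "i \<le> Suc k" for k i
    unfolding \<tau>_def using grid_in[OF u(1) that] .
  \<comment> \<open>On the likely event that the path stays below \<open>C\<close>, truncation is
    inactive as soon as \<open>k\<close> reaches \<open>C\<close>.\<close>
  have \<xi>eq: "\<xi> k i \<omega> = H (\<tau> k i) \<omega>" if "i \<le> k" "\<forall>s\<in>{0..u}. \<bar>H s \<omega>\<bar> \<le> C" "C \<le> real k" for k i \<omega> C
    using that(2)[rule_format, OF \<tau>in[of i k]] that(1,3) unfolding \<xi>_def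
    by (simp add: abs_le_iff max.absorb2 min.absorb2)
  have evC: "eventually (\<lambda>k. C \<le> real k) sequentially" for C
    using filterlim_real_sequentially unfolding filterlim_at_top by auto
  have "simple_integrand F 0 u (Suc k) (\<tau> k) (\<xi> k)" for k
    unfolding simple_integrand_def
  proof (intro conjI allI impI)
    fix i assume i: "i < Suc k"
    show "\<tau> k i \<le> \<tau> k (Suc i)" unfolding \<tau>_def by (rule grid_mono[OF u(1)]) simp
    have "H (\<tau> k i) \<in> borel_measurable (F (\<tau> k i))"
      using \<tau>in[of i k] i u(2) by (intro continuous_adaptedD(1)[OF H]) auto
    then show "\<xi> k i \<in> borel_measurable (F (\<tau> k i))"
      unfolding \<xi>_def by (intro borel_measurable_max borel_measurable_min borel_measurable_const)
    show "\<exists>C. \<forall>\<omega>\<in>space (F (\<tau> k i)). \<bar>\<xi> k i \<omega>\<bar> \<le> C"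
      unfolding \<xi>_def by (intro exI[of _ "real k"]) auto
  qed (auto simp: \<tau>_def)
  moreover have "(\<lambda>k. measure P {\<omega> \<in> space P.
      (\<integral>\<^sup>+ s\<in>{0..u}. ennreal ((simple_process (Suc k) (\<tau> k) (\<xi> k) s \<omega> - H s \<omega>)\<^sup>2) \<partial>lborel) > ennreal \<epsilon>}) \<longlonglongrightarrow> 0"
    if "\<epsilon> > 0" for \<epsilon>
    unfolding not_le[symmetric]
  proof (rule mostly_tendsto)
    fix \<eta> :: real assume \<eta>: "\<eta> > 0"
    define e where "e = sqrt (\<epsilon> / (u + 1))"
    have e: "e > 0" "e\<^sup>2 * u \<le> \<epsilon>"
      using that u(1) by (auto simp: e_def field_simps)
    obtain d where d: "d > 0"
      "mostly P (\<eta> / 2) (\<lambda>\<omega>. \<forall>s\<in>{0..u}. \<forall>s'\<in>{0..u}. \<bar>s - s'\<bar> \<le> d \<longrightarrow> \<bar>H s \<omega> - H s' \<omega>\<bar> \<le> e)"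
      using mostly_uniformly_continuous[OF H u, of e "\<eta> / 2"] e(1) \<eta> by auto
    obtain C where C: "C > 0" "mostly P (\<eta> / 2) (\<lambda>\<omega>. \<forall>s\<in>{0..u}. \<bar>H s \<omega>\<bar> \<le> C)"
      using mostly_pathwise_bounded[OF H u, of "\<eta> / 2"] \<eta> by auto
    show "eventually (\<lambda>k. mostly P \<eta> (\<lambda>\<omega>.
      (\<integral>\<^sup>+ s\<in>{0..u}. ennreal ((simple_process (Suc k) (\<tau> k) (\<xi> k) s \<omega> - H s \<omega>)\<^sup>2) \<partial>lborel) \<le> ennreal \<epsilon>)) sequentially"
      using evC[of C] evC[of "u / d"]
    proof eventually_elim
      case (elim k)
      then have k: "u / real (Suc k) \<le> d" using d(1) u(1) by (simp add: field_simps)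
      show ?case
      proof (rule mostly_conj_mono[OF d(2) C(2)])
        fix \<omega> assume 1: "\<forall>s\<in>{0..u}. \<forall>s'\<in>{0..u}. \<bar>s - s'\<bar> \<le> d \<longrightarrow> \<bar>H s \<omega> - H s' \<omega>\<bar> \<le> e" and 2: "\<forall>s\<in>{0..u}. \<bar>H s \<omega>\<bar> \<le> C"
        have "(simple_process (Suc k) (\<tau> k) (\<xi> k) s \<omega> - H s \<omega>)\<^sup>2 \<le> e\<^sup>2" if "0 < s" "s \<le> u" for s
          unfolding \<tau>_def
        proof (rule simple_process_grid_close[OF u(1) _ k _ _ that])
          show "\<xi> k i \<omega> = H (u * real i / real (Suc k)) \<omega>" if "i < Suc k" for i
            using \<xi>eq[of i k \<omega> C] 2 elim(1) that unfolding \<tau>_def by simp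
        qed (use 1 in auto)
        then have "(\<integral>\<^sup>+ s\<in>{0..u}. ennreal ((simple_process (Suc k) (\<tau> k) (\<xi> k) s \<omega> - H s \<omega>)\<^sup>2) \<partial>lborel) \<le> ennreal (e\<^sup>2 * u)"
          by (intro nn_integral_interval_const u(1)) auto
        also have "\<dots> \<le> ennreal \<epsilon>" using e(2) by (rule ennreal_leI)
        finally show "(\<integral>\<^sup>+ s\<in>{0..u}. ennreal ((simple_process (Suc k) (\<tau> k) (\<xi> k) s \<omega> - H s \<omega>)\<^sup>2) \<partial>lborel) \<le> ennreal \<epsilon>" .
      qed simp
    qed
  qed
  moreover have "(\<lambda>k. measure P {\<omega> \<in> space P. \<bar>simple_integral W (Suc k) (\<tau> k) (\<xi> k) \<omega> - I \<omega>\<bar> > \<epsilon>}) \<longlonglongrightarrow> 0"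
    if "\<epsilon> > 0" for \<epsilon>
    unfolding not_le[symmetric]
  proof (rule mostly_tendsto)
    fix \<eta> :: real assume \<eta>: "\<eta> > 0"
    obtain C where C: "C > 0" "mostly P (\<eta> / 2) (\<lambda>\<omega>. \<forall>s\<in>{0..u}. \<bar>H s \<omega>\<bar> \<le> C)"
      using mostly_pathwise_bounded[OF H u, of "\<eta> / 2"] \<eta> by auto
    have "eventually (\<lambda>n. mostly P (\<eta> / 2) (\<lambda>\<omega>. \<bar>left_sum H u n \<omega> - I \<omega>\<bar> \<le> \<epsilon>)) sequentially"
      using I(2) that \<eta> unfolding null_in_prob_def by simp
    then have "eventually (\<lambda>n. mostly P (\<eta> / 2) (\<lambda>\<omega>. \<bar>left_sum H u (Suc n) \<omega> - I \<omega>\<bar> \<le> \<epsilon>)) sequentially"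
      by (subst eventually_sequentially_Suc)
    then show "eventually (\<lambda>k. mostly P \<eta> (\<lambda>\<omega>. \<bar>simple_integral W (Suc k) (\<tau> k) (\<xi> k) \<omega> - I \<omega>\<bar> \<le> \<epsilon>)) sequentially"
      using evC[of C]
    proof eventually_elim
      case (elim k)
      show ?case
      proof (rule mostly_conj_mono[OF elim(1) C(2)])
        fix \<omega> assume 1: "\<bar>left_sum H u (Suc k) \<omega> - I \<omega>\<bar> \<le> \<epsilon>" and 2: "\<forall>s\<in>{0..u}. \<bar>H s \<omega>\<bar> \<le> C"
        have "simple_integral W (Suc k) (\<tau> k) (\<xi> k) \<omega> = left_sum H u (Suc k) \<omega>"
          unfolding simple_integral_def left_sum_def \<tau>_def[symmetric]
          by (rule sum.cong) (use \<xi>eq[OF _ 2 elim(2)] in \<open>simp_all add: \<tau>_def\<close>)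
        then show "\<bar>simple_integral W (Suc k) (\<tau> k) (\<xi> k) \<omega> - I \<omega>\<bar> \<le> \<epsilon>" using 1 by simp
      qed simp
    qed
  qed
  ultimately show ?thesis
    unfolding has_ito_integral_def using continuous_adapted_progressive[OF H u] I(1)
    by (intro conjI exI[of _ "Suc"] exI[of _ \<tau>] exI[of _ \<xi>] allI impI) auto
qed

end

section \<open>Pathwise estimates along the uniform grid\<close>

lemma LINT_continuous:
  fixes a :: "real \<Rightarrow> real"
  assumes "continuous_on {0..u} a"
  shows "(LINT s:{0..u}|lborel. a s) = integral {0..u} a"
  by (rule set_borel_integral_eq_integral(2)[OF borel_integrable_atLeastAtMost'[OF assms]])

lemma integral_increment:
  fixes a :: "real \<Rightarrow> real"
  assumes "continuous_on {0..u} a" "0 \<le> s" "s \<le> t" "t \<le> u"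
  shows "(LINT r:{0..t}|lborel. a r) - (LINT r:{0..s}|lborel. a r) = integral {s..t} a"
proof -
  have c: "continuous_on {0..t} a" "continuous_on {0..s} a"
    using assms by (auto intro: continuous_on_subset)
  have "integral {0..s} a + integral {s..t} a = integral {0..t} a"
    using assms c by (intro Henstock_Kurzweil_Integration.integral_combine integrable_continuous_real) auto
  then show ?thesis using LINT_continuous[OF c(1)] LINT_continuous[OF c(2)] by simp
qed

lemma continuous_on_LINT:
  fixes a :: "real \<Rightarrow> real"
  assumes "continuous_on {0..u} a"
  shows "continuous_on {0..u} (\<lambda>t. LINT r:{0..t}|lborel. a r)"
proof -
  have "continuous_on {0..u} (\<lambda>t. integral {0..t} a)"
    by (rule indefinite_integral_continuous_1[OF integrable_continuous_real[OF assms]])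
  then show ?thesis
  proof (rule continuous_on_eq)
    fix t assume "t \<in> {0..u}"
    then show "integral {0..t} a = (LINT r:{0..t}|lborel. a r)"
      by (intro LINT_continuous[symmetric] continuous_on_subset[OF assms]) auto
  qed
qed

lemma grid_step: "grid u n (Suc i) = grid u n i + u / real n" for u :: real
  by (simp add: add_divide_distrib distrib_left)

lemma grid_Icc:
  fixes u :: real
  assumes "0 \<le> u" "i < n"
  shows "0 \<le> grid u n i" "grid u n i \<le> grid u n (Suc i)" "grid u n (Suc i) \<le> u"
  using grid_in[OF assms(1), of i n] grid_mono[OF assms(1), of i "Suc i" n] grid_in[OF assms(1), of "Suc i" n] assms(2)
  by auto

lemma LINT_increment_bound:
  fixes a :: "real \<Rightarrow> real"
  assumes a: "continuous_on {0..u} a" "\<And>s. s \<in> {0..u} \<Longrightarrow> \<bar>a s\<bar> \<le> C" and u: "0 \<le> u" "i < n"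
  shows "\<bar>(LINT r:{0..grid u n (Suc i)}|lborel. a r) - (LINT r:{0..grid u n i}|lborel. a r)\<bar> \<le> C * (u / n)"
proof -
  note g = grid_Icc[OF u]
  have "norm (integral {grid u n i..grid u n (Suc i)} a) \<le> C * (grid u n (Suc i) - grid u n i)"
    using g a by (intro integral_bound continuous_on_subset[OF a(1)]) auto
  then show ?thesis
    unfolding integral_increment[OF a(1) g] by (simp add: grid_step del: of_nat_Suc)
qed

text \<open>Since \<open>A\<close> is a primitive of \<open>a\<close>, the error on a cell starting
  at \<open>t\<close> is the integral of \<open>(g t - g r) * a r\<close>, which uniform continuity
  of \<open>g\<close> controls.\<close>

lemma riemann_stieltjes_tendsto:
  fixes g a :: "real \<Rightarrow> real"
  assumes g: "continuous_on {0..u} g" and a: "continuous_on {0..u} a" and u: "0 \<le> u"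
  defines "A \<equiv> \<lambda>t. LINT r:{0..t}|lborel. a r"
  shows "(\<lambda>n. \<Sum>i<n. g (grid u n i) * (A (grid u n (Suc i)) - A (grid u n i)))
    \<longlonglongrightarrow> (LINT s:{0..u}|lborel. g s * a s)"
proof (rule LIMSEQ_I)
  fix \<epsilon> :: real assume "\<epsilon> > 0"
  have ga: "continuous_on {0..u} (\<lambda>s. g s * a s)" by (intro continuous_on_mult g a)
  define G where "G t = (LINT r:{0..t}|lborel. g r * a r)" for t
  have "compact (a ` {0..u})" by (intro compact_continuous_image a compact_Icc)
  then obtain C where C: "C > 0" "\<And>s. s \<in> {0..u} \<Longrightarrow> \<bar>a s\<bar> \<le> C"
    using compact_imp_bounded bounded_pos by (metis imageI real_norm_def)
  define e where "e = \<epsilon> / (2 * (C * (u + 1)))"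
  have e: "e > 0" "e * C * u < \<epsilon>"
  proof -
    show "e > 0" using \<open>\<epsilon> > 0\<close> C(1) u by (simp add: e_def)
    have "e * C * u \<le> e * (C * (u + 1))" using \<open>e > 0\<close> C(1) by (simp add: mult.assoc)
    also have "\<dots> = \<epsilon> / 2" using C(1) u by (simp add: e_def)
    also have "\<dots> < \<epsilon>" using \<open>\<epsilon> > 0\<close> by simp
    finally show "e * C * u < \<epsilon>" .
  qed
  have "uniformly_continuous_on {0..u} g" using g by (intro compact_uniformly_continuous) auto
  then obtain d where d: "d > 0" "\<And>s s'. s \<in> {0..u} \<Longrightarrow> s' \<in> {0..u} \<Longrightarrow> \<bar>s' - s\<bar> < d \<Longrightarrow> \<bar>g s' - g s\<bar> < e"
    using e(1) unfolding uniformly_continuous_on_def dist_real_def by blast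
  obtain N where N: "u / d < real N" using reals_Archimedean2 by blast
  show "\<exists>no. \<forall>n\<ge>no. norm ((\<Sum>i<n. g (grid u n i) * (A (grid u n (Suc i)) - A (grid u n i)))
      - (LINT s:{0..u}|lborel. g s * a s)) < \<epsilon>"
  proof (intro exI allI impI)
    fix n assume n: "n \<ge> Suc N"
    have un: "u / n < d"
    proof -
      have "u < real N * d" using N d(1) by (simp add: field_simps)
      also have "\<dots> \<le> real n * d" using n d(1) by (intro mult_right_mono) auto
      finally show ?thesis using n by (simp add: field_simps)
    qed
    have "G u - G 0 = (\<Sum>i<n. G (grid u n (Suc i)) - G (grid u n i))"
      using n by (subst sum_lessThan_telescope) simp
    moreover have "G 0 = 0" unfolding G_def by (subst LINT_continuous) auto
    ultimately have eq: "(\<Sum>i<n. g (grid u n i) * (A (grid u n (Suc i)) - A (grid u n i))) - G u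
      = (\<Sum>i<n. g (grid u n i) * (A (grid u n (Suc i)) - A (grid u n i)) - (G (grid u n (Suc i)) - G (grid u n i)))"
      by (simp add: sum_subtractf)
    have "\<bar>(\<Sum>i<n. g (grid u n i) * (A (grid u n (Suc i)) - A (grid u n i))) - G u\<bar> \<le> (\<Sum>i<n. e * C * (u / n))"
      unfolding eq
    proof (rule order_trans[OF sum_abs sum_mono])
      fix i assume "i \<in> {..<n}"
      then have i: "i < n" by simp
      let ?s = "grid u n i" and ?t = "grid u n (Suc i)"
      note st = grid_Icc[OF u i]
      have c: "continuous_on {?s..?t} a" "continuous_on {?s..?t} g"
        using st by (auto intro: continuous_on_subset[OF a] continuous_on_subset[OF g])
      have eq: "g ?s * (A ?t - A ?s) - (G ?t - G ?s) = integral {?s..?t} (\<lambda>r. g ?s * a r - g r * a r)"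
        unfolding A_def G_def integral_increment[OF a st] integral_increment[OF ga st]
        using c by (subst Henstock_Kurzweil_Integration.integral_diff)
          (auto intro!: integrable_continuous_real continuous_intros)
      have "norm (integral {?s..?t} (\<lambda>r. g ?s * a r - g r * a r)) \<le> (e * C) * (?t - ?s)"
      proof (rule integral_bound[OF st(2)])
        show "continuous_on {?s..?t} (\<lambda>r. g ?s * a r - g r * a r)"
          using c by (intro continuous_intros)
        fix r assume r: "r \<in> {?s..?t}"
        then have "\<bar>?s - r\<bar> < d" using un by (simp add: grid_step del: of_nat_Suc)
        then have "\<bar>g ?s - g r\<bar> < e" using d(2)[of r ?s] r st by auto
        moreover have "\<bar>a r\<bar> \<le> C" using C(2) r st by auto
        ultimately have "\<bar>g ?s - g r\<bar> * \<bar>a r\<bar> \<le> e * C" by (intro mult_mono) auto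
        then show "norm (g ?s * a r - g r * a r) \<le> e * C"
          by (simp add: abs_mult[symmetric] left_diff_distrib)
      qed
      moreover have "?t - ?s = u / n" by (simp add: grid_step del: of_nat_Suc)
      ultimately show "\<bar>g ?s * (A ?t - A ?s) - (G ?t - G ?s)\<bar> \<le> e * C * (u / n)" unfolding eq by simp
    qed
    also have "\<dots> = e * C * u"
    proof -
      have "real n \<noteq> 0" using n by simp
      then show ?thesis by (simp only: sum_constant card_lessThan) (simp add: field_simps)
    qed
    also have "\<dots> < \<epsilon>" by (rule e(2))
    finally show "norm ((\<Sum>i<n. g (grid u n i) * (A (grid u n (Suc i)) - A (grid u n i)))
      - (LINT s:{0..u}|lborel. g s * a s)) < \<epsilon>"
      by (simp add: G_def)
  qed
qed

lemma riemann_sum_tendsto: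
  fixes g :: "real \<Rightarrow> real"
  assumes g: "continuous_on {0..u} g" and u: "0 \<le> u"
  shows "(\<lambda>n. \<Sum>i<n. g (grid u n i) * (u / n)) \<longlonglongrightarrow> (LINT s:{0..u}|lborel. g s)"
proof -
  have 1: "(LINT r:{0..t}|lborel. 1) = t" if "0 \<le> t" for t :: real
    using that by (subst LINT_continuous) auto
  have "(\<Sum>i<n. g (grid u n i) * ((LINT r:{0..grid u n (Suc i)}|lborel. 1) - (LINT r:{0..grid u n i}|lborel. 1)))
     = (\<Sum>i<n. g (grid u n i) * (u / n))" for n
    using u by (intro sum.cong) (auto simp: 1 grid_step simp del: of_nat_Suc)
  then show ?thesis using riemann_stieltjes_tendsto[OF g continuous_on_const[of _ 1] u] by simp
qed

text \<open>A primitive of a bounded function is Lipschitz, so there are \<open>n\<close> squares of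
  order \<open>1 / n\<^sup>2\<close>.\<close>

lemma sum_squares_increments_tendsto:
  fixes a :: "real \<Rightarrow> real"
  assumes a: "continuous_on {0..u} a" and u: "0 \<le> u"
  defines "A \<equiv> \<lambda>t. LINT r:{0..t}|lborel. a r"
  shows "(\<lambda>n. \<Sum>i<n. (A (grid u n (Suc i)) - A (grid u n i))\<^sup>2) \<longlonglongrightarrow> 0"
proof -
  have "compact (a ` {0..u})" by (intro compact_continuous_image a compact_Icc)
  then obtain C where C: "C > 0" "\<And>s. s \<in> {0..u} \<Longrightarrow> \<bar>a s\<bar> \<le> C"
    using compact_imp_bounded bounded_pos by (metis imageI real_norm_def)
  have "(\<Sum>i<n. (A (grid u n (Suc i)) - A (grid u n i))\<^sup>2) \<le> (C * u)\<^sup>2 / n" for n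
  proof -
    have "(\<Sum>i<n. (A (grid u n (Suc i)) - A (grid u n i))\<^sup>2) \<le> (\<Sum>i<n. (C * (u / n))\<^sup>2)"
    proof (rule sum_mono)
      fix i assume "i \<in> {..<n}"
      then have "\<bar>A (grid u n (Suc i)) - A (grid u n i)\<bar> \<le> C * (u / n)"
        unfolding A_def using LINT_increment_bound[OF a C(2) u] by simp
      then have "\<bar>A (grid u n (Suc i)) - A (grid u n i)\<bar>\<^sup>2 \<le> (C * (u / n))\<^sup>2"
        by (rule power_mono) simp
      then show "(A (grid u n (Suc i)) - A (grid u n i))\<^sup>2 \<le> (C * (u / n))\<^sup>2" by simp
    qed
    also have "\<dots> = (C * u)\<^sup>2 / n" by (simp add: power2_eq_square field_simps)
    finally show ?thesis .
  qed
  then show ?thesis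
    by (intro tendsto_sandwich[OF _ _ tendsto_const lim_const_over_n[of "(C * u)\<^sup>2"]])
       (auto intro!: always_eventually sum_nonneg)
qed

lemma uniformly_continuous_rectangle:
  fixes g :: "real \<Rightarrow> real \<Rightarrow> real"
  assumes g: "continuous_on (S \<times> J) (\<lambda>(t, x). g t x)" and K: "compact A" "compact B" "A \<subseteq> S" "B \<subseteq> J" and e: "\<epsilon> > 0"
  shows "\<exists>d>0. \<forall>s\<in>A. \<forall>s'\<in>A. \<forall>y\<in>B. \<forall>y'\<in>B. \<bar>s - s'\<bar> < d \<longrightarrow> \<bar>y - y'\<bar> < d \<longrightarrow> \<bar>g s y - g s' y'\<bar> < \<epsilon>"
proof -
  have "uniformly_continuous_on (A \<times> B) (\<lambda>(t, x). g t x)"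
    using K by (intro compact_uniformly_continuous compact_Times continuous_on_subset[OF g]) auto
  then obtain d where d: "d > 0" "\<And>p q. p \<in> A \<times> B \<Longrightarrow> q \<in> A \<times> B \<Longrightarrow> dist q p < d \<Longrightarrow>
      dist (case q of (t, x) \<Rightarrow> g t x) (case p of (t, x) \<Rightarrow> g t x) < \<epsilon>"
    using e unfolding uniformly_continuous_on_def by blast
  show ?thesis
  proof (intro exI[of _ "d / 2"] conjI ballI impI)
    fix s s' y y' assume *: "s \<in> A" "s' \<in> A" "y \<in> B" "y' \<in> B" "\<bar>s - s'\<bar> < d / 2" "\<bar>y - y'\<bar> < d / 2"
    have "dist (s, y) (s', y') \<le> \<bar>s - s'\<bar> + \<bar>y - y'\<bar>"
      unfolding dist_Pair_Pair dist_real_def by (rule order_trans[OF sqrt_sum_squares_le_sum_abs]) simp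
    then have "dist (s, y) (s', y') < d" using * by linarith
    then show "\<bar>g s y - g s' y'\<bar> < \<epsilon>"
      using d(2)[of "(s', y')" "(s, y)"] * by (simp add: dist_real_def)
  qed (use d(1) in simp)
qed

text \<open>Using \<open>closed_segment\<close> covers both orders of the two points, and their
  equality, by one formula.\<close>

lemma taylor_second_order:
  fixes f f1 f2 :: "real \<Rightarrow> real"
  assumes f: "\<And>z. z \<in> closed_segment x y \<Longrightarrow> (f has_real_derivative f1 z) (at z)"
    "\<And>z. z \<in> closed_segment x y \<Longrightarrow> (f1 has_real_derivative f2 z) (at z)"
  shows "\<exists>z\<in>closed_segment x y. f y = f x + f1 x * (y - x) + f2 z / 2 * (y - x)\<^sup>2"
proof (cases "x = y")
  case False
  define diff where "diff m = (if m = 0 then f else if m = Suc 0 then f1 else f2)" for m :: nat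
  have "\<exists>t. (if y < x then y < t \<and> t < x else x < t \<and> t < y) \<and>
      f y = (\<Sum>m<2. diff m x / fact m * (y - x) ^ m) + diff 2 t / fact 2 * (y - x) ^ 2"
  proof (rule Taylor[where a="min x y" and b="max x y"])
    show "\<forall>m t. m < 2 \<and> min x y \<le> t \<and> t \<le> max x y \<longrightarrow> (diff m has_real_derivative diff (Suc m) t) (at t)"
    proof (intro allI impI)
      fix m :: nat and t assume *: "m < 2 \<and> min x y \<le> t \<and> t \<le> max x y"
      then have "t \<in> closed_segment x y" by (auto simp: closed_segment_eq_real_ivl min_def max_def split: if_splits)
      moreover have "m = 0 \<or> m = Suc 0" using * by auto
      ultimately show "(diff m has_real_derivative diff (Suc m) t) (at t)"
        using f[of t] by (auto simp: diff_def)
    qed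
  qed (use False in \<open>auto simp: diff_def\<close>)
  then obtain t where "if y < x then y < t \<and> t < x else x < t \<and> t < y"
    "f y = (\<Sum>m<2. diff m x / fact m * (y - x) ^ m) + diff 2 t / fact 2 * (y - x) ^ 2" by auto
  then show ?thesis
    by (intro bexI[of _ t]) (auto simp: diff_def numeral_2_eq_2 closed_segment_eq_real_ivl split: if_splits)
qed auto

text \<open>The deterministic half of Ito's formula, for one continuous path. Each increment splits
  into a move in space at the old time and a move in time at the new position. Replacing the
  intermediate derivatives by those at the left end point costs a uniformly small factor of the time
  step and of the squared space step.\<close>

lemma ito_taylor_remainder:
  fixes k kt kx kxx :: "real \<Rightarrow> real \<Rightarrow> real" and x :: "real \<Rightarrow> real"
  assumes x: "continuous_on {0..u} x" "x ` {0..u} \<subseteq> J" and u: "0 \<le> u" "u < T" and pos: "\<epsilon> > 0"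
    and kt: "\<And>t x. t \<in> {0..<T} \<Longrightarrow> x \<in> J \<Longrightarrow> ((\<lambda>t. k t x) has_real_derivative kt t x) (at t within {0..<T})"
    and kx: "\<And>t x. t \<in> {0..<T} \<Longrightarrow> x \<in> J \<Longrightarrow> (k t has_real_derivative kx t x) (at x)"
    and kxx: "\<And>t x. t \<in> {0..<T} \<Longrightarrow> x \<in> J \<Longrightarrow> (kx t has_real_derivative kxx t x) (at x)"
    and cont: "continuous_on ({0..<T} \<times> J) (\<lambda>(t, x). kt t x)" "continuous_on ({0..<T} \<times> J) (\<lambda>(t, x). kxx t x)"
  shows "\<exists>N. \<forall>n\<ge>N. \<bar>\<Sum>i<n. let t = grid u n i; t' = grid u n (Suc i) in
      k t' (x t') - k t (x t) - kt t (x t) * (u / n) - kx t (x t) * (x t' - x t) - kxx t (x t) / 2 * (x t' - x t)\<^sup>2\<bar>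
      \<le> \<epsilon> * (u + (\<Sum>i<n. (x (grid u n (Suc i)) - x (grid u n i))\<^sup>2))"
proof -
  let ?B = "x ` {0..u}"
  have B: "compact ?B" by (intro compact_continuous_image x compact_Icc)
  have sub: "{0..u} \<subseteq> {0..<T}" using u by auto
  obtain d1 where d1: "d1 > 0" "\<And>s s' y y'. s \<in> {0..u} \<Longrightarrow> s' \<in> {0..u} \<Longrightarrow> y \<in> ?B \<Longrightarrow> y' \<in> ?B \<Longrightarrow>
      \<bar>s - s'\<bar> < d1 \<Longrightarrow> \<bar>y - y'\<bar> < d1 \<Longrightarrow> \<bar>kt s y - kt s' y'\<bar> < \<epsilon>"
    using uniformly_continuous_rectangle[OF cont(1) compact_Icc B sub x(2) pos] by blast
  obtain d2 where d2: "d2 > 0" "\<And>s s' y y'. s \<in> {0..u} \<Longrightarrow> s' \<in> {0..u} \<Longrightarrow> y \<in> ?B \<Longrightarrow> y' \<in> ?B \<Longrightarrow>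
      \<bar>s - s'\<bar> < d2 \<Longrightarrow> \<bar>y - y'\<bar> < d2 \<Longrightarrow> \<bar>kxx s y - kxx s' y'\<bar> < \<epsilon>"
    using uniformly_continuous_rectangle[OF cont(2) compact_Icc B sub x(2) pos] by blast
  define d where "d = min d1 d2"
  have d: "d > 0" "d \<le> d1" "d \<le> d2" using d1 d2 by (auto simp: d_def)
  have "uniformly_continuous_on {0..u} x" using x(1) by (intro compact_uniformly_continuous) auto
  then obtain d3 where d3: "d3 > 0" "\<And>s s'. s \<in> {0..u} \<Longrightarrow> s' \<in> {0..u} \<Longrightarrow> \<bar>s' - s\<bar> < d3 \<Longrightarrow> \<bar>x s' - x s\<bar> < d"
    using d(1) unfolding uniformly_continuous_on_def dist_real_def by blast
  obtain N where N: "u / min d d3 < real N" using reals_Archimedean2 by blast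
  show ?thesis
  proof (intro exI allI impI)
    fix n assume n: "n \<ge> Suc N"
    have un: "u / n < min d d3"
    proof -
      define m where "m = min d d3"
      have m: "m > 0" "u / m < real N" using N d(1) d3(1) by (auto simp: m_def)
      have "u < real N * m" using m by (simp add: pos_divide_less_eq)
      also have "\<dots> \<le> real n * m" using n m(1) by (intro mult_right_mono) auto
      finally show ?thesis using n unfolding m_def[symmetric] by (simp add: pos_divide_less_eq mult.commute)
    qed
    have step: "\<bar>k t' (x t') - k t (x t) - kt t (x t) * (u / n) - kx t (x t) * (x t' - x t) - kxx t (x t) / 2 * (x t' - x t)\<^sup>2\<bar>
      \<le> \<epsilon> * (u / n + (x t' - x t)\<^sup>2)" if tt: "0 \<le> t" "t \<le> t'" "t' \<le> u" "t' = t + u / n" for t t'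
    proof -
      have in_u: "t \<in> {0..u}" "t' \<in> {0..u}" using tt by auto
      have close: "\<bar>x r - x t\<bar> < d" if "r \<in> {t..t'}" for r
      proof -
        have "\<bar>r - t\<bar> < d3" "r \<in> {0..u}" using that tt(1-3) un unfolding tt(4) by simp_all
        then show ?thesis by (intro d3(2) in_u(1))
      qed
      \<comment> \<open>By the intermediate value property every point of the segment is a value of
        the path in this cell. Hence the Taylor point lies in \<open>J\<close>, which need not be
        convex, and is close to \<open>x t\<close>.\<close>
      have seg: "closed_segment (x t) (x t') \<subseteq> x ` {t..t'}"
      proof -
        have "connected (x ` {t..t'})"
          using tt by (intro connected_continuous_image continuous_on_subset[OF x(1)]) auto
        then have "convex (x ` {t..t'})" by (simp only: is_interval_connected_1[symmetric] is_interval_convex_1[symmetric])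
        then show ?thesis using tt by (intro closed_segment_subset) auto
      qed
      have segJ: "closed_segment (x t) (x t') \<subseteq> ?B"
        using tt(1,3) by (intro order_trans[OF seg image_mono]) simp
      have tT: "t \<in> {0..<T}" using in_u sub by auto
      have "\<exists>z\<in>closed_segment (x t) (x t'). k t (x t') = k t (x t) + kx t (x t) * (x t' - x t) + kxx t z / 2 * (x t' - x t)\<^sup>2"
      proof (rule taylor_second_order)
        fix z assume "z \<in> closed_segment (x t) (x t')"
        then have "z \<in> J" using segJ x(2) by (rule subsetD[OF order_trans, rotated 2])
        then show "(k t has_real_derivative kx t z) (at z)" "(kx t has_real_derivative kxx t z) (at z)"
          using kx kxx tT by simp_all
      qed
      then obtain z where z: "z \<in> closed_segment (x t) (x t')"
        "k t (x t') = k t (x t) + kx t (x t) * (x t' - x t) + kxx t z / 2 * (x t' - x t)\<^sup>2" by auto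
      obtain r where r: "r \<in> {t..t'}" "z = x r" using seg z(1) by auto
      have zB: "z \<in> ?B" "x t \<in> ?B" "x t' \<in> ?B" using r tt in_u by auto
      have e2: "\<bar>kxx t z - kxx t (x t)\<bar> < \<epsilon>"
        using close[OF r(1)] d(3) d2(1) in_u zB unfolding r(2)[symmetric] by (intro d2(2)) auto
      \<comment> \<open>The mean value theorem in time at the fixed position \<open>x t'\<close>;
        for \<open>t = t'\<close> both sides vanish.\<close>
      have "\<exists>s\<in>{t..t'}. k t' (x t') - k t (x t') = kt s (x t') * (t' - t)"
      proof (cases "t = t'")
        case False
        then have lt: "t < t'" using tt by simp
        have xJ: "x t' \<in> J" using zB x(2) by auto
        have *: "((\<lambda>t. k t (x t')) has_real_derivative kt s (x t')) (at s within {t..t'})" if "s \<in> {t..t'}" for s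
        proof (rule DERIV_subset[OF kt[OF _ xJ]])
          show "s \<in> {0..<T}" "{t..t'} \<subseteq> {0..<T}" using that tt(1,3) u by auto
        qed
        obtain s where "t < s" "s < t'" "k t' (x t') - k t (x t') = kt s (x t') * (t' - t)"
        proof (rule mvt[OF lt, of "\<lambda>t. k t (x t')" "\<lambda>s h. kt s (x t') * h"])
          show "continuous_on {t..t'} (\<lambda>t. k t (x t'))"
            using * by (rule DERIV_continuous_on)
          fix s assume s: "t < s" "s < t'"
          then have "at s within {t..t'} = at s" by (intro at_within_interior) auto
          then show "((\<lambda>t. k t (x t')) has_derivative (\<lambda>h. kt s (x t') * h)) (at s)"
            using *[of s] s by (simp add: has_field_derivative_def)
        qed
        then show ?thesis by (intro bexI[of _ s]) auto
      qed auto
      then obtain s where s: "s \<in> {t..t'}" "k t' (x t') - k t (x t') = kt s (x t') * (t' - t)" by auto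
      have "\<bar>s - t\<bar> < d1" using s(1) un d unfolding tt(4) by simp
      moreover have "\<bar>x t' - x t\<bar> < d1" using close[of t'] tt d by auto
      ultimately have e1: "\<bar>kt s (x t') - kt t (x t)\<bar> < \<epsilon>"
        using in_u zB s(1) tt by (intro d1(2)) auto
      have eq: "k t' (x t') - k t (x t) - kt t (x t) * (u / n) - kx t (x t) * (x t' - x t) - kxx t (x t) / 2 * (x t' - x t)\<^sup>2
        = (kt s (x t') - kt t (x t)) * (u / n) + (kxx t z - kxx t (x t)) / 2 * (x t' - x t)\<^sup>2"
        using s(2) z(2) tt(4) by (simp add: algebra_simps diff_divide_distrib)
      have "\<bar>(kt s (x t') - kt t (x t)) * (u / n) + (kxx t z - kxx t (x t)) / 2 * (x t' - x t)\<^sup>2\<bar> \<le> \<bar>kt s (x t') - kt t (x t)\<bar> * (u / n) + \<bar>kxx t z - kxx t (x t)\<bar> / 2 * (x t' - x t)\<^sup>2"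
        using u(1) by (intro order_trans[OF abs_triangle_ineq]) (simp add: abs_mult)
      also have "\<dots> \<le> \<epsilon> * (u / n) + \<epsilon> * (x t' - x t)\<^sup>2"
        using e1 e2 u(1) by (intro add_mono mult_right_mono) auto
      finally show ?thesis unfolding eq by (simp only: distrib_left)
    qed
    have "\<bar>\<Sum>i<n. let t = grid u n i; t' = grid u n (Suc i) in
      k t' (x t') - k t (x t) - kt t (x t) * (u / n) - kx t (x t) * (x t' - x t) - kxx t (x t) / 2 * (x t' - x t)\<^sup>2\<bar>
      \<le> (\<Sum>i<n. \<epsilon> * (u / n + (x (grid u n (Suc i)) - x (grid u n i))\<^sup>2))"
      unfolding Let_def
      by (rule order_trans[OF sum_abs sum_mono], rule step) (use grid_Icc[OF u(1)] grid_step in auto)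
    also have "\<dots> = \<epsilon> * (u + (\<Sum>i<n. (x (grid u n (Suc i)) - x (grid u n i))\<^sup>2))"
      using n by (simp add: sum_distrib_left[symmetric] sum.distrib)
    finally show "\<bar>\<Sum>i<n. let t = grid u n i; t' = grid u n (Suc i) in
      k t' (x t') - k t (x t) - kt t (x t) * (u / n) - kx t (x t) * (x t' - x t) - kxx t (x t) / 2 * (x t' - x t)\<^sup>2\<bar>
      \<le> \<epsilon> * (u + (\<Sum>i<n. (x (grid u n (Suc i)) - x (grid u n i))\<^sup>2))" .
  qed
qed

lemma continuous_zero_from_rationals:
  fixes F :: "real \<Rightarrow> real"
  assumes "continuous_on {0..<T} F" "\<And>q. q \<in> \<rat> \<Longrightarrow> 0 \<le> q \<Longrightarrow> q < T \<Longrightarrow> F q = 0" "0 \<le> t" "t < T"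
  shows "F t = 0"
proof -
  define q where "q n = of_int \<lfloor>real (Suc n) * t\<rfloor> / real (Suc n)" for n
  have lim: "q \<longlonglongrightarrow> t" unfolding q_def by (rule floor_approx)
  have q: "0 \<le> q n" "q n \<le> t" "q n \<in> \<rat>" for n
    unfolding q_def using floor_approx_bounds[OF assms(3), of n] by (auto intro!: Rats_divide simp del: of_nat_Suc)
  have "(\<lambda>n. F (q n)) \<longlonglongrightarrow> F t"
    using assms(3,4) q order_le_less_trans[OF q(2) assms(4)]
    by (intro continuous_on_tendsto_compose[OF assms(1) lim]) auto
  moreover have "F (q n) = 0" for n
    using q[of n] assms(4) by (intro assms(2)) auto
  ultimately show ?thesis by (simp add: LIMSEQ_const_iff)
qed

lemma continuous_zero_of_integral_zero:
  fixes f :: "real \<Rightarrow> real"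
  assumes f: "continuous_on {0..<T} f" and zero: "\<And>u. 0 \<le> u \<Longrightarrow> u < T \<Longrightarrow> (LINT s:{0..u}|lborel. f s) = 0" and t: "0 \<le> t" "t < T"
  shows "f t = 0"
proof -
  \<comment> \<open>A point strictly between \<open>t\<close> and \<open>T\<close> gives a closed
    interval on which the integral can be differentiated at \<open>t\<close>, one-sidedly if
    \<open>t = 0\<close>.\<close>
  define v where "v = (t + T) / 2"
  have v: "t < v" "v < T" using t by (auto simp: v_def)
  have c: "continuous_on {0..u} f" if "u < T" for u using that by (intro continuous_on_subset[OF f]) auto
  have eq: "integral {0..u} f = 0" if "u \<in> {0..v}" for u
    using zero[of u] LINT_continuous[OF c, of u] that v by auto
  have "((\<lambda>u. integral {0..u} f) has_vector_derivative f t) (at t within {0..v})"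
    using t v by (intro integral_has_vector_derivative c) auto
  then have "((\<lambda>u. 0) has_vector_derivative f t) (at t within {0..v})"
    by (rule has_vector_derivative_transform[rotated 2]) (use eq t v in auto)
  moreover have "((\<lambda>u. 0) has_vector_derivative 0) (at t within {0..v})"
    by (rule has_vector_derivative_const)
  ultimately show ?thesis
    using t v by (intro vector_derivative_unique_within) (auto simp: trivial_limit_within islimpt_Icc)
qed

section \<open>Discretisation errors of It\^o integrals\<close>

context wiener_process
begin

text \<open>Stated with left sums instead of \<open>has_ito_integral\<close>, so that the values at
  different grid times can be approximated along one common finer grid.\<close>

definition ito_integral_process :: "real \<Rightarrow> (real \<Rightarrow> 'a \<Rightarrow> real) \<Rightarrow> (real \<Rightarrow> 'a \<Rightarrow> real) \<Rightarrow> bool" where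
  "ito_integral_process T b Y \<longleftrightarrow>
     continuous_adapted T b \<and> continuous_adapted T Y \<and> (\<forall>\<omega>\<in>space P. Y 0 \<omega> = 0) \<and>
     (\<forall>u. 0 \<le> u \<longrightarrow> u < T \<longrightarrow> null_in_prob P (\<lambda>n \<omega>. left_sum b u n \<omega> - Y u \<omega>))"

text \<open>Formally the stochastic integral over one cell of \<open>b\<close> minus its value at
  the left end point.\<close>

definition ito_error :: "(real \<Rightarrow> 'a \<Rightarrow> real) \<Rightarrow> (real \<Rightarrow> 'a \<Rightarrow> real) \<Rightarrow> real \<Rightarrow> nat \<Rightarrow> nat \<Rightarrow> 'a \<Rightarrow> real" where
  "ito_error b Y u n i \<omega> = Y (grid u n (Suc i)) \<omega> - Y (grid u n i) \<omega>
     - b (grid u n i) \<omega> * (incr W u n i \<omega>)"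

text \<open>Along a finer grid with \<open>m\<close> subdivisions of each cell the increments of \<open>Y\<close> become Riemann
  sums, and the weighted error becomes the elementary integral of \<open>H (b - b\<^sub>i)\<close>, which is small
  uniformly in \<open>m\<close>.\<close>

lemma ito_error_transform_null:
  assumes Y: "ito_integral_process T b Y" and u: "0 \<le> u" "u < T"
    and H: "\<And>n i. i < n \<Longrightarrow> H n i \<in> borel_measurable (F (grid u n i))"
    and bd: "\<And>\<eta>. \<eta> > 0 \<Longrightarrow> \<exists>C. eventually (\<lambda>n. mostly P \<eta> (\<lambda>\<omega>. \<forall>i<n. \<bar>H n i \<omega>\<bar> \<le> C)) sequentially"
  shows "null_in_prob P (\<lambda>n \<omega>. \<Sum>i<n. H n i \<omega> * ito_error b Y u n i \<omega>)"
  unfolding null_in_prob_def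
proof (intro allI impI)
  fix \<epsilon> \<eta> :: real assume pos: "\<epsilon> > 0" "\<eta> > 0"
  have b: "continuous_adapted T b" and Y0: "\<And>\<omega>. \<omega> \<in> space P \<Longrightarrow> Y 0 \<omega> = 0"
    and Ylim: "\<And>v. 0 \<le> v \<Longrightarrow> v < T \<Longrightarrow> null_in_prob P (\<lambda>n \<omega>. left_sum b v n \<omega> - Y v \<omega>)"
    using Y unfolding ito_integral_process_def by auto
  obtain C0 where C0: "eventually (\<lambda>n. mostly P (\<eta> / 8) (\<lambda>\<omega>. \<forall>i<n. \<bar>H n i \<omega>\<bar> \<le> C0)) sequentially"
    using bd[of "\<eta> / 8"] pos by auto
  define C where "C = \<bar>C0\<bar> + 1"
  have C: "C > 0" "C0 \<le> C" by (auto simp: C_def)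
  define \<delta> where "\<delta> = (\<epsilon> / 2)\<^sup>2 * (\<eta> / 8)"
  have \<delta>: "\<delta> > 0" "\<delta> / (\<epsilon> / 2)\<^sup>2 = \<eta> / 8" using pos by (auto simp: \<delta>_def)
  define e where "e = sqrt (\<delta> / (u + 1)) / C"
  have e: "e > 0" "(C * e)\<^sup>2 * u \<le> \<delta>"
  proof -
    show "e > 0" using \<delta>(1) u C by (simp add: e_def)
    have "C * e = sqrt (\<delta> / (u + 1))" using C by (simp add: e_def)
    then have "(C * e)\<^sup>2 = \<delta> / (u + 1)" using \<delta>(1) u by simp
    then have "(C * e)\<^sup>2 * (u + 1) = \<delta>" using u by simp
    moreover have "(C * e)\<^sup>2 * u \<le> (C * e)\<^sup>2 * (u + 1)" by (rule mult_left_mono) auto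
    ultimately show "(C * e)\<^sup>2 * u \<le> \<delta>" by linarith
  qed
  obtain d where d: "d > 0"
    "mostly P (\<eta> / 8) (\<lambda>\<omega>. \<forall>s\<in>{0..u}. \<forall>s'\<in>{0..u}. \<bar>s - s'\<bar> \<le> d \<longrightarrow> \<bar>b s \<omega> - b s' \<omega>\<bar> \<le> e)"
    using mostly_uniformly_continuous[OF b u, of e "\<eta> / 8"] e(1) pos by auto
  have "eventually (\<lambda>n. u / d \<le> real n) sequentially"
    using filterlim_real_sequentially unfolding filterlim_at_top by auto
  with C0 eventually_gt_at_top[of 0]
  show "eventually (\<lambda>n. mostly P \<eta> (\<lambda>\<omega>. \<bar>\<Sum>i<n. H n i \<omega> * ito_error b Y u n i \<omega>\<bar> \<le> \<epsilon>)) sequentially"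
  proof eventually_elim
    case (elim n)
    have n: "0 < n" "u / n \<le> d" using elim(2,3) d(1) by (auto simp: field_simps)
    have Hn: "mostly P (\<eta> / 8) (\<lambda>\<omega>. \<forall>i<n. \<bar>H n i \<omega>\<bar> \<le> C)"
      by (rule mostly_mono[OF elim(1) order_refl]) (auto intro: order_trans[OF _ C(2)])
    \<comment> \<open>Replacing \<open>Y\<close> by Riemann sums changes each of the
      \<open>n\<close> increments by at most \<open>2 * \<kappa>\<close>, with weight at most
      \<open>C\<close>: in total \<open>\<epsilon> / 2\<close>.\<close>
    define \<kappa> where "\<kappa> = \<epsilon> / (4 * n * C)"
    have \<kappa>: "\<kappa> > 0" "2 * n * C * \<kappa> = \<epsilon> / 2" using pos C n by (auto simp: \<kappa>_def)
    let ?\<eta> = "\<eta> / (8 * real (Suc n))"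
    \<comment> \<open>With \<open>j * m\<close> cells the interval up to the coarse point number
      \<open>j\<close> has mesh \<open>u / (n * m)\<close> for every \<open>j\<close>, so all these
      sums live on one fine grid. Here \<open>n\<close> is fixed, and \<open>m\<close> may depend on
      it.\<close>
    have "eventually (\<lambda>m. \<forall>j\<in>{..n}. mostly P ?\<eta>
        (\<lambda>\<omega>. \<bar>left_sum b (grid u n j) (j * m) \<omega> - Y (grid u n j) \<omega>\<bar> \<le> \<kappa>)) sequentially"
    proof (rule eventually_ball_finite)
      show "\<forall>j\<in>{..n}. eventually (\<lambda>m. mostly P ?\<eta>
        (\<lambda>\<omega>. \<bar>left_sum b (grid u n j) (j * m) \<omega> - Y (grid u n j) \<omega>\<bar> \<le> \<kappa>)) sequentially"
      proof
        fix j assume j: "j \<in> {..n}"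
        show "eventually (\<lambda>m. mostly P ?\<eta>
          (\<lambda>\<omega>. \<bar>left_sum b (grid u n j) (j * m) \<omega> - Y (grid u n j) \<omega>\<bar> \<le> \<kappa>)) sequentially"
        \<comment> \<open>For \<open>j = 0\<close> the number of cells does not grow with
          \<open>m\<close>, but both the sum and \<open>Y 0\<close> are zero.\<close>
        proof (cases "j = 0")
          case True
          have "mostly P ?\<eta> (\<lambda>\<omega>. \<bar>left_sum b (grid u n j) (j * m) \<omega> - Y (grid u n j) \<omega>\<bar> \<le> \<kappa>)" for m
            using pos \<kappa>(1) Y0 by (intro mostly_true) (auto simp: True left_sum_def)
          then show ?thesis by simp
        next
          case False
          have "grid u n j \<in> {0..u}" using grid_in[OF u(1), of j n] j by simp
          then have "null_in_prob P (\<lambda>k \<omega>. left_sum b (grid u n j) k \<omega> - Y (grid u n j) \<omega>)"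
            using u(2) by (intro Ylim) auto
          then have "eventually (\<lambda>k. mostly P ?\<eta> (\<lambda>\<omega>. \<bar>left_sum b (grid u n j) k \<omega> - Y (grid u n j) \<omega>\<bar> \<le> \<kappa>)) sequentially"
            using pos \<kappa>(1) unfolding null_in_prob_def by simp
          moreover have "filterlim (\<lambda>m. j * m) sequentially sequentially"
            using False by (intro filterlim_subseq strict_monoI) simp
          ultimately show ?thesis by (rule eventually_compose_filterlim)
        qed
      qed
    qed simp
    then have "eventually (\<lambda>m. 0 < m \<and> (\<forall>j\<in>{..n}. mostly P ?\<eta>
        (\<lambda>\<omega>. \<bar>left_sum b (grid u n j) (j * m) \<omega> - Y (grid u n j) \<omega>\<bar> \<le> \<kappa>))) sequentially"
      by (intro eventually_conj eventually_gt_at_top)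
    from eventually_happens'[OF sequentially_bot this] obtain m where m: "0 < m"
      "\<And>j. j \<in> {..n} \<Longrightarrow> mostly P ?\<eta> (\<lambda>\<omega>. \<bar>left_sum b (grid u n j) (j * m) \<omega> - Y (grid u n j) \<omega>\<bar> \<le> \<kappa>)"
      by auto
    have "mostly P (card {..n} * ?\<eta>) (\<lambda>\<omega>. \<forall>j\<in>{..n}. \<bar>left_sum b (grid u n j) (j * m) \<omega> - Y (grid u n j) \<omega>\<bar> \<le> \<kappa>)"
      by (rule mostly_ball) (use m(2) in auto)
    then have approx: "mostly P (\<eta> / 8) (\<lambda>\<omega>. \<forall>j\<in>{..n}. \<bar>left_sum b (grid u n j) (j * m) \<omega> - Y (grid u n j) \<omega>\<bar> \<le> \<kappa>)"
      by (rule mostly_mono) (simp_all del: of_nat_Suc)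
    define p where "p l = grid u (n * m) l" for l
    \<comment> \<open>The left end point of the coarse cell that contains the fine point
      \<open>p l\<close>.\<close>
    define q where "q l = u * real (l div m) / real n" for l
    define S where "S l \<omega> = H n (l div m) \<omega> * (b (p l) \<omega> - b (q l) \<omega>)" for l \<omega>
    have div_less: "l div m < n" if "l < n * m" for l using that m(1) by (simp add: less_mult_imp_div_less)
    have p_in: "p l \<in> {0..u}" if "l \<le> n * m" for l unfolding p_def by (rule grid_in[OF u(1) that])
    have q_in: "q l \<in> {0..u}" if "l < n * m" for l
      unfolding q_def by (rule grid_in[OF u(1)]) (use div_less[OF that] in simp)
    have q_eq: "q l = u * real (l div m * m) / real (n * m)" for l
      using m(1) by (simp add: q_def)
    have qp: "q l \<le> p l" "p l - q l \<le> u / n" for l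
    proof -
      show "q l \<le> p l" unfolding q_eq p_def by (rule grid_mono[OF u(1)]) (simp add: div_times_less_eq_dividend)
      have "p l - q l = u * (real l - real (l div m * m)) / real (n * m)"
        unfolding q_eq p_def by (simp add: diff_divide_distrib right_diff_distrib)
      also have "real l - real (l div m * m) = real (l mod m)"
        by (metis add_diff_cancel_left' div_mult_mod_eq of_nat_add)
      also have "u * real (l mod m) / real (n * m) \<le> grid u (n * m) m"
        using u(1) m(1) by (intro divide_right_mono mult_left_mono) (auto simp: less_imp_le)
      also have "\<dots> = u / n" using m(1) by simp
      finally show "p l - q l \<le> u / n" .
    qed
    have Smeas: "S l \<in> borel_measurable (F (p l))" if l: "l < n * m" for l
      unfolding S_def
    proof (intro borel_measurable_times borel_measurable_diff)
      show "H n (l div m) \<in> borel_measurable (F (p l))"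
        by (rule measurable_F_mono[OF H[OF div_less[OF l]]]) (use qp(1)[of l] in \<open>simp add: q_def\<close>)
      show "b (p l) \<in> borel_measurable (F (p l))"
        using p_in[of l] l u by (intro continuous_adaptedD(1)[OF b]) auto
      show "b (q l) \<in> borel_measurable (F (p l))"
        using q_in[OF l] u by (intro measurable_F_mono[OF continuous_adaptedD(1)[OF b] qp(1)]) auto
    qed
    have psuc: "p (Suc l) - p l = u / real (n * m)" for l
      by (simp add: p_def grid_step del: of_nat_mult of_nat_Suc)
    have "mostly P (\<eta> / 8 + \<eta> / 8) (\<lambda>\<omega>. (\<Sum>l<n * m. (S l \<omega>)\<^sup>2 * (p (Suc l) - p l)) \<le> \<delta>)"
    proof (rule mostly_conj_mono[OF Hn d(2) order_refl])
      fix \<omega> assume 1: "\<forall>i<n. \<bar>H n i \<omega>\<bar> \<le> C"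
        and 2: "\<forall>s\<in>{0..u}. \<forall>s'\<in>{0..u}. \<bar>s - s'\<bar> \<le> d \<longrightarrow> \<bar>b s \<omega> - b s' \<omega>\<bar> \<le> e"
      have "(\<Sum>l<n * m. (S l \<omega>)\<^sup>2 * (p (Suc l) - p l)) \<le> (\<Sum>l<n * m. (C * e)\<^sup>2 * (u / real (n * m)))"
        unfolding psuc
      proof (intro sum_mono mult_right_mono)
        fix l assume "l \<in> {..<n * m}"
        then have l: "l < n * m" by simp
        have "\<bar>p l - q l\<bar> \<le> d" using qp[of l] n(2) by simp
        then have "\<bar>b (p l) \<omega> - b (q l) \<omega>\<bar> \<le> e" using 2 p_in[of l] q_in[OF l] l by simp
        then have "\<bar>S l \<omega>\<bar> \<le> C * e"
          unfolding S_def abs_mult using 1 div_less[OF l] C(1) by (intro mult_mono) auto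
        then have "\<bar>S l \<omega>\<bar>\<^sup>2 \<le> (C * e)\<^sup>2" by (rule power_mono) simp
        then show "(S l \<omega>)\<^sup>2 \<le> (C * e)\<^sup>2" by simp
      qed (use u(1) in simp)
      also have "\<dots> = (C * e)\<^sup>2 * u" using n(1) m(1) by simp
      also have "\<dots> \<le> \<delta>" by (rule e(2))
      finally show "(\<Sum>l<n * m. (S l \<omega>)\<^sup>2 * (p (Suc l) - p l)) \<le> \<delta>" .
    qed
    then have "mostly P (\<eta> / 8 + \<eta> / 8 + \<delta> / (\<epsilon> / 2)\<^sup>2) (\<lambda>\<omega>. \<bar>\<Sum>l<n * m. S l \<omega> * (W (p (Suc l)) \<omega> - W (p l) \<omega>)\<bar> \<le> \<epsilon> / 2)"
    proof (rule wiener_sum_mostly[rotated 3])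
      show "0 \<le> p 0" by (simp add: p_def)
      show "p l \<le> p (Suc l)" for l unfolding p_def by (rule grid_mono[OF u(1)]) simp
    qed (use Smeas \<delta>(1) pos in auto)
    then have SW: "mostly P (\<eta> / 8 + \<eta> / 8 + \<eta> / 8) (\<lambda>\<omega>. \<bar>\<Sum>l<n * m. S l \<omega> * (W (p (Suc l)) \<omega> - W (p l) \<omega>)\<bar> \<le> \<epsilon> / 2)"
      unfolding \<delta>(2) .
    have ls: "left_sum b (grid u n j) (j * m) \<omega> = (\<Sum>l<j * m. b (p l) \<omega> * (W (p (Suc l)) \<omega> - W (p l) \<omega>))" for j \<omega>
    proof (cases "j = 0")
      case False
      have eq: "grid u n j * real l / real (j * m) = p l" for l
        using False n(1) m(1) by (simp add: p_def)
      show ?thesis unfolding left_sum_def eq ..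
    qed (simp add: left_sum_def)
    \<comment> \<open>Group the fine sum by coarse cells. On each group \<open>H\<close> and the
      value of \<open>b\<close> at \<open>q l\<close> are constant, so the increments of
      \<open>W\<close> telescope and a difference of two left sums remains.\<close>
    have split: "(\<Sum>l<n * m. S l \<omega> * (W (p (Suc l)) \<omega> - W (p l) \<omega>))
      = (\<Sum>i<n. H n i \<omega> * (left_sum b (grid u n (Suc i)) (Suc i * m) \<omega> - left_sum b (grid u n i) (i * m) \<omega>
            - b (grid u n i) \<omega> * (incr W u n i \<omega>)))" for \<omega>
    proof -
      have "(\<Sum>l<n * m. S l \<omega> * (W (p (Suc l)) \<omega> - W (p l) \<omega>))
        = (\<Sum>i<n. \<Sum>l\<in>{i * m..<i * m + m}. S l \<omega> * (W (p (Suc l)) \<omega> - W (p l) \<omega>))"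
        by (rule sum.nat_group[symmetric])
      also have "\<dots> = (\<Sum>i<n. H n i \<omega> * (left_sum b (grid u n (Suc i)) (Suc i * m) \<omega> - left_sum b (grid u n i) (i * m) \<omega>
            - b (grid u n i) \<omega> * (incr W u n i \<omega>)))"
      proof (rule sum.cong[OF refl])
        fix i assume "i \<in> {..<n}"
        let ?B = "{i * m..<i * m + m}"
        have div: "l div m = i" if "l \<in> ?B" for l
          using that by (intro div_nat_eqI) (auto simp: mult.commute)
        have "(\<Sum>l\<in>?B. S l \<omega> * (W (p (Suc l)) \<omega> - W (p l) \<omega>))
          = (\<Sum>l\<in>?B. H n i \<omega> * (b (p l) \<omega> * (W (p (Suc l)) \<omega> - W (p l) \<omega>) - b (grid u n i) \<omega> * (W (p (Suc l)) \<omega> - W (p l) \<omega>)))"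
          by (rule sum.cong[OF refl]) (simp add: S_def q_def div algebra_simps)
        also have "\<dots> = H n i \<omega> * ((\<Sum>l\<in>?B. b (p l) \<omega> * (W (p (Suc l)) \<omega> - W (p l) \<omega>))
            - b (grid u n i) \<omega> * (\<Sum>l\<in>?B. W (p (Suc l)) \<omega> - W (p l) \<omega>))"
          by (simp add: sum_distrib_left[symmetric] sum_subtractf)
        also have "(\<Sum>l\<in>?B. W (p (Suc l)) \<omega> - W (p l) \<omega>) = W (grid u n (Suc i)) \<omega> - W (grid u n i) \<omega>"
        proof -
          have "(\<Sum>l\<in>?B. W (p (Suc l)) \<omega> - W (p l) \<omega>) = W (p (i * m + m)) \<omega> - W (p (i * m)) \<omega>"
            by (rule sum_Suc_diff') simp
          moreover have "p (i * m + m) = grid u n (Suc i)" "p (i * m) = grid u n i"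
          proof -
            have "p (i * m + m) = u * real (Suc i * m) / real (n * m)" by (simp add: p_def add.commute)
            then show "p (i * m + m) = grid u n (Suc i)" using m(1) by (simp del: of_nat_Suc mult_Suc)
            show "p (i * m) = grid u n i" using m(1) by (simp add: p_def)
          qed
          ultimately show ?thesis by simp
        qed
        also have "(\<Sum>l\<in>?B. b (p l) \<omega> * (W (p (Suc l)) \<omega> - W (p l) \<omega>))
          = left_sum b (grid u n (Suc i)) (Suc i * m) \<omega> - left_sum b (grid u n i) (i * m) \<omega>"
        proof -
          have "{..<Suc i * m} = {..<i * m} \<union> ?B" "{..<i * m} \<inter> ?B = {}" by auto
          then show ?thesis unfolding ls by (simp add: sum.union_disjoint)
        qed
        finally show "(\<Sum>l\<in>?B. S l \<omega> * (W (p (Suc l)) \<omega> - W (p l) \<omega>))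
          = H n i \<omega> * (left_sum b (grid u n (Suc i)) (Suc i * m) \<omega> - left_sum b (grid u n i) (i * m) \<omega>
            - b (grid u n i) \<omega> * (incr W u n i \<omega>))" .
      qed
      finally show ?thesis .
    qed
    have HA: "mostly P (\<eta> / 8 + \<eta> / 8) (\<lambda>\<omega>. (\<forall>i<n. \<bar>H n i \<omega>\<bar> \<le> C) \<and>
        (\<forall>j\<in>{..n}. \<bar>left_sum b (grid u n j) (j * m) \<omega> - Y (grid u n j) \<omega>\<bar> \<le> \<kappa>))"
      by (rule mostly_conj[OF Hn approx])
    show ?case
    proof (rule mostly_conj_mono[OF SW HA])
      show "\<eta> / 8 + \<eta> / 8 + \<eta> / 8 + (\<eta> / 8 + \<eta> / 8) \<le> \<eta>" using pos by simp
      fix \<omega> assume 1: "\<bar>\<Sum>l<n * m. S l \<omega> * (W (p (Suc l)) \<omega> - W (p l) \<omega>)\<bar> \<le> \<epsilon> / 2"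
        and "(\<forall>i<n. \<bar>H n i \<omega>\<bar> \<le> C) \<and>
        (\<forall>j\<in>{..n}. \<bar>left_sum b (grid u n j) (j * m) \<omega> - Y (grid u n j) \<omega>\<bar> \<le> \<kappa>)"
      then have 2: "\<And>i. i < n \<Longrightarrow> \<bar>H n i \<omega>\<bar> \<le> C"
        and 3: "\<And>j. j \<le> n \<Longrightarrow> \<bar>left_sum b (grid u n j) (j * m) \<omega> - Y (grid u n j) \<omega>\<bar> \<le> \<kappa>" by auto
      let ?D = "\<lambda>j. left_sum b (grid u n j) (j * m) \<omega> - Y (grid u n j) \<omega>"
      have "(\<Sum>l<n * m. S l \<omega> * (W (p (Suc l)) \<omega> - W (p l) \<omega>)) - (\<Sum>i<n. H n i \<omega> * ito_error b Y u n i \<omega>)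
        = (\<Sum>i<n. H n i \<omega> * (?D (Suc i) - ?D i))"
        unfolding split ito_error_def sum_subtractf[symmetric] right_diff_distrib[symmetric]
        by (intro sum.cong arg_cong2[where f="(*)"] refl) (simp del: of_nat_Suc mult_Suc)
      moreover have "\<bar>\<Sum>i<n. H n i \<omega> * (?D (Suc i) - ?D i)\<bar> \<le> (\<Sum>i<n. C * (2 * \<kappa>))"
      proof (rule order_trans[OF sum_abs sum_mono])
        fix i assume "i \<in> {..<n}"
        then have i: "i < n" by simp
        have "\<bar>?D (Suc i) - ?D i\<bar> \<le> 2 * \<kappa>" using 3[of i] 3[of "Suc i"] i by linarith
        then show "\<bar>H n i \<omega> * (?D (Suc i) - ?D i)\<bar> \<le> C * (2 * \<kappa>)"
          unfolding abs_mult using 2[OF i] C(1) by (intro mult_mono) auto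
      qed
      moreover have "(\<Sum>i<n. C * (2 * \<kappa>)) = \<epsilon> / 2" using \<kappa>(2) by (simp add: mult.assoc mult.left_commute)
      ultimately show "\<bar>\<Sum>i<n. H n i \<omega> * ito_error b Y u n i \<omega>\<bar> \<le> \<epsilon>" using 1 by linarith
    qed
  qed
qed

lemma sum_ito_error:
  "(\<Sum>i<j. ito_error b Y u n i \<omega>) = Y (grid u n j) \<omega> - Y 0 \<omega>
     - (\<Sum>i<j. b (grid u n i) \<omega> * (incr W u n i \<omega>))"
proof -
  have "(\<Sum>i<j. ito_error b Y u n i \<omega>) = (\<Sum>i<j. Y (grid u n (Suc i)) \<omega> - Y (grid u n i) \<omega>)
     - (\<Sum>i<j. b (grid u n i) \<omega> * (incr W u n i \<omega>))"
    unfolding ito_error_def by (simp only: sum_subtractf)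
  moreover have "(\<Sum>i<j. Y (grid u n (Suc i)) \<omega> - Y (grid u n i) \<omega>) = Y (grid u n j) \<omega> - Y 0 \<omega>"
    by (subst sum_lessThan_telescope[of "\<lambda>i. Y (grid u n i) \<omega>"]) simp
  ultimately show ?thesis by simp
qed

lemma ito_error_measurable:
  assumes Y: "ito_integral_process T b Y" and u: "0 \<le> u" "u < T" and i: "i < n"
  shows "ito_error b Y u n i \<in> borel_measurable (F (grid u n (Suc i)))"
proof -
  note g = grid_Icc[OF u(1) i]
  have b: "continuous_adapted T b" and Yc: "continuous_adapted T Y"
    using Y unfolding ito_integral_process_def by auto
  show ?thesis
    unfolding ito_error_def
    by (intro borel_measurable_diff borel_measurable_times W_measurable_F order_refl
        continuous_adaptedD(1)[OF Yc] measurable_F_mono[OF continuous_adaptedD(1)[OF Yc]]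
        measurable_F_mono[OF continuous_adaptedD(1)[OF b]]) (use g u in linarith)+
qed

text \<open>A discrete maximal inequality: the partial sums of the errors are stopped once they exceed 1.\<close>

lemma sum_ito_error_mostly_bounded:
  assumes Y: "ito_integral_process T b Y" and u: "0 \<le> u" "u < T" and "\<eta> > 0"
  shows "eventually (\<lambda>n. mostly P \<eta> (\<lambda>\<omega>. \<forall>j\<le>n. \<bar>\<Sum>i<j. ito_error b Y u n i \<omega>\<bar> \<le> 1)) sequentially"
proof -
  define V where "V n j \<omega> = (\<Sum>i<j. ito_error b Y u n i \<omega>)" for n j \<omega>
  have V: "V n j \<in> borel_measurable (F (grid u n j))" if "j \<le> n" for n j
    unfolding V_def
  proof (rule borel_measurable_sum)
    fix i assume "i \<in> {..<j}"
    then show "ito_error b Y u n i \<in> borel_measurable (F (grid u n j))"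
      using that by (intro measurable_F_mono[OF ito_error_measurable[OF Y u]] grid_mono[OF u(1)]) auto
  qed
  \<comment> \<open>The product is 1 until some partial sum leaves the interval from -1 to 1, and 0
    afterwards. It looks only at sums up to index \<open>i\<close>, so it is an admissible weight
    for the error at \<open>i\<close>.\<close>
  define H where "H n i \<omega> = (\<Prod>j\<le>i. indicat_real {-1..1} (V n j \<omega>))" for n i \<omega>
  have H: "H n i \<omega> = (if \<forall>j\<le>i. \<bar>V n j \<omega>\<bar> \<le> 1 then 1 else 0)" for n i \<omega>
  proof (cases "\<forall>j\<le>i. \<bar>V n j \<omega>\<bar> \<le> 1")
    case True
    then have "H n i \<omega> = (\<Prod>j\<le>i. 1)"
      unfolding H_def by (intro prod.cong) (auto simp: indicator_def abs_le_iff)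
    then show ?thesis using True by simp
  next
    case False
    then obtain j where "j \<le> i" "\<not> \<bar>V n j \<omega>\<bar> \<le> 1" by auto
    then have "H n i \<omega> = 0"
      unfolding H_def by (intro prod_zero) (auto simp: indicator_def abs_le_iff intro!: bexI[of _ j])
    then show ?thesis using False by simp
  qed
  have "null_in_prob P (\<lambda>n \<omega>. \<Sum>i<n. H n i \<omega> * ito_error b Y u n i \<omega>)"
  proof (rule ito_error_transform_null[OF Y u])
    fix n i :: nat assume i: "i < n"
    show "H n i \<in> borel_measurable (F (grid u n i))"
      unfolding H_def
    proof (rule borel_measurable_prod)
      fix j assume "j \<in> {..i}"
      then have "V n j \<in> borel_measurable (F (grid u n i))"
        using i by (intro measurable_F_mono[OF V] grid_mono[OF u(1)]) auto
      then show "(\<lambda>\<omega>. indicat_real {-1..1} (V n j \<omega>)) \<in> borel_measurable (F (grid u n i))"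
        by (rule measurable_compose) simp
    qed
  next
    fix \<eta> :: real assume "\<eta> > 0"
    then have "mostly P \<eta> (\<lambda>\<omega>. \<forall>i<n. \<bar>H n i \<omega>\<bar> \<le> 1)" for n
      by (intro mostly_true) (auto simp: H)
    then show "\<exists>C. eventually (\<lambda>n. mostly P \<eta> (\<lambda>\<omega>. \<forall>i<n. \<bar>H n i \<omega>\<bar> \<le> C)) sequentially"
      by (intro exI[of _ 1]) simp
  qed
  then have "eventually (\<lambda>n. mostly P \<eta> (\<lambda>\<omega>. \<bar>\<Sum>i<n. H n i \<omega> * ito_error b Y u n i \<omega>\<bar> \<le> 1)) sequentially"
    using \<open>\<eta> > 0\<close> unfolding null_in_prob_def by simp
  then show ?thesis
  proof eventually_elim
    case (elim n)
    then show ?case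
    proof (rule mostly_mono[OF _ order_refl])
      fix \<omega> assume *: "\<bar>\<Sum>i<n. H n i \<omega> * ito_error b Y u n i \<omega>\<bar> \<le> 1"
      have "\<forall>j\<le>n. \<bar>V n j \<omega>\<bar> \<le> 1"
      proof (rule ccontr)
        assume "\<not> (\<forall>j\<le>n. \<bar>V n j \<omega>\<bar> \<le> 1)"
        then have ex: "\<exists>j. j \<le> n \<and> \<not> \<bar>V n j \<omega>\<bar> \<le> 1" by auto
        \<comment> \<open>At the first violating index \<open>j\<close> the stopped transform equals
          \<open>V n j\<close>, which exceeds 1 in modulus and contradicts its smallness.\<close>
        define j where "j = (LEAST j. j \<le> n \<and> \<not> \<bar>V n j \<omega>\<bar> \<le> 1)"
        have j: "j \<le> n" "\<not> \<bar>V n j \<omega>\<bar> \<le> 1" using LeastI_ex[OF ex] unfolding j_def by auto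
        have less: "\<bar>V n i \<omega>\<bar> \<le> 1" if "i < j" for i
          using not_less_Least[of i "\<lambda>j. j \<le> n \<and> \<not> \<bar>V n j \<omega>\<bar> \<le> 1"] that j(1) unfolding j_def by auto
        have Hi: "H n i \<omega> = (if i < j then 1 else 0)" for i
          using less j(2) by (auto simp: H not_less)
        have "(\<Sum>i<n. H n i \<omega> * ito_error b Y u n i \<omega>) = (\<Sum>i<n. if i \<in> {..<j} then ito_error b Y u n i \<omega> else 0)"
          by (rule sum.cong) (auto simp: Hi)
        also have "\<dots> = (\<Sum>i\<in>{..<n} \<inter> {..<j}. ito_error b Y u n i \<omega>)"
          by (rule sum.inter_restrict[symmetric]) simp
        also have "{..<n} \<inter> {..<j} = {..<j}" using j(1) by auto
        finally show False using * j(2) by (simp add: V_def)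
      qed
      then show "\<forall>j\<le>n. \<bar>\<Sum>i<j. ito_error b Y u n i \<omega>\<bar> \<le> 1" unfolding V_def .
    qed
  qed
qed

text \<open>Discrete integration by parts.\<close>

lemma sum_square_increments:
  fixes v :: "nat \<Rightarrow> real"
  shows "(\<Sum>i<n. (v (Suc i) - v i)\<^sup>2) = (v n)\<^sup>2 - (v 0)\<^sup>2 - 2 * (\<Sum>i<n. v i * (v (Suc i) - v i))"
  by (induction n) (simp_all add: power2_eq_square algebra_simps)

text \<open>By \<open>sum_square_increments\<close> the square sum is the square of the total error
  minus a transform of the errors by twice their own partial sums. The total error vanishes in
  probability by definition of \<open>Y\<close>, and the maximal inequality bounds the weights of
  the transform.\<close>

lemma sum_ito_error_squares_null:
  assumes Y: "ito_integral_process T b Y" and u: "0 \<le> u" "u < T"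
  shows "null_in_prob P (\<lambda>n \<omega>. \<Sum>i<n. (ito_error b Y u n i \<omega>)\<^sup>2)"
proof -
  define V where "V n j \<omega> = (\<Sum>i<j. ito_error b Y u n i \<omega>)" for n j \<omega>
  have V: "V n (Suc i) \<omega> - V n i \<omega> = ito_error b Y u n i \<omega>" "V n 0 \<omega> = 0" for n i \<omega>
    by (simp_all add: V_def)
  have eq: "(\<Sum>i<n. (ito_error b Y u n i \<omega>)\<^sup>2) = V n n \<omega> * V n n \<omega> - (\<Sum>i<n. 2 * V n i \<omega> * ito_error b Y u n i \<omega>)" for n \<omega>
    using sum_square_increments[of "\<lambda>j. V n j \<omega>" n]
    by (simp add: V power2_eq_square sum_distrib_left mult.assoc)
  have "null_in_prob P (\<lambda>n. V n n)"
  proof -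
    have "null_in_prob P (\<lambda>n \<omega>. left_sum b u n \<omega> - Y u \<omega>)"
      using Y u unfolding ito_integral_process_def by auto
    from null_in_prob_minus[OF this] show ?thesis
    proof (rule null_in_prob_eventually_cong)
      show "eventually (\<lambda>n. \<forall>\<omega>\<in>space P. V n n \<omega> = - (left_sum b u n \<omega> - Y u \<omega>)) sequentially"
        using eventually_gt_at_top[of 0]
      proof eventually_elim
        case (elim n)
        then show ?case
          using Y unfolding V_def sum_ito_error ito_integral_process_def by (auto simp: left_sum_def)
      qed
    qed
  qed
  then have 1: "null_in_prob P (\<lambda>n \<omega>. V n n \<omega> * V n n \<omega>)"
    by (intro null_in_prob_mult_bounded null_in_prob_bounded)
  have "null_in_prob P (\<lambda>n \<omega>. \<Sum>i<n. 2 * V n i \<omega> * ito_error b Y u n i \<omega>)"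
  proof (rule ito_error_transform_null[OF Y u])
    fix n i :: nat assume "i < n"
    then show "(\<lambda>\<omega>. 2 * V n i \<omega>) \<in> borel_measurable (F (grid u n i))"
      unfolding V_def
      by (intro borel_measurable_times borel_measurable_const borel_measurable_sum
          measurable_F_mono[OF ito_error_measurable[OF Y u]] grid_mono[OF u(1)]) auto
  next
    fix \<eta> :: real assume "\<eta> > 0"
    show "\<exists>C. eventually (\<lambda>n. mostly P \<eta> (\<lambda>\<omega>. \<forall>i<n. \<bar>2 * V n i \<omega>\<bar> \<le> C)) sequentially"
    proof
      show "eventually (\<lambda>n. mostly P \<eta> (\<lambda>\<omega>. \<forall>i<n. \<bar>2 * V n i \<omega>\<bar> \<le> 2)) sequentially"
        using sum_ito_error_mostly_bounded[OF Y u \<open>\<eta> > 0\<close>]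
      proof eventually_elim
        case (elim n)
        then show ?case by (rule mostly_mono) (auto simp: V_def abs_mult)
      qed
    qed
  qed
  from null_in_prob_diff[OF 1 this] show ?thesis unfolding eq .
qed

end

lemma continuous_on_atLeastLessThan:
  fixes f :: "real \<Rightarrow> 'b::topological_space"
  assumes "\<And>u. 0 \<le> u \<Longrightarrow> u < T \<Longrightarrow> continuous_on {0..u} f"
  shows "continuous_on {0..<T} f"
  unfolding continuous_on_eq_continuous_within
proof
  fix t assume t: "t \<in> {0..<T}"
  define v where "v = (t + T) / 2"
  have v: "t < v" "v < T" "0 \<le> v" using t by (auto simp: v_def)
  have "continuous (at t within {0..v}) f"
    using assms[OF v(3,2)] t v unfolding continuous_on_eq_continuous_within by simp
  moreover have "at t within {0..v} = at t within {0..<T}"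
    by (rule at_within_nhd[of t "{..<v}"]) (use v in auto)
  ultimately show "continuous (at t within {0..<T}) f" by simp
qed

text \<open>The maximum runs over \<open>{..n}\<close> so that the set is nonempty even for
  \<open>n = 0\<close>.\<close>

lemma abs_sum_le_Max:
  fixes g x :: "nat \<Rightarrow> real"
  shows "\<bar>\<Sum>i<n. g i * x i\<bar> \<le> Max ((\<lambda>i. \<bar>g i\<bar>) ` {..n}) * (\<Sum>i<n. \<bar>x i\<bar>)"
  unfolding sum_distrib_left
proof (rule order_trans[OF sum_abs sum_mono])
  fix i assume "i \<in> {..<n}"
  then have "\<bar>g i\<bar> \<le> Max ((\<lambda>i. \<bar>g i\<bar>) ` {..n})" by (intro Max_ge) auto
  then show "\<bar>g i * x i\<bar> \<le> Max ((\<lambda>i. \<bar>g i\<bar>) ` {..n}) * \<bar>x i\<bar>"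
    unfolding abs_mult by (rule mult_right_mono) simp
qed

context wiener_process
begin

section \<open>Quadratic variation\<close>

text \<open>Riemann sums over the interval up to \<open>t\<close> use values up to time
  \<open>t\<close> only, so their limit is \<open>F t\<close> measurable.\<close>

lemma continuous_adapted_LINT:
  assumes a: "continuous_adapted T a"
  shows "continuous_adapted T (\<lambda>t \<omega>. LINT s:{0..t}|lborel. a s \<omega>)"
  unfolding continuous_adapted_def
proof (intro conjI ballI)
  fix t assume t: "t \<in> {0..<T}"
  show "(\<lambda>\<omega>. LINT s:{0..t}|lborel. a s \<omega>) \<in> borel_measurable (F t)"
  proof (rule borel_measurable_LIMSEQ_real)
    fix \<omega> assume "\<omega> \<in> space (F t)"
    then show "(\<lambda>n. \<Sum>i<n. a (grid t n i) \<omega> * (t / n)) \<longlonglongrightarrow> (LINT s:{0..t}|lborel. a s \<omega>)"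
      using t by (intro riemann_sum_tendsto continuous_adaptedD(3)[OF a]) (auto simp: space_F)
  next
    fix n
    show "(\<lambda>\<omega>. \<Sum>i<n. a (grid t n i) \<omega> * (t / n)) \<in> borel_measurable (F t)"
    proof (intro borel_measurable_sum borel_measurable_times borel_measurable_const)
      fix i assume "i \<in> {..<n}"
      then have "grid t n i \<in> {0..t}" using grid_in[of t i n] t by auto
      then show "a (grid t n i) \<in> borel_measurable (F t)"
        using t by (intro measurable_F_mono[OF continuous_adaptedD(1)[OF a]]) auto
    qed
  qed
next
  fix \<omega> assume "\<omega> \<in> space P"
  then show "continuous_on {0..<T} (\<lambda>t. LINT s:{0..t}|lborel. a s \<omega>)"
    by (intro continuous_on_atLeastLessThan continuous_on_LINT continuous_adaptedD(3)[OF a])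
qed

lemma continuous_adapted_grid_measurable:
  assumes "continuous_adapted T H" "0 \<le> u" "u < T" "i \<le> n"
  shows "H (grid u n i) \<in> borel_measurable (F (grid u n i))"
    and "H (grid u n i) \<in> borel_measurable P"
  by (rule continuous_adaptedD[OF assms(1)]; use grid_in[OF assms(2,4)] assms(3) in simp)+

lemma grid_mostly_bounded:
  assumes g: "continuous_adapted T g" and u: "0 \<le> u" "u < T" and "\<eta> > 0"
  shows "\<exists>C. eventually (\<lambda>n. mostly P \<eta> (\<lambda>\<omega>. \<forall>i<n. \<bar>g (grid u n i) \<omega>\<bar> \<le> C)) sequentially"
proof -
  obtain C where C: "mostly P \<eta> (\<lambda>\<omega>. \<forall>s\<in>{0..u}. \<bar>g s \<omega>\<bar> \<le> C)"
    using mostly_pathwise_bounded[OF g u \<open>\<eta> > 0\<close>] by auto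
  have "mostly P \<eta> (\<lambda>\<omega>. \<forall>i<n. \<bar>g (grid u n i) \<omega>\<bar> \<le> C)" for n
    using C
  proof (rule mostly_mono[OF _ order_refl])
    fix \<omega> assume *: "\<forall>s\<in>{0..u}. \<bar>g s \<omega>\<bar> \<le> C"
    show "\<forall>i<n. \<bar>g (grid u n i) \<omega>\<bar> \<le> C"
    proof (intro allI impI)
      fix i assume "i < n"
      then show "\<bar>g (grid u n i) \<omega>\<bar> \<le> C" using *[rule_format, OF grid_in[OF u(1)]] by simp
    qed
  qed
  then show ?thesis by (intro exI[of _ C]) simp
qed

lemma grid_Max_bounded:
  assumes g: "continuous_adapted T g" and u: "0 \<le> u" "u < T"
  shows "bounded_in_prob P (\<lambda>n \<omega>. Max ((\<lambda>i. \<bar>g (grid u n i) \<omega>\<bar>) ` {..n}))"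
  unfolding bounded_in_prob_def
proof (intro allI impI)
  fix \<eta> :: real assume "\<eta> > 0"
  then obtain C where C: "mostly P \<eta> (\<lambda>\<omega>. \<forall>s\<in>{0..u}. \<bar>g s \<omega>\<bar> \<le> C)"
    using mostly_pathwise_bounded[OF g u] by auto
  have "mostly P \<eta> (\<lambda>\<omega>. \<bar>Max ((\<lambda>i. \<bar>g (grid u n i) \<omega>\<bar>) ` {..n})\<bar> \<le> C)" for n
    using C
  proof (rule mostly_mono[OF _ order_refl])
    fix \<omega> assume *: "\<forall>s\<in>{0..u}. \<bar>g s \<omega>\<bar> \<le> C"
    have le: "\<bar>g (grid u n i) \<omega>\<bar> \<le> C" if "i \<le> n" for i
      using * grid_in[OF u(1) that] by simp
    have "Max ((\<lambda>i. \<bar>g (grid u n i) \<omega>\<bar>) ` {..n}) \<le> C"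
      using le by (subst Max_le_iff) auto
    moreover have "0 \<le> Max ((\<lambda>i. \<bar>g (grid u n i) \<omega>\<bar>) ` {..n})"
      by (rule order_trans[OF abs_ge_zero Max_ge]) auto
    ultimately show "\<bar>Max ((\<lambda>i. \<bar>g (grid u n i) \<omega>\<bar>) ` {..n})\<bar> \<le> C" by simp
  qed
  then show "\<exists>C. eventually (\<lambda>n. mostly P \<eta> (\<lambda>\<omega>. \<bar>Max ((\<lambda>i. \<bar>g (grid u n i) \<omega>\<bar>) ` {..n})\<bar> \<le> C)) sequentially"
    by (intro exI[of _ C]) simp
qed

lemma riemann_stieltjes_null:
  assumes g: "continuous_adapted T g" and a: "continuous_adapted T a" and u: "0 \<le> u" "u < T"
  shows "null_in_prob P (\<lambda>n \<omega>. (\<Sum>i<n. g (grid u n i) \<omega> *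
      ((LINT s:{0..grid u n (Suc i)}|lborel. a s \<omega>) - (LINT s:{0..grid u n i}|lborel. a s \<omega>)))
      - (LINT s:{0..u}|lborel. g s \<omega> * a s \<omega>))"
proof (rule null_in_prob_pathwise)
  fix n
  show "(\<lambda>\<omega>. (\<Sum>i<n. g (grid u n i) \<omega> *
      ((LINT s:{0..grid u n (Suc i)}|lborel. a s \<omega>) - (LINT s:{0..grid u n i}|lborel. a s \<omega>)))
      - (LINT s:{0..u}|lborel. g s \<omega> * a s \<omega>)) \<in> borel_measurable P"
    using continuous_adapted_grid_measurable(2)[OF g u, of _ n]
      continuous_adapted_grid_measurable(2)[OF continuous_adapted_LINT[OF a] u, of _ n]
      continuous_adaptedD(2)[OF continuous_adapted_LINT[OF continuous_adapted_mult[OF g a]] u]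
    by (intro borel_measurable_diff borel_measurable_sum borel_measurable_times) (auto simp del: of_nat_Suc)
next
  fix \<omega> assume \<omega>: "\<omega> \<in> space P"
  show "(\<lambda>n. (\<Sum>i<n. g (grid u n i) \<omega> *
      ((LINT s:{0..grid u n (Suc i)}|lborel. a s \<omega>) - (LINT s:{0..grid u n i}|lborel. a s \<omega>)))
      - (LINT s:{0..u}|lborel. g s \<omega> * a s \<omega>)) \<longlonglongrightarrow> 0"
    by (rule LIM_zero[OF riemann_stieltjes_tendsto[OF continuous_adaptedD(3)[OF g u(2) \<omega>] continuous_adaptedD(3)[OF a u(2) \<omega>] u(1)]])
qed

lemma riemann_sum_null:
  assumes g: "continuous_adapted T g" and u: "0 \<le> u" "u < T"
  shows "null_in_prob P (\<lambda>n \<omega>. (\<Sum>i<n. g (grid u n i) \<omega> * (u / n)) - (LINT s:{0..u}|lborel. g s \<omega>))"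
proof (rule null_in_prob_pathwise)
  fix n
  show "(\<lambda>\<omega>. (\<Sum>i<n. g (grid u n i) \<omega> * (u / n)) - (LINT s:{0..u}|lborel. g s \<omega>)) \<in> borel_measurable P"
    using continuous_adapted_grid_measurable(2)[OF g u, of _ n] continuous_adaptedD(2)[OF continuous_adapted_LINT[OF g] u]
    by (intro borel_measurable_diff borel_measurable_sum borel_measurable_times) auto
next
  fix \<omega> assume \<omega>: "\<omega> \<in> space P"
  show "(\<lambda>n. (\<Sum>i<n. g (grid u n i) \<omega> * (u / n)) - (LINT s:{0..u}|lborel. g s \<omega>)) \<longlonglongrightarrow> 0"
    by (rule LIM_zero[OF riemann_sum_tendsto[OF continuous_adaptedD(3)[OF g u(2) \<omega>] u(1)]])
qed

text \<open>Each squared increment is the time step plus a compensated square. The time steps form a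
  Riemann sum; the compensated part has quadratic sum at most
  \<open>C\<^sup>2 * (2 * u\<^sup>2) / n\<close> where \<open>c\<close> is bounded by
  \<open>C\<close>.\<close>

lemma wiener_quadratic_variation:
  assumes c: "continuous_adapted T c" and u: "0 \<le> u" "u < T"
  shows "null_in_prob P (\<lambda>n \<omega>. (\<Sum>i<n. c (grid u n i) \<omega> *
      (incr W u n i \<omega>)\<^sup>2) - (LINT s:{0..u}|lborel. c s \<omega>))"
proof -
  let ?p = "\<lambda>n i. grid u n i"
  have "null_in_prob P (\<lambda>n \<omega>. \<Sum>i<n. c (?p n i) \<omega> * ((W (?p n (Suc i)) \<omega> - W (?p n i) \<omega>)\<^sup>2 - (?p n (Suc i) - ?p n i)))"
  \<comment> \<open>\<open>wiener_square_sum_mostly\<close> needs strictly increasing times; for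
    \<open>u = 0\<close> all increments vanish.\<close>
  proof (cases "u = 0")
    case True
    then show ?thesis unfolding null_in_prob_def by (auto intro!: always_eventually mostly_true)
  next
    case False
    then have u0: "u > 0" using u by simp
    show ?thesis
      unfolding null_in_prob_def
    proof (intro allI impI)
      fix \<epsilon> \<eta> :: real assume pos: "\<epsilon> > 0" "\<eta> > 0"
      obtain C where C: "eventually (\<lambda>n. mostly P (\<eta> / 2) (\<lambda>\<omega>. \<forall>i<n. \<bar>c (?p n i) \<omega>\<bar> \<le> C)) sequentially"
        using grid_mostly_bounded[OF c u, of "\<eta> / 2"] pos by auto
      define \<delta> where "\<delta> = \<epsilon>\<^sup>2 * (\<eta> / 2)"
      have \<delta>: "\<delta> > 0" "\<delta> / \<epsilon>\<^sup>2 = \<eta> / 2" using pos by (auto simp: \<delta>_def)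
      have "eventually (\<lambda>n. (C\<^sup>2 * (2 * u\<^sup>2)) / \<delta> \<le> real n) sequentially"
        using filterlim_real_sequentially unfolding filterlim_at_top by auto
      with C eventually_gt_at_top[of 0]
      show "eventually (\<lambda>n. mostly P \<eta> (\<lambda>\<omega>. \<bar>\<Sum>i<n. c (?p n i) \<omega> * ((W (?p n (Suc i)) \<omega> - W (?p n i) \<omega>)\<^sup>2 - (?p n (Suc i) - ?p n i))\<bar> \<le> \<epsilon>)) sequentially"
      proof eventually_elim
        case (elim n)
        have step: "?p n (Suc i) - ?p n i = u / n" for i by (simp add: grid_step del: of_nat_Suc)
        have small: "mostly P (\<eta> / 2) (\<lambda>\<omega>. (\<Sum>i<n. (c (?p n i) \<omega>)\<^sup>2 * (2 * (?p n (Suc i) - ?p n i)\<^sup>2)) \<le> \<delta>)"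
        proof (rule mostly_mono[OF elim(1) order_refl])
          fix \<omega> assume *: "\<forall>i<n. \<bar>c (?p n i) \<omega>\<bar> \<le> C"
          have "(\<Sum>i<n. (c (?p n i) \<omega>)\<^sup>2 * (2 * (?p n (Suc i) - ?p n i)\<^sup>2)) \<le> (\<Sum>i<n. C\<^sup>2 * (2 * (u / n)\<^sup>2))"
            unfolding step
          proof (intro sum_mono mult_right_mono)
            fix i assume "i \<in> {..<n}"
            then have "\<bar>c (?p n i) \<omega>\<bar> \<le> C" using * by simp
            then have "\<bar>c (?p n i) \<omega>\<bar>\<^sup>2 \<le> C\<^sup>2" by (rule power_mono) simp
            then show "(c (?p n i) \<omega>)\<^sup>2 \<le> C\<^sup>2" by simp
          qed simp
          also have "\<dots> = C\<^sup>2 * (2 * u\<^sup>2) / n" using elim(2) by (simp add: power_divide power2_eq_square)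
          also have "\<dots> \<le> \<delta>" using elim(2,3) \<delta>(1) by (simp add: field_simps)
          finally show "(\<Sum>i<n. (c (?p n i) \<omega>)\<^sup>2 * (2 * (?p n (Suc i) - ?p n i)\<^sup>2)) \<le> \<delta>" .
        qed
        have "mostly P (\<eta> / 2 + \<delta> / \<epsilon>\<^sup>2) (\<lambda>\<omega>. \<bar>\<Sum>i<n. c (?p n i) \<omega> * ((W (?p n (Suc i)) \<omega> - W (?p n i) \<omega>)\<^sup>2 - (?p n (Suc i) - ?p n i))\<bar> \<le> \<epsilon>)"
        proof (rule wiener_square_sum_mostly[OF _ _ _ small \<delta>(1) pos(1)])
          show "?p n i < ?p n (Suc i)" for i using elim(2) u0 by (simp add: divide_strict_right_mono)
          show "c (?p n i) \<in> borel_measurable (F (?p n i))" if "i < n" for i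
            using that by (intro continuous_adapted_grid_measurable(1)[OF c u]) simp
        qed simp
        then show ?case unfolding \<delta>(2) by simp
      qed
    qed
  qed
  from null_in_prob_add[OF this riemann_sum_null[OF c u]] show ?thesis
    by (rule null_in_prob_cong)
       (simp add: grid_step right_diff_distrib sum_subtractf del: of_nat_Suc)
qed

text \<open>The working form of \<open>has_ito_differential\<close> for continuous coefficients. The
  stochastic part \<open>Y\<close> is named, and the equation holds at every time for every
  \<omega>, not only almost surely.\<close>

definition ito_decomposition ::
  "real \<Rightarrow> (real \<Rightarrow> 'a \<Rightarrow> real) \<Rightarrow> (real \<Rightarrow> 'a \<Rightarrow> real) \<Rightarrow> (real \<Rightarrow> 'a \<Rightarrow> real) \<Rightarrow> (real \<Rightarrow> 'a \<Rightarrow> real) \<Rightarrow> bool" where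
  "ito_decomposition T X a b Y \<longleftrightarrow> continuous_adapted T X \<and> continuous_adapted T a \<and> ito_integral_process T b Y \<and>
     (\<forall>t \<omega>. 0 \<le> t \<longrightarrow> t < T \<longrightarrow> \<omega> \<in> space P \<longrightarrow> X t \<omega> = X 0 \<omega> + (LINT s:{0..t}|lborel. a s \<omega>) + Y t \<omega>)"

lemma ito_decompositionD:
  assumes "ito_decomposition T X a b Y"
  shows "continuous_adapted T X" "continuous_adapted T a" "ito_integral_process T b Y" "continuous_adapted T b"
    "\<And>u. 0 \<le> u \<Longrightarrow> u < T \<Longrightarrow> null_in_prob P (\<lambda>n \<omega>. left_sum b u n \<omega> - Y u \<omega>)"
    "\<And>t \<omega>. 0 \<le> t \<Longrightarrow> t < T \<Longrightarrow> \<omega> \<in> space P \<Longrightarrow> X t \<omega> = X 0 \<omega> + (LINT s:{0..t}|lborel. a s \<omega>) + Y t \<omega>"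
proof -
  show "continuous_adapted T X" "continuous_adapted T a" "ito_integral_process T b Y"
    using assms unfolding ito_decomposition_def by simp_all
  then show "continuous_adapted T b" unfolding ito_integral_process_def by simp
  show "null_in_prob P (\<lambda>n \<omega>. left_sum b u n \<omega> - Y u \<omega>)" if "0 \<le> u" "u < T" for u
    using assms that unfolding ito_decomposition_def ito_integral_process_def by simp
  show "X t \<omega> = X 0 \<omega> + (LINT s:{0..t}|lborel. a s \<omega>) + Y t \<omega>" if "0 \<le> t" "t < T" "\<omega> \<in> space P" for t \<omega>
    using assms that unfolding ito_decomposition_def by blast
qed

lemma ito_decomposition_increment:
  assumes X: "ito_decomposition T X a b Y" and u: "0 \<le> u" "u < T" and i: "i < n" and \<omega>: "\<omega> \<in> space P"
  shows "X (grid u n (Suc i)) \<omega> - X (grid u n i) \<omega>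
    = ((LINT s:{0..grid u n (Suc i)}|lborel. a s \<omega>) - (LINT s:{0..grid u n i}|lborel. a s \<omega>))
      + ito_error b Y u n i \<omega>
      + b (grid u n i) \<omega> * (incr W u n i \<omega>)"
proof -
  note g = grid_Icc[OF u(1) i]
  have "X (grid u n (Suc i)) \<omega> = X 0 \<omega> + (LINT s:{0..grid u n (Suc i)}|lborel. a s \<omega>) + Y (grid u n (Suc i)) \<omega>"
    by (rule ito_decompositionD(6)[OF X _ _ \<omega>]) (use g u in linarith)+
  moreover have "X (grid u n i) \<omega> = X 0 \<omega> + (LINT s:{0..grid u n i}|lborel. a s \<omega>) + Y (grid u n i) \<omega>"
    by (rule ito_decompositionD(6)[OF X _ _ \<omega>]) (use g u in linarith)+
  ultimately show ?thesis unfolding ito_error_def by simp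
qed

lemma drift_squares_null:
  assumes a: "continuous_adapted T a" and u: "0 \<le> u" "u < T"
  shows "null_in_prob P (\<lambda>n \<omega>. \<Sum>i<n. ((LINT s:{0..grid u n (Suc i)}|lborel. a s \<omega>) - (LINT s:{0..grid u n i}|lborel. a s \<omega>))\<^sup>2)"
proof (rule null_in_prob_pathwise)
  fix n
  show "(\<lambda>\<omega>. \<Sum>i<n. ((LINT s:{0..grid u n (Suc i)}|lborel. a s \<omega>) - (LINT s:{0..grid u n i}|lborel. a s \<omega>))\<^sup>2) \<in> borel_measurable P"
  proof (intro borel_measurable_sum borel_measurable_power borel_measurable_diff)
    fix i assume "i \<in> {..<n}"
    then have i: "i \<le> n" "Suc i \<le> n" by auto
    note m = continuous_adapted_grid_measurable(2)[OF continuous_adapted_LINT[OF a] u]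
    show "(\<lambda>\<omega>. LINT s:{0..grid u n (Suc i)}|lborel. a s \<omega>) \<in> borel_measurable P"
      by (rule m[OF i(2)])
    show "(\<lambda>\<omega>. LINT s:{0..grid u n i}|lborel. a s \<omega>) \<in> borel_measurable P"
      by (rule m[OF i(1)])
  qed
next
  fix \<omega> assume \<omega>: "\<omega> \<in> space P"
  show "(\<lambda>n. \<Sum>i<n. ((LINT s:{0..grid u n (Suc i)}|lborel. a s \<omega>) - (LINT s:{0..grid u n i}|lborel. a s \<omega>))\<^sup>2) \<longlonglongrightarrow> 0"
    by (rule sum_squares_increments_tendsto[OF continuous_adaptedD(3)[OF a u(2) \<omega>] u(1)])
qed

lemma null_in_prob_sum_squares_add:
  assumes "null_in_prob P (\<lambda>n \<omega>. \<Sum>i<n. (x n i \<omega>)\<^sup>2)" "null_in_prob P (\<lambda>n \<omega>. \<Sum>i<n. (y n i \<omega>)\<^sup>2)"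
  shows "null_in_prob P (\<lambda>n \<omega>. \<Sum>i<n. (x n i \<omega> + y n i \<omega>)\<^sup>2)"
proof -
  have "null_in_prob P (\<lambda>n \<omega>. ((\<Sum>i<n. (x n i \<omega>)\<^sup>2) + (\<Sum>i<n. (y n i \<omega>)\<^sup>2)) + ((\<Sum>i<n. (x n i \<omega>)\<^sup>2) + (\<Sum>i<n. (y n i \<omega>)\<^sup>2)))"
    by (intro null_in_prob_add assms)
  then show ?thesis
  proof (rule null_in_prob_mono)
    fix n \<omega>
    have "(\<Sum>i<n. (x n i \<omega> + y n i \<omega>)\<^sup>2) \<le> (\<Sum>i<n. ((x n i \<omega>)\<^sup>2 + (y n i \<omega>)\<^sup>2) + ((x n i \<omega>)\<^sup>2 + (y n i \<omega>)\<^sup>2))"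
    proof (rule sum_mono)
      fix i
      have "0 \<le> (x n i \<omega> - y n i \<omega>)\<^sup>2" by simp
      then show "(x n i \<omega> + y n i \<omega>)\<^sup>2 \<le> ((x n i \<omega>)\<^sup>2 + (y n i \<omega>)\<^sup>2) + ((x n i \<omega>)\<^sup>2 + (y n i \<omega>)\<^sup>2)"
        by (simp add: power2_eq_square algebra_simps)
    qed
    then show "\<bar>\<Sum>i<n. (x n i \<omega> + y n i \<omega>)\<^sup>2\<bar>
      \<le> \<bar>((\<Sum>i<n. (x n i \<omega>)\<^sup>2) + (\<Sum>i<n. (y n i \<omega>)\<^sup>2)) + ((\<Sum>i<n. (x n i \<omega>)\<^sup>2) + (\<Sum>i<n. (y n i \<omega>)\<^sup>2))\<bar>"
      by (simp add: sum.distrib sum_nonneg sum_distrib_left)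
  qed
qed

text \<open>Write an increment as \<open>e + w\<close>, where \<open>w\<close> is \<open>b\<close>
  times the Wiener increment and \<open>e\<close> collects drift and error. Then
  \<open>(e + w)\<^sup>2 - w\<^sup>2 = e * (2 * w + e)\<close>, and Cauchy-Schwarz makes its
  weighted sum negligible because the squares of \<open>e\<close> sum to a null sequence. The
  squares of \<open>w\<close> are the Wiener case with weight \<open>g * b\<^sup>2\<close>.\<close>

theorem quadratic_variation:
  assumes X: "ito_decomposition T X a b Y" and g: "continuous_adapted T g" and u: "0 \<le> u" "u < T"
  shows "null_in_prob P (\<lambda>n \<omega>. (\<Sum>i<n. g (grid u n i) \<omega> *
      (incr X u n i \<omega>)\<^sup>2) - (LINT s:{0..u}|lborel. g s \<omega> * (b s \<omega>)\<^sup>2))"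
proof -
  note D = ito_decompositionD[OF X]
  define gi where "gi n i \<omega> = g (grid u n i) \<omega>" for n i \<omega>
  define dX where "dX n i \<omega> = X (grid u n (Suc i)) \<omega> - X (grid u n i) \<omega>" for n i \<omega>
  define w where "w n i \<omega> = b (grid u n i) \<omega> * (incr W u n i \<omega>)" for n i \<omega>
  define e where "e n i \<omega> = ((LINT s:{0..grid u n (Suc i)}|lborel. a s \<omega>) - (LINT s:{0..grid u n i}|lborel. a s \<omega>))
      + ito_error b Y u n i \<omega>" for n i \<omega>
  have dX: "dX n i \<omega> = e n i \<omega> + w n i \<omega>" if "i < n" "\<omega> \<in> space P" for n i \<omega>
    using ito_decomposition_increment[OF X u that] by (simp add: dX_def e_def w_def)
  define N1 where "N1 n \<omega> = (\<Sum>i<n. (e n i \<omega>)\<^sup>2)" for n \<omega>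
  define B2 where "B2 n \<omega> = (\<Sum>i<n. (w n i \<omega>)\<^sup>2)" for n \<omega>
  define Gm where "Gm n \<omega> = Max ((\<lambda>i. \<bar>gi n i \<omega>\<bar>) ` {..n})" for n \<omega>
  have N1: "null_in_prob P N1"
    unfolding N1_def e_def
    by (intro null_in_prob_sum_squares_add drift_squares_null[OF D(2) u] sum_ito_error_squares_null[OF D(3) u])
  have b2: "continuous_adapted T (\<lambda>s \<omega>. (b s \<omega>)\<^sup>2)" by (rule continuous_adapted_power[OF D(4)])
  have B2: "bounded_in_prob P B2"
  proof -
    have "bounded_in_prob P (\<lambda>n \<omega>. ((\<Sum>i<n. (b (grid u n i) \<omega>)\<^sup>2 *
      (incr W u n i \<omega>)\<^sup>2) - (LINT s:{0..u}|lborel. (b s \<omega>)\<^sup>2))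
      + (LINT s:{0..u}|lborel. (b s \<omega>)\<^sup>2))"
      by (intro bounded_in_prob_add null_in_prob_bounded wiener_quadratic_variation[OF b2 u] bounded_in_prob_const
          continuous_adaptedD(2)[OF continuous_adapted_LINT[OF b2] u])
    moreover have "B2 = (\<lambda>n \<omega>. ((\<Sum>i<n. (b (grid u n i) \<omega>)\<^sup>2 *
      (incr W u n i \<omega>)\<^sup>2) - (LINT s:{0..u}|lborel. (b s \<omega>)\<^sup>2))
      + (LINT s:{0..u}|lborel. (b s \<omega>)\<^sup>2))"
      unfolding B2_def w_def power_mult_distrib by simp
    ultimately show ?thesis by simp
  qed
  have Gm: "bounded_in_prob P Gm" unfolding Gm_def gi_def by (rule grid_Max_bounded[OF g u])
  have const: "bounded_in_prob P (\<lambda>n \<omega>. c)" for c by (rule bounded_in_prob_const) simp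
  have "null_in_prob P (\<lambda>n \<omega>. sqrt (N1 n \<omega>) * ((1 + (8 * B2 n \<omega> + 2 * N1 n \<omega>)) * Gm n \<omega>))"
    by (intro null_in_prob_mult_bounded null_in_prob_sqrt N1 bounded_in_prob_mult bounded_in_prob_add B2 Gm const null_in_prob_bounded)
  then have 1: "null_in_prob P (\<lambda>n \<omega>. \<Sum>i<n. gi n i \<omega> * ((dX n i \<omega>)\<^sup>2 - (w n i \<omega>)\<^sup>2))"
  proof (rule null_in_prob_mono)
    fix n \<omega> assume \<omega>: "\<omega> \<in> space P"
    define y where "y i = 2 * w n i \<omega> + e n i \<omega>" for i
    have N1_0: "N1 n \<omega> \<ge> 0" "B2 n \<omega> \<ge> 0" unfolding N1_def B2_def by (auto intro: sum_nonneg)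
    have Gm0: "Gm n \<omega> \<ge> 0" unfolding Gm_def by (rule order_trans[OF abs_ge_zero Max_ge]) auto
    have y2: "(\<Sum>i<n. (y i)\<^sup>2) \<le> 8 * B2 n \<omega> + 2 * N1 n \<omega>"
    proof -
      have "(\<Sum>i<n. (y i)\<^sup>2) \<le> (\<Sum>i<n. 8 * (w n i \<omega>)\<^sup>2 + 2 * (e n i \<omega>)\<^sup>2)"
      proof (rule sum_mono)
        fix i
        have "0 \<le> (2 * w n i \<omega> - e n i \<omega>)\<^sup>2" by simp
        then show "(y i)\<^sup>2 \<le> 8 * (w n i \<omega>)\<^sup>2 + 2 * (e n i \<omega>)\<^sup>2"
          by (simp add: y_def power2_eq_square algebra_simps)
      qed
      then show ?thesis unfolding B2_def N1_def by (simp add: sum.distrib sum_distrib_left)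
    qed
    have "(\<Sum>i<n. gi n i \<omega> * ((dX n i \<omega>)\<^sup>2 - (w n i \<omega>)\<^sup>2)) = (\<Sum>i<n. gi n i \<omega> * (e n i \<omega> * y i))"
      by (rule sum.cong[OF refl]) (simp add: dX[OF _ \<omega>] y_def power2_eq_square algebra_simps)
    then have "\<bar>\<Sum>i<n. gi n i \<omega> * ((dX n i \<omega>)\<^sup>2 - (w n i \<omega>)\<^sup>2)\<bar> \<le> Gm n \<omega> * (\<Sum>i<n. \<bar>e n i \<omega> * y i\<bar>)"
      unfolding Gm_def using abs_sum_le_Max[of "\<lambda>i. gi n i \<omega>" "\<lambda>i. e n i \<omega> * y i" n] by simp
    moreover have "(\<Sum>i<n. \<bar>e n i \<omega> * y i\<bar>) \<le> sqrt (N1 n \<omega>) * (1 + (8 * B2 n \<omega> + 2 * N1 n \<omega>))"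
    proof -
      have "(\<Sum>i<n. \<bar>e n i \<omega>\<bar> * \<bar>y i\<bar>)\<^sup>2 \<le> (\<Sum>i<n. \<bar>e n i \<omega>\<bar>\<^sup>2) * (\<Sum>i<n. \<bar>y i\<bar>\<^sup>2)"
        by (rule Cauchy_Schwarz_ineq_sum)
      then have "(\<Sum>i<n. \<bar>e n i \<omega> * y i\<bar>)\<^sup>2 \<le> N1 n \<omega> * (\<Sum>i<n. (y i)\<^sup>2)"
        by (simp add: abs_mult N1_def)
      then have "(\<Sum>i<n. \<bar>e n i \<omega> * y i\<bar>) \<le> sqrt (N1 n \<omega> * (\<Sum>i<n. (y i)\<^sup>2))"
        by (rule real_le_rsqrt)
      also have "\<dots> = sqrt (N1 n \<omega>) * sqrt (\<Sum>i<n. (y i)\<^sup>2)" by (rule real_sqrt_mult)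
      \<comment> \<open>The crude bound of \<open>sqrt z\<close> by \<open>1 + z\<close> keeps the
        factor a sum of sequences already known to be bounded in probability.\<close>
      also have "sqrt (\<Sum>i<n. (y i)\<^sup>2) \<le> 1 + (8 * B2 n \<omega> + 2 * N1 n \<omega>)"
      proof (rule real_le_lsqrt)
        show "(\<Sum>i<n. (y i)\<^sup>2) \<le> (1 + (8 * B2 n \<omega> + 2 * N1 n \<omega>))\<^sup>2"
        proof -
          have "z \<le> (1 + z)\<^sup>2" if "z \<ge> 0" for z :: real
            using that by (simp add: power2_eq_square algebra_simps)
          from this[of "8 * B2 n \<omega> + 2 * N1 n \<omega>"] show ?thesis using y2 N1_0 by linarith
        qed
      qed (use N1_0 in \<open>auto intro: sum_nonneg\<close>)
      finally show ?thesis using N1_0 by (simp add: mult_left_mono)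
    qed
    ultimately have "\<bar>\<Sum>i<n. gi n i \<omega> * ((dX n i \<omega>)\<^sup>2 - (w n i \<omega>)\<^sup>2)\<bar> \<le> Gm n \<omega> * (sqrt (N1 n \<omega>) * (1 + (8 * B2 n \<omega> + 2 * N1 n \<omega>)))"
      using mult_left_mono[OF _ Gm0] order_trans by blast
    then show "\<bar>\<Sum>i<n. gi n i \<omega> * ((dX n i \<omega>)\<^sup>2 - (w n i \<omega>)\<^sup>2)\<bar> \<le> \<bar>sqrt (N1 n \<omega>) * ((1 + (8 * B2 n \<omega> + 2 * N1 n \<omega>)) * Gm n \<omega>)\<bar>"
      by (simp add: ac_simps order_trans[OF _ abs_ge_self])
  qed
  have 2: "null_in_prob P (\<lambda>n \<omega>. (\<Sum>i<n. (g (grid u n i) \<omega> * (b (grid u n i) \<omega>)\<^sup>2) *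
      (incr W u n i \<omega>)\<^sup>2) - (LINT s:{0..u}|lborel. g s \<omega> * (b s \<omega>)\<^sup>2))"
    by (rule wiener_quadratic_variation[OF continuous_adapted_mult[OF g b2] u])
  from null_in_prob_add[OF 1 2] show ?thesis
  proof (rule null_in_prob_cong)
    fix n \<omega>
    have "(\<Sum>i<n. gi n i \<omega> * ((dX n i \<omega>)\<^sup>2 - (w n i \<omega>)\<^sup>2)) = (\<Sum>i<n. gi n i \<omega> * (dX n i \<omega>)\<^sup>2) - (\<Sum>i<n. gi n i \<omega> * (w n i \<omega>)\<^sup>2)"
      by (simp only: right_diff_distrib sum_subtractf)
    moreover have "(\<Sum>i<n. gi n i \<omega> * (w n i \<omega>)\<^sup>2) = (\<Sum>i<n. (g (grid u n i) \<omega> * (b (grid u n i) \<omega>)\<^sup>2) *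
      (incr W u n i \<omega>)\<^sup>2)"
      by (simp only: gi_def w_def power_mult_distrib mult.assoc)
    ultimately show "(\<Sum>i<n. g (grid u n i) \<omega> * (incr X u n i \<omega>)\<^sup>2)
      - (LINT s:{0..u}|lborel. g s \<omega> * (b s \<omega>)\<^sup>2)
      = (\<Sum>i<n. gi n i \<omega> * ((dX n i \<omega>)\<^sup>2 - (w n i \<omega>)\<^sup>2)) + ((\<Sum>i<n. (g (grid u n i) \<omega> * (b (grid u n i) \<omega>)\<^sup>2) *
      (incr W u n i \<omega>)\<^sup>2) - (LINT s:{0..u}|lborel. g s \<omega> * (b s \<omega>)\<^sup>2))"
      by (simp only: gi_def dX_def)
  qed
qed

end

context wiener_process
begin

section \<open>It\^o's formula\<close>

lemma progressive_adapted:
  assumes H: "progressive_on F 0 t H" and t: "0 \<le> t"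
  shows "H t \<in> borel_measurable (F t)"
proof -
  have "Pair t \<in> measurable (F t) (restrict_space borel {0..t} \<Otimes>\<^sub>M F t)"
    using t by (intro measurable_Pair1') (simp add: space_restrict_space)
  from measurable_compose[OF this H[unfolded progressive_on_def]] show ?thesis by simp
qed

lemma ito_decompositionI:
  assumes X: "continuous_adapted T X" and a: "continuous_adapted T a" and b: "continuous_adapted T b"
    and null: "\<And>u. 0 \<le> u \<Longrightarrow> u < T \<Longrightarrow>
      null_in_prob P (\<lambda>n \<omega>. left_sum b u n \<omega> - (X u \<omega> - X 0 \<omega> - (LINT s:{0..u}|lborel. a s \<omega>)))"
  shows "ito_decomposition T X a b (\<lambda>t \<omega>. X t \<omega> - X 0 \<omega> - (LINT s:{0..t}|lborel. a s \<omega>))"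
proof -
  have "continuous_adapted T (\<lambda>t. X 0)"
    unfolding continuous_adapted_def
  proof (intro conjI ballI)
    fix t assume "t \<in> {0..<T}"
    then show "X 0 \<in> borel_measurable (F t)"
      using measurable_F_mono[OF continuous_adaptedD(1)[OF X, of 0], of t] by simp
  qed simp
  then have "continuous_adapted T (\<lambda>t \<omega>. X t \<omega> - X 0 \<omega> - (LINT s:{0..t}|lborel. a s \<omega>))"
    by (intro continuous_adapted_diff X continuous_adapted_LINT[OF a])
  moreover have "(LINT s:{0..0}|lborel. a s \<omega>) = 0" for \<omega>
    by (subst LINT_continuous) auto
  ultimately show ?thesis
    unfolding ito_decomposition_def ito_integral_process_def using X a b null by simp
qed

text \<open>The stochastic part is defined as the remainder after the drift, so the decomposition
  holds identically; \<open>ito_integral_left_sums\<close> then says that this remainder is the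
  limit of left sums.\<close>

lemma ito_differential_decomposition:
  assumes Z: "has_ito_differential P F W 0 T Z a b"
    and a: "\<And>\<omega>. \<omega> \<in> space P \<Longrightarrow> continuous_on {0..<T} (\<lambda>t. a t \<omega>)"
    and b: "\<And>\<omega>. \<omega> \<in> space P \<Longrightarrow> continuous_on {0..<T} (\<lambda>t. b t \<omega>)"
  shows "ito_decomposition T Z a b (\<lambda>t \<omega>. Z t \<omega> - Z 0 \<omega> - (LINT s:{0..t}|lborel. a s \<omega>))"
proof (rule ito_decompositionI)
  show "continuous_adapted T Z" using Z unfolding has_ito_differential_def continuous_adapted_def by simp
  show "continuous_adapted T a" "continuous_adapted T b"
    using Z a b unfolding has_ito_differential_def continuous_adapted_def by (simp_all add: progressive_adapted)
  then show "null_in_prob P (\<lambda>n \<omega>. left_sum b u n \<omega> - (Z u \<omega> - Z 0 \<omega> - (LINT s:{0..u}|lborel. a s \<omega>)))"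
    if "0 \<le> u" "u < T" for u
    using Z that by (intro ito_integral_left_sums) (auto simp: has_ito_differential_def)
qed

lemma ito_decomposition_differential:
  assumes X: "ito_decomposition T X a b Y"
  shows "has_ito_differential P F W 0 T X a b"
  unfolding has_ito_differential_def
proof (intro conjI ballI)
  note D = ito_decompositionD[OF X]
  show "X t \<in> borel_measurable (F t)" if "t \<in> {0..<T}" for t
    using D(1) that unfolding continuous_adapted_def by simp
  show "continuous_on {0..<T} (\<lambda>t. X t \<omega>)" if "\<omega> \<in> space P" for \<omega>
    using D(1) that unfolding continuous_adapted_def by simp
  fix t assume "t \<in> {0..<T}"
  then have t: "0 \<le> t" "t < T" by auto
  show "progressive_on F 0 t a" "progressive_on F 0 t b"
    by (rule continuous_adapted_progressive[OF D(2) t] continuous_adapted_progressive[OF D(4) t])+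
  show "AE \<omega> in P. set_integrable lborel {0..t} (\<lambda>s. a s \<omega>)"
    by (intro AE_I2 borel_integrable_atLeastAtMost' continuous_adaptedD(3)[OF D(2) t(2)])
  show "AE \<omega> in P. set_integrable lborel {0..t} (\<lambda>s. (b s \<omega>)\<^sup>2)"
    by (intro AE_I2 borel_integrable_atLeastAtMost' continuous_on_power continuous_adaptedD(3)[OF D(4) t(2)])
  show "has_ito_integral P F W 0 t b (\<lambda>\<omega>. X t \<omega> - X 0 \<omega> - (LINT s:{0..t}|lborel. a s \<omega>))"
  proof (rule ito_integral_of_left_sums[OF D(4) t])
    show "(\<lambda>\<omega>. X t \<omega> - X 0 \<omega> - (LINT s:{0..t}|lborel. a s \<omega>)) \<in> borel_measurable P"
      using continuous_adaptedD(2)[OF D(1)] continuous_adaptedD(2)[OF continuous_adapted_LINT[OF D(2)] t] t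
      by (intro borel_measurable_diff) simp_all
    show "null_in_prob P (\<lambda>n \<omega>. left_sum b t n \<omega> - (X t \<omega> - X 0 \<omega> - (LINT s:{0..t}|lborel. a s \<omega>)))"
    proof (rule null_in_prob_cong[OF D(5)[OF t]])
      fix n \<omega> assume "\<omega> \<in> space P"
      from D(6)[OF t this] show "left_sum b t n \<omega> - (X t \<omega> - X 0 \<omega> - (LINT s:{0..t}|lborel. a s \<omega>)) = left_sum b t n \<omega> - Y t \<omega>"
        by linarith
    qed
  qed
qed

text \<open>Telescope along the grid and expand each increment. Five errors vanish in probability:
  the Taylor remainder, the Riemann sum in time, the drift sum, the transform of
  \<open>ito_error\<close> by \<open>kx\<close>, and the quadratic variation. What is left over is
  the left sum of \<open>kx * b\<close>.\<close>

theorem ito_formula: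
  assumes Z: "ito_decomposition T Z a b Y" and J: "J \<in> sets borel"
    and ZJ: "\<And>t \<omega>. 0 \<le> t \<Longrightarrow> t < T \<Longrightarrow> \<omega> \<in> space P \<Longrightarrow> Z t \<omega> \<in> J"
    and kt: "\<And>t x. t \<in> {0..<T} \<Longrightarrow> x \<in> J \<Longrightarrow> ((\<lambda>t. k t x) has_real_derivative kt t x) (at t within {0..<T})"
    and kx: "\<And>t x. t \<in> {0..<T} \<Longrightarrow> x \<in> J \<Longrightarrow> (k t has_real_derivative kx t x) (at x)"
    and kxx: "\<And>t x. t \<in> {0..<T} \<Longrightarrow> x \<in> J \<Longrightarrow> (kx t has_real_derivative kxx t x) (at x)"
    and cont: "continuous_on ({0..<T} \<times> J) (\<lambda>(t, x). k t x)" "continuous_on ({0..<T} \<times> J) (\<lambda>(t, x). kt t x)"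
      "continuous_on ({0..<T} \<times> J) (\<lambda>(t, x). kx t x)" "continuous_on ({0..<T} \<times> J) (\<lambda>(t, x). kxx t x)"
  shows "has_ito_differential P F W 0 T (\<lambda>t \<omega>. k t (Z t \<omega>))
    (\<lambda>t \<omega>. kt t (Z t \<omega>) + kx t (Z t \<omega>) * a t \<omega> + kxx t (Z t \<omega>) / 2 * (b t \<omega>)\<^sup>2)
    (\<lambda>t \<omega>. kx t (Z t \<omega>) * b t \<omega>)"
proof -
  note D = ito_decompositionD[OF Z]
  have contH: "continuous_on ({0..<T} \<times> J) (\<lambda>(t, x). kxx t x / 2)"
    using continuous_on_divide[OF cont(4) continuous_on_const[of _ 2]] by (simp add: case_prod_beta)
  have ca: "continuous_adapted T (\<lambda>t \<omega>. k t (Z t \<omega>))" "continuous_adapted T (\<lambda>t \<omega>. kt t (Z t \<omega>))"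
    "continuous_adapted T (\<lambda>t \<omega>. kx t (Z t \<omega>))" "continuous_adapted T (\<lambda>t \<omega>. kxx t (Z t \<omega>) / 2)"
    by (rule continuous_adapted_compose[OF D(1) cont(1) J ZJ] continuous_adapted_compose[OF D(1) cont(2) J ZJ]
        continuous_adapted_compose[OF D(1) cont(3) J ZJ] continuous_adapted_compose[OF D(1) contH J ZJ]; assumption)+
  have b2: "continuous_adapted T (\<lambda>t \<omega>. (b t \<omega>)\<^sup>2)" by (rule continuous_adapted_power[OF D(4)])
  have kxa: "continuous_adapted T (\<lambda>t \<omega>. kx t (Z t \<omega>) * a t \<omega>)" by (rule continuous_adapted_mult[OF ca(3) D(2)])
  have kxxb: "continuous_adapted T (\<lambda>t \<omega>. kxx t (Z t \<omega>) / 2 * (b t \<omega>)\<^sup>2)" by (rule continuous_adapted_mult[OF ca(4) b2])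
  define a' where "a' = (\<lambda>t \<omega>. kt t (Z t \<omega>) + kx t (Z t \<omega>) * a t \<omega> + kxx t (Z t \<omega>) / 2 * (b t \<omega>)\<^sup>2)"
  define b' where "b' = (\<lambda>t \<omega>. kx t (Z t \<omega>) * b t \<omega>)"
  have a': "continuous_adapted T a'" unfolding a'_def by (rule continuous_adapted_add[OF continuous_adapted_add[OF ca(2) kxa] kxxb])
  have b': "continuous_adapted T b'" unfolding b'_def by (rule continuous_adapted_mult[OF ca(3) D(4)])
  have "ito_decomposition T (\<lambda>t \<omega>. k t (Z t \<omega>)) a' b' (\<lambda>t \<omega>. k t (Z t \<omega>) - k 0 (Z 0 \<omega>) - (LINT s:{0..t}|lborel. a' s \<omega>))"
  proof (rule ito_decompositionI[OF ca(1) a' b'])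
    fix u assume u: "0 \<le> u" "u < T"
    let ?p = "\<lambda>n i. grid u n i"
    define A where "A t \<omega> = (LINT s:{0..t}|lborel. a s \<omega>)" for t \<omega>
    define Q where "Q n \<omega> = (\<Sum>i<n. (Z (?p n (Suc i)) \<omega> - Z (?p n i) \<omega>)\<^sup>2)" for n \<omega>
    define E where "E n \<omega> = (\<Sum>i<n. let t = ?p n i; t' = ?p n (Suc i) in
        k t' (Z t' \<omega>) - k t (Z t \<omega>) - kt t (Z t \<omega>) * (u / n) - kx t (Z t \<omega>) * (Z t' \<omega> - Z t \<omega>)
          - kxx t (Z t \<omega>) / 2 * (Z t' \<omega> - Z t \<omega>)\<^sup>2)" for n \<omega>
    have Q0: "Q n \<omega> \<ge> 0" for n \<omega> unfolding Q_def by (rule sum_nonneg) simp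
    \<comment> \<open>The square sums \<open>Q\<close> converge in probability only, so the
      remainder has no evident pathwise limit. The normalised remainder tends to zero along each
      path, and the factor, bounded in probability, is restored afterwards.\<close>
    have "null_in_prob P (\<lambda>n \<omega>. E n \<omega> / (1 + u + Q n \<omega>))"
    proof (rule null_in_prob_pathwise)
      fix n
      note m = continuous_adapted_grid_measurable(2)[OF ca(1) u] continuous_adapted_grid_measurable(2)[OF ca(2) u]
        continuous_adapted_grid_measurable(2)[OF ca(3) u] continuous_adapted_grid_measurable(2)[OF ca(4) u]
        continuous_adapted_grid_measurable(2)[OF D(1) u]
      have "E n \<in> borel_measurable P"
        unfolding E_def Let_def
        by (intro borel_measurable_sum borel_measurable_diff borel_measurable_times borel_measurable_power borel_measurable_const;
            rule m; simp)
      moreover have "Q n \<in> borel_measurable P"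
        unfolding Q_def
        by (intro borel_measurable_sum borel_measurable_diff borel_measurable_power; rule m; simp)
      ultimately show "(\<lambda>\<omega>. E n \<omega> / (1 + u + Q n \<omega>)) \<in> borel_measurable P"
        by (intro borel_measurable_divide borel_measurable_add borel_measurable_const)
    next
      fix \<omega> assume \<omega>: "\<omega> \<in> space P"
      show "(\<lambda>n. E n \<omega> / (1 + u + Q n \<omega>)) \<longlonglongrightarrow> 0"
      proof (rule LIMSEQ_I)
        fix r :: real assume "r > 0"
        then have r: "r / 2 > 0" by simp
        have "(\<lambda>t. Z t \<omega>) ` {0..u} \<subseteq> J" using ZJ u \<omega> by auto
        from ito_taylor_remainder[OF continuous_adaptedD(3)[OF D(1) u(2) \<omega>] this u r kt kx kxx cont(2,4)]
        obtain N where N: "\<And>n. n \<ge> N \<Longrightarrow> \<bar>E n \<omega>\<bar> \<le> r / 2 * (u + Q n \<omega>)"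
          unfolding E_def Q_def by blast
        show "\<exists>no. \<forall>n\<ge>no. norm (E n \<omega> / (1 + u + Q n \<omega>) - 0) < r"
        proof (intro exI allI impI)
          fix n assume n: "n \<ge> N"
          have pos: "1 + u + Q n \<omega> > 0" using u Q0[of n \<omega>] by simp
          have "\<bar>E n \<omega>\<bar> \<le> r / 2 * (u + Q n \<omega>)" by (rule N[OF n])
          also have "\<dots> \<le> r / 2 * (1 + u + Q n \<omega>)" using r by (intro mult_left_mono) auto
          also have "\<dots> < r * (1 + u + Q n \<omega>)" using \<open>r > 0\<close> pos by (intro mult_strict_right_mono) auto
          finally show "norm (E n \<omega> / (1 + u + Q n \<omega>) - 0) < r"
            using pos by (simp add: abs_divide pos_divide_less_eq)
        qed
      qed
    qed
    moreover have "bounded_in_prob P (\<lambda>n \<omega>. 1 + u + Q n \<omega>)"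
    proof -
      have "null_in_prob P (\<lambda>n \<omega>. Q n \<omega> - (LINT s:{0..u}|lborel. (b s \<omega>)\<^sup>2))"
        using quadratic_variation[OF Z continuous_adapted_const[of T 1] u] by (simp add: Q_def)
      then have "bounded_in_prob P (\<lambda>n \<omega>. (1 + u) + ((Q n \<omega> - (LINT s:{0..u}|lborel. (b s \<omega>)\<^sup>2)) + (LINT s:{0..u}|lborel. (b s \<omega>)\<^sup>2)))"
        using continuous_adaptedD(2)[OF continuous_adapted_LINT[OF b2] u]
        by (intro bounded_in_prob_add null_in_prob_bounded bounded_in_prob_const) simp_all
      then show ?thesis by simp
    qed
    ultimately have "null_in_prob P (\<lambda>n \<omega>. E n \<omega> / (1 + u + Q n \<omega>) * (1 + u + Q n \<omega>))"
      by (rule null_in_prob_mult_bounded)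
    moreover have "E n \<omega> / (1 + u + Q n \<omega>) * (1 + u + Q n \<omega>) = E n \<omega>" for n \<omega>
      using Q0[of n \<omega>] u by simp
    ultimately have t1: "null_in_prob P E" by simp
    have t2: "null_in_prob P (\<lambda>n \<omega>. (\<Sum>i<n. kt (?p n i) (Z (?p n i) \<omega>) * (u / n)) - (LINT s:{0..u}|lborel. kt s (Z s \<omega>)))"
      by (rule riemann_sum_null[OF ca(2) u])
    have t3: "null_in_prob P (\<lambda>n \<omega>. (\<Sum>i<n. kx (?p n i) (Z (?p n i) \<omega>) * (A (?p n (Suc i)) \<omega> - A (?p n i) \<omega>))
        - (LINT s:{0..u}|lborel. kx s (Z s \<omega>) * a s \<omega>))"
      unfolding A_def by (rule riemann_stieltjes_null[OF ca(3) D(2) u])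
    have t4: "null_in_prob P (\<lambda>n \<omega>. \<Sum>i<n. kx (?p n i) (Z (?p n i) \<omega>) * ito_error b Y u n i \<omega>)"
    proof (rule ito_error_transform_null[OF D(3) u])
      show "(\<lambda>\<omega>. kx (?p n i) (Z (?p n i) \<omega>)) \<in> borel_measurable (F (?p n i))" if "i < n" for n i
        by (rule continuous_adapted_grid_measurable(1)[OF ca(3) u]) (use that in simp)
      show "\<exists>C. eventually (\<lambda>n. mostly P \<eta> (\<lambda>\<omega>. \<forall>i<n. \<bar>kx (?p n i) (Z (?p n i) \<omega>)\<bar> \<le> C)) sequentially" if "\<eta> > 0" for \<eta>
        by (rule grid_mostly_bounded[OF ca(3) u that])
    qed
    have t5: "null_in_prob P (\<lambda>n \<omega>. (\<Sum>i<n. kxx (?p n i) (Z (?p n i) \<omega>) / 2 * (Z (?p n (Suc i)) \<omega> - Z (?p n i) \<omega>)\<^sup>2)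
        - (LINT s:{0..u}|lborel. kxx s (Z s \<omega>) / 2 * (b s \<omega>)\<^sup>2))"
      by (rule quadratic_variation[OF Z ca(4) u])
    note null = null_in_prob_minus[OF null_in_prob_add[OF null_in_prob_add[OF null_in_prob_add[OF null_in_prob_add[OF t1 t2] t3] t4] t5]]
    show "null_in_prob P (\<lambda>n \<omega>. left_sum b' u n \<omega> - (k u (Z u \<omega>) - k 0 (Z 0 \<omega>) - (LINT s:{0..u}|lborel. a' s \<omega>)))"
    proof (rule null_in_prob_eventually_cong[OF null])
      show "eventually (\<lambda>n. \<forall>\<omega>\<in>space P. left_sum b' u n \<omega> - (k u (Z u \<omega>) - k 0 (Z 0 \<omega>) - (LINT s:{0..u}|lborel. a' s \<omega>))
        = - (E n \<omega> + ((\<Sum>i<n. kt (?p n i) (Z (?p n i) \<omega>) * (u / n)) - (LINT s:{0..u}|lborel. kt s (Z s \<omega>)))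
          + ((\<Sum>i<n. kx (?p n i) (Z (?p n i) \<omega>) * (A (?p n (Suc i)) \<omega> - A (?p n i) \<omega>)) - (LINT s:{0..u}|lborel. kx s (Z s \<omega>) * a s \<omega>))
          + (\<Sum>i<n. kx (?p n i) (Z (?p n i) \<omega>) * ito_error b Y u n i \<omega>)
          + ((\<Sum>i<n. kxx (?p n i) (Z (?p n i) \<omega>) / 2 * (Z (?p n (Suc i)) \<omega> - Z (?p n i) \<omega>)\<^sup>2)
            - (LINT s:{0..u}|lborel. kxx s (Z s \<omega>) / 2 * (b s \<omega>)\<^sup>2)))) sequentially"
        using eventually_gt_at_top[of "0::nat"]
      proof (rule eventually_mono, intro ballI)
        fix n :: nat and \<omega> assume n: "0 < n" and \<omega>: "\<omega> \<in> space P"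
        define p where "p i = ?p n i" for i
        have tele: "(\<Sum>i<n. k (p (Suc i)) (Z (p (Suc i)) \<omega>) - k (p i) (Z (p i) \<omega>)) = k u (Z u \<omega>) - k 0 (Z 0 \<omega>)"
          using n by (subst sum_lessThan_telescope[of "\<lambda>i. k (p i) (Z (p i) \<omega>)"]) (simp add: p_def)
        have E: "E n \<omega> = (k u (Z u \<omega>) - k 0 (Z 0 \<omega>)) - (\<Sum>i<n. kt (p i) (Z (p i) \<omega>) * (u / n))
          - (\<Sum>i<n. kx (p i) (Z (p i) \<omega>) * (Z (p (Suc i)) \<omega> - Z (p i) \<omega>))
          - (\<Sum>i<n. kxx (p i) (Z (p i) \<omega>) / 2 * (Z (p (Suc i)) \<omega> - Z (p i) \<omega>)\<^sup>2)"
          unfolding E_def Let_def tele[symmetric] p_def[symmetric] by (simp only: sum_subtractf)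
        have "(\<Sum>i<n. kx (p i) (Z (p i) \<omega>) * (Z (p (Suc i)) \<omega> - Z (p i) \<omega>))
          = (\<Sum>i<n. kx (p i) (Z (p i) \<omega>) * (A (p (Suc i)) \<omega> - A (p i) \<omega>) + kx (p i) (Z (p i) \<omega>) * ito_error b Y u n i \<omega>
              + b' (p i) \<omega> * (W (p (Suc i)) \<omega> - W (p i) \<omega>))"
        proof (rule sum.cong[OF refl])
          fix i assume "i \<in> {..<n}"
          then have "Z (p (Suc i)) \<omega> - Z (p i) \<omega> = (A (p (Suc i)) \<omega> - A (p i) \<omega>) + ito_error b Y u n i \<omega>
            + b (p i) \<omega> * (W (p (Suc i)) \<omega> - W (p i) \<omega>)"
            using ito_decomposition_increment[OF Z u _ \<omega>, of i n] by (simp only: A_def p_def lessThan_iff)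
          then show "kx (p i) (Z (p i) \<omega>) * (Z (p (Suc i)) \<omega> - Z (p i) \<omega>)
            = kx (p i) (Z (p i) \<omega>) * (A (p (Suc i)) \<omega> - A (p i) \<omega>) + kx (p i) (Z (p i) \<omega>) * ito_error b Y u n i \<omega>
              + b' (p i) \<omega> * (W (p (Suc i)) \<omega> - W (p i) \<omega>)"
            by (simp only: b'_def distrib_left mult.assoc)
        qed
        then have K: "(\<Sum>i<n. kx (p i) (Z (p i) \<omega>) * (Z (p (Suc i)) \<omega> - Z (p i) \<omega>))
          = (\<Sum>i<n. kx (p i) (Z (p i) \<omega>) * (A (p (Suc i)) \<omega> - A (p i) \<omega>))
            + (\<Sum>i<n. kx (p i) (Z (p i) \<omega>) * ito_error b Y u n i \<omega>) + left_sum b' u n \<omega>"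
          by (simp only: sum.distrib left_sum_def p_def)
        have I: "(LINT s:{0..u}|lborel. a' s \<omega>) = (LINT s:{0..u}|lborel. kt s (Z s \<omega>))
          + (LINT s:{0..u}|lborel. kx s (Z s \<omega>) * a s \<omega>) + (LINT s:{0..u}|lborel. kxx s (Z s \<omega>) / 2 * (b s \<omega>)\<^sup>2)"
        proof -
          note i = borel_integrable_atLeastAtMost'[OF continuous_adaptedD(3)[OF _ u(2) \<omega>]]
          show ?thesis unfolding a'_def
            using set_integral_add[OF set_integral_add(1)[OF i[OF ca(2)] i[OF kxa]] i[OF kxxb]]
              set_integral_add[OF i[OF ca(2)] i[OF kxa]] by simp
        qed
        show "left_sum b' u n \<omega> - (k u (Z u \<omega>) - k 0 (Z 0 \<omega>) - (LINT s:{0..u}|lborel. a' s \<omega>))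
        = - (E n \<omega> + ((\<Sum>i<n. kt (?p n i) (Z (?p n i) \<omega>) * (u / n)) - (LINT s:{0..u}|lborel. kt s (Z s \<omega>)))
          + ((\<Sum>i<n. kx (?p n i) (Z (?p n i) \<omega>) * (A (?p n (Suc i)) \<omega> - A (?p n i) \<omega>)) - (LINT s:{0..u}|lborel. kx s (Z s \<omega>) * a s \<omega>))
          + (\<Sum>i<n. kx (?p n i) (Z (?p n i) \<omega>) * ito_error b Y u n i \<omega>)
          + ((\<Sum>i<n. kxx (?p n i) (Z (?p n i) \<omega>) / 2 * (Z (?p n (Suc i)) \<omega> - Z (?p n i) \<omega>)\<^sup>2)
            - (LINT s:{0..u}|lborel. kxx s (Z s \<omega>) / 2 * (b s \<omega>)\<^sup>2)))"
          unfolding p_def[symmetric] E I K by linarith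
      qed
    qed
  qed
  from ito_decomposition_differential[OF this] show ?thesis unfolding a'_def b'_def .
qed

section \<open>Uniqueness of the It\^o decomposition\<close>

text \<open>Countably many rational times share one null set, and continuity of the paths extends
  the identity to all times.\<close>

lemma AE_all_times:
  fixes D :: "real \<Rightarrow> 'a \<Rightarrow> real"
  assumes cont: "\<And>\<omega>. \<omega> \<in> space P \<Longrightarrow> continuous_on {0..<T} (\<lambda>t. D t \<omega>)"
    and zero: "\<And>u. 0 \<le> u \<Longrightarrow> u < T \<Longrightarrow> AE \<omega> in P. D u \<omega> = 0"
  shows "AE \<omega> in P. \<forall>t\<in>{0..<T}. D t \<omega> = 0"
proof -
  have "AE \<omega> in P. \<forall>q\<in>\<rat> \<inter> {0..<T}. D q \<omega> = 0"
    using zero by (subst AE_ball_countable) (auto intro: countable_subset[OF _ countable_rat])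
  then show ?thesis
    using AE_space
  proof eventually_elim
    case (elim \<omega>)
    show ?case
    proof
      fix t assume "t \<in> {0..<T}"
      then show "D t \<omega> = 0"
        by (intro continuous_zero_from_rationals[OF cont[OF elim(2)], of t]) (use elim(1) in auto)
    qed
  qed
qed

text \<open>Integrands that agree give the same left sums on every grid, and limits in probability
  are almost surely unique.\<close>

lemma ito_integral_process_cong_AE:
  assumes Y: "ito_integral_process T b Y" and Y': "ito_integral_process T b' Y'"
    and eq: "AE \<omega> in P. \<forall>t\<in>{0..<T}. b t \<omega> = b' t \<omega>"
  shows "AE \<omega> in P. \<forall>t\<in>{0..<T}. Y t \<omega> - Y' t \<omega> = 0"
proof (rule AE_all_times)
  fix \<omega> assume "\<omega> \<in> space P"
  then show "continuous_on {0..<T} (\<lambda>t. Y t \<omega> - Y' t \<omega>)"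
    using Y Y' unfolding ito_integral_process_def continuous_adapted_def by (intro continuous_on_diff) simp_all
next
  fix u assume u: "0 \<le> u" "u < T"
  have n1: "null_in_prob P (\<lambda>n \<omega>. left_sum b u n \<omega> - Y u \<omega>)"
    using Y u unfolding ito_integral_process_def by simp
  have n2: "null_in_prob P (\<lambda>n \<omega>. left_sum b' u n \<omega> - Y' u \<omega>)"
    using Y' u unfolding ito_integral_process_def by simp
  from null_in_prob_diff[OF n2 n1]
  have "null_in_prob P (\<lambda>n \<omega>. Y u \<omega> - Y' u \<omega>)"
  proof (rule null_in_prob_AE_cong)
    fix n
    show "AE \<omega> in P. Y u \<omega> - Y' u \<omega> = left_sum b' u n \<omega> - Y' u \<omega> - (left_sum b u n \<omega> - Y u \<omega>)"
      using eq
    proof eventually_elim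
      case (elim \<omega>)
      have "b (grid u n i) \<omega> = b' (grid u n i) \<omega>" if "i < n" for i
        using elim grid_in[OF u(1), of i n] that u(2) by auto
      then have "left_sum b u n \<omega> = left_sum b' u n \<omega>" unfolding left_sum_def by simp
      then show ?case by simp
    qed
  qed
  then show "AE \<omega> in P. Y u \<omega> - Y' u \<omega> = 0" by (rule null_in_prob_const)
qed

text \<open>The difference of the two drift integrals is an It\^o integral of \<open>b - b'\<close> whose
  quadratic variation vanishes, because its paths are continuously differentiable.\<close>

theorem ito_decomposition_unique:
  assumes Z: "ito_decomposition T Z a b Y" and Z': "ito_decomposition T Z a' b' Y'"
  shows "AE \<omega> in P. \<forall>t\<in>{0..<T}. a t \<omega> = a' t \<omega> \<and> b t \<omega> = b' t \<omega>"
proof -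
  note D = ito_decompositionD[OF Z] and D' = ito_decompositionD[OF Z']
  define c where "c t \<omega> = (b t \<omega> - b' t \<omega>)\<^sup>2" for t \<omega>
  have c: "continuous_adapted T c"
    unfolding c_def by (intro continuous_adapted_power continuous_adapted_diff D(4) D'(4))
  have "AE \<omega> in P. (LINT s:{0..u}|lborel. c s \<omega>) = 0" if u: "0 \<le> u" "u < T" for u
  proof -
    let ?A = "\<lambda>a n i \<omega>. (LINT s:{0..grid u n (Suc i)}|lborel. a s \<omega>) - (LINT s:{0..grid u n i}|lborel. a s \<omega>)"
    have neg: "null_in_prob P (\<lambda>n \<omega>. \<Sum>i<n. (- x n i \<omega>)\<^sup>2)" if "null_in_prob P (\<lambda>n \<omega>. \<Sum>i<n. (x n i \<omega>)\<^sup>2)" for x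
      using that by simp
    \<comment> \<open>Both decompositions describe the same \<open>Z\<close>. Hence
      \<open>b - b'\<close> times a Wiener increment is a difference of drift increments plus a
      difference of errors, all with negligible square sums.\<close>
    have "null_in_prob P (\<lambda>n \<omega>. \<Sum>i<n. ((?A a' n i \<omega> + - ?A a n i \<omega>) + (ito_error b' Y' u n i \<omega> + - ito_error b Y u n i \<omega>))\<^sup>2)"
      by (rule null_in_prob_sum_squares_add[OF null_in_prob_sum_squares_add[OF drift_squares_null[OF D'(2) u] neg[OF drift_squares_null[OF D(2) u]]]
           null_in_prob_sum_squares_add[OF sum_ito_error_squares_null[OF D'(3) u] neg[OF sum_ito_error_squares_null[OF D(3) u]]]])
    then have 1: "null_in_prob P (\<lambda>n \<omega>. \<Sum>i<n. c (grid u n i) \<omega> * (incr W u n i \<omega>)\<^sup>2)"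
    proof (rule null_in_prob_cong)
      fix n \<omega> assume \<omega>: "\<omega> \<in> space P"
      show "(\<Sum>i<n. c (grid u n i) \<omega> * (incr W u n i \<omega>)\<^sup>2)
        = (\<Sum>i<n. ((?A a' n i \<omega> + - ?A a n i \<omega>) + (ito_error b' Y' u n i \<omega> + - ito_error b Y u n i \<omega>))\<^sup>2)"
      proof (rule sum.cong[OF refl])
        fix i assume "i \<in> {..<n}"
        then have i: "i < n" by simp
        let ?w = "W (grid u n (Suc i)) \<omega> - W (grid u n i) \<omega>"
        have "(?A a' n i \<omega> + - ?A a n i \<omega>) + (ito_error b' Y' u n i \<omega> + - ito_error b Y u n i \<omega>)
          = b (grid u n i) \<omega> * ?w - b' (grid u n i) \<omega> * ?w"
          using ito_decomposition_increment[OF Z u i \<omega>] ito_decomposition_increment[OF Z' u i \<omega>] by linarith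
        also have "\<dots> = (b (grid u n i) \<omega> - b' (grid u n i) \<omega>) * ?w" by (simp only: left_diff_distrib)
        finally have eq: "(?A a' n i \<omega> + - ?A a n i \<omega>) + (ito_error b' Y' u n i \<omega> + - ito_error b Y u n i \<omega>)
          = (b (grid u n i) \<omega> - b' (grid u n i) \<omega>) * ?w" .
        show "c (grid u n i) \<omega> * ?w\<^sup>2 = ((?A a' n i \<omega> + - ?A a n i \<omega>) + (ito_error b' Y' u n i \<omega> + - ito_error b Y u n i \<omega>))\<^sup>2"
          unfolding eq c_def power_mult_distrib ..
      qed
    qed
    have "null_in_prob P (\<lambda>n \<omega>. (LINT s:{0..u}|lborel. c s \<omega>))"
      using null_in_prob_diff[OF 1 wiener_quadratic_variation[OF c u]] by simp
    then show ?thesis by (rule null_in_prob_const)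
  qed
  then have "AE \<omega> in P. \<forall>t\<in>{0..<T}. (LINT s:{0..t}|lborel. c s \<omega>) = 0"
    using continuous_adapted_LINT[OF c] unfolding continuous_adapted_def by (intro AE_all_times) simp_all
  then have "AE \<omega> in P. \<forall>t\<in>{0..<T}. c t \<omega> = 0"
    using AE_space
  proof eventually_elim
    case (elim \<omega>)
    have "continuous_on {0..<T} (\<lambda>t. c t \<omega>)" using c elim(2) unfolding continuous_adapted_def by simp
    then show ?case
      by (intro ballI continuous_zero_of_integral_zero[where f="\<lambda>t. c t \<omega>"]) (use elim(1) in auto)
  qed
  then have b: "AE \<omega> in P. \<forall>t\<in>{0..<T}. b t \<omega> = b' t \<omega>" unfolding c_def by simp
  \<comment> \<open>Once \<open>b = b'\<close>, the stochastic parts agree, so the drift integrals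
    agree at all times and can be differentiated.\<close>
  have "AE \<omega> in P. \<forall>t\<in>{0..<T}. a t \<omega> - a' t \<omega> = 0"
    using ito_integral_process_cong_AE[OF D(3) D'(3) b] AE_space
  proof eventually_elim
    case (elim \<omega>)
    have aa: "continuous_adapted T (\<lambda>t \<omega>. a t \<omega> - a' t \<omega>)" by (rule continuous_adapted_diff[OF D(2) D'(2)])
    show ?case
    proof (intro ballI continuous_zero_of_integral_zero[where f="\<lambda>t. a t \<omega> - a' t \<omega>"])
      show "continuous_on {0..<T} (\<lambda>t. a t \<omega> - a' t \<omega>)" using aa elim(2) unfolding continuous_adapted_def by simp
      fix u assume u: "0 \<le> u" "u < T"
      note i = borel_integrable_atLeastAtMost'[OF continuous_adaptedD(3)[OF _ u(2) elim(2)]]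
      have "(LINT s:{0..u}|lborel. a s \<omega> - a' s \<omega>) = (LINT s:{0..u}|lborel. a s \<omega>) - (LINT s:{0..u}|lborel. a' s \<omega>)"
        by (rule set_integral_diff(2)[OF i[OF D(2)] i[OF D'(2)]])
      moreover have "Y u \<omega> - Y' u \<omega> = 0" using elim(1) u by simp
      ultimately show "(LINT s:{0..u}|lborel. a s \<omega> - a' s \<omega>) = 0"
        using D(6)[OF u elim(2)] D'(6)[OF u elim(2)] by linarith
    qed auto
  qed
  with b show ?thesis by eventually_elim simp
qed

lemma ito_decomposition_cong_AE:
  assumes Z: "ito_decomposition T Z a b Y" and Z': "ito_decomposition T Z' a' b' Y'"
    and eq: "AE \<omega> in P. \<forall>t\<in>{0..<T}. a t \<omega> = a' t \<omega> \<and> b t \<omega> = b' t \<omega>"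
  shows "AE \<omega> in P. \<forall>t\<in>{0..<T}. Z t \<omega> - Z 0 \<omega> = Z' t \<omega> - Z' 0 \<omega>"
proof -
  note D = ito_decompositionD[OF Z] and D' = ito_decompositionD[OF Z']
  have "AE \<omega> in P. \<forall>t\<in>{0..<T}. b t \<omega> = b' t \<omega>" using eq by eventually_elim simp
  from ito_integral_process_cong_AE[OF D(3) D'(3) this] eq AE_space
  show ?thesis
  proof eventually_elim
    case (elim \<omega>)
    show ?case
    proof
      fix t assume t: "t \<in> {0..<T}"
      have "(LINT s:{0..t}|lborel. a s \<omega>) = (LINT s:{0..t}|lborel. a' s \<omega>)"
        by (rule set_lebesgue_integral_cong) (use elim(2) t in auto)
      moreover have "Y t \<omega> - Y' t \<omega> = 0" using elim(1) t by simp
      ultimately show "Z t \<omega> - Z 0 \<omega> = Z' t \<omega> - Z' 0 \<omega>"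
        using D(6)[of t \<omega>] D'(6)[of t \<omega>] t elim(3) by simp
    qed
  qed
qed

end

section \<open>Change of coefficients, added drift, and uniqueness of the partial
  differential\<close>

context wiener_process
begin

lemma continuous_adapted_cong:
  assumes H: "continuous_adapted T H"
    and eq: "\<And>t \<omega>. 0 \<le> t \<Longrightarrow> t < T \<Longrightarrow> \<omega> \<in> space P \<Longrightarrow> H' t \<omega> = H t \<omega>"
  shows "continuous_adapted T H'"
  unfolding continuous_adapted_def
proof (intro conjI ballI)
  fix t assume t: "t \<in> {0..<T}"
  have "H t \<in> borel_measurable (F t) \<longleftrightarrow> H' t \<in> borel_measurable (F t)"
    by (rule measurable_cong) (use eq t in \<open>simp add: space_F\<close>)
  then show "H' t \<in> borel_measurable (F t)" using continuous_adaptedD(1)[OF H, of t] t by simp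
next
  fix \<omega> assume \<omega>: "\<omega> \<in> space P"
  then have "continuous_on {0..<T} (\<lambda>t. H t \<omega>)" using H unfolding continuous_adapted_def by simp
  then show "continuous_on {0..<T} (\<lambda>t. H' t \<omega>)"
    by (rule continuous_on_eq) (use eq \<omega> in simp)
qed

lemma ito_decomposition_cong:
  assumes X: "ito_decomposition T X a b Y"
    and eq: "\<And>t \<omega>. 0 \<le> t \<Longrightarrow> t < T \<Longrightarrow> \<omega> \<in> space P \<Longrightarrow> a' t \<omega> = a t \<omega> \<and> b' t \<omega> = b t \<omega>"
  shows "ito_decomposition T X a' b' Y"
proof -
  note D = ito_decompositionD[OF X]
  have ls: "left_sum b' u n \<omega> = left_sum b u n \<omega>" if "0 \<le> u" "u < T" "\<omega> \<in> space P" for u n \<omega>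
    unfolding left_sum_def
  proof (rule sum.cong[OF refl])
    fix i assume "i \<in> {..<n}"
    then have "grid u n i \<in> {0..u}" using grid_in[OF that(1), of i n] by simp
    then show "b' (grid u n i) \<omega> * (incr W u n i \<omega>)
      = b (grid u n i) \<omega> * (incr W u n i \<omega>)"
      using eq that by simp
  qed
  have "continuous_adapted T a'" "continuous_adapted T b'"
    by (rule continuous_adapted_cong[OF D(2)] continuous_adapted_cong[OF D(4)]; use eq in simp)+
  moreover have "null_in_prob P (\<lambda>n \<omega>. left_sum b' u n \<omega> - Y u \<omega>)" if "0 \<le> u" "u < T" for u
    by (rule null_in_prob_cong[OF D(5)[OF that]]) (simp add: ls[OF that])
  moreover have "(LINT s:{0..t}|lborel. a' s \<omega>) = (LINT s:{0..t}|lborel. a s \<omega>)" if "0 \<le> t" "t < T" "\<omega> \<in> space P" for t \<omega>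
    by (rule set_lebesgue_integral_cong) (use eq that in auto)
  then have "X t \<omega> = X 0 \<omega> + (LINT s:{0..t}|lborel. a' s \<omega>) + Y t \<omega>" if "0 \<le> t" "t < T" "\<omega> \<in> space P" for t \<omega>
    using D(6)[OF that] that by (simp only:)
  ultimately show ?thesis
    using X unfolding ito_decomposition_def ito_integral_process_def by blast
qed

text \<open>Made for \<open>ln M\<close>, which is \<open>ln L\<close> plus a constant and an
  integral of \<open>- r\<close>: the stochastic part stays the same, so no product rule for
  \<open>M\<close> has to be derived.\<close>

lemma ito_decomposition_add_drift:
  assumes Z: "ito_decomposition T Z a b Y" and h: "continuous_adapted T h"
    and X: "\<And>t \<omega>. 0 \<le> t \<Longrightarrow> t < T \<Longrightarrow> \<omega> \<in> space P \<Longrightarrow> X t \<omega> = c + (LINT s:{0..t}|lborel. h s \<omega>) + Z t \<omega>"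
  shows "ito_decomposition T X (\<lambda>t \<omega>. h t \<omega> + a t \<omega>) b Y"
proof -
  note D = ito_decompositionD[OF Z]
  have "continuous_adapted T (\<lambda>t \<omega>. c + (LINT s:{0..t}|lborel. h s \<omega>) + Z t \<omega>)"
    by (intro continuous_adapted_add continuous_adapted_const continuous_adapted_LINT[OF h] D(1))
  then have "continuous_adapted T X" by (rule continuous_adapted_cong) (rule X)
  moreover have "X t \<omega> = X 0 \<omega> + (LINT s:{0..t}|lborel. h s \<omega> + a s \<omega>) + Y t \<omega>" if t: "0 \<le> t" "t < T" "\<omega> \<in> space P" for t \<omega>
  proof -
    note i = borel_integrable_atLeastAtMost'[OF continuous_adaptedD(3)[OF _ t(2,3)]]
    have "(LINT s:{0..t}|lborel. h s \<omega> + a s \<omega>) = (LINT s:{0..t}|lborel. h s \<omega>) + (LINT s:{0..t}|lborel. a s \<omega>)"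
      by (rule set_integral_add(2)[OF i[OF h] i[OF D(2)]])
    moreover have "(LINT s:{0..0}|lborel. h s \<omega>) = 0" by (subst LINT_continuous) auto
    ultimately show ?thesis using X[OF t] X[of 0 \<omega>] D(6)[OF t] t by simp
  qed
  ultimately show ?thesis
    unfolding ito_decomposition_def using continuous_adapted_add[OF h D(2)] D(3) by blast
qed

text \<open>Uniqueness holds simultaneously for a countable dense set of parameters, hence, by joint
  continuity of the coefficients, for all parameters, in particular for the random one.\<close>

theorem partial_differential_unique:
  fixes k :: "'x \<Rightarrow> 'y::{metric_space, second_countable_topology} \<Rightarrow> real"
  assumes A: "has_partial_differential P F W T k E \<Xi> \<Upsilon> A"
    and A': "has_partial_differential P F W T k E \<Xi> \<Upsilon> A'"
    and \<Upsilon>: "\<And>t \<omega>. 0 \<le> t \<Longrightarrow> t < T \<Longrightarrow> \<omega> \<in> space P \<Longrightarrow> \<Upsilon> t \<omega> \<in> E"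
      "\<And>\<omega>. \<omega> \<in> space P \<Longrightarrow> continuous_on {0..<T} (\<lambda>t. \<Upsilon> t \<omega>)"
  shows "AE \<omega> in P. \<forall>t\<in>{0..<T}. A t \<omega> - A 0 \<omega> = A' t \<omega> - A' 0 \<omega>"
proof -
  obtain a b where ab: "\<And>\<omega>. \<omega> \<in> space P \<Longrightarrow> continuous_on ({0..<T} \<times> E) (\<lambda>(t, y). a y t \<omega>)"
    "\<And>\<omega>. \<omega> \<in> space P \<Longrightarrow> continuous_on ({0..<T} \<times> E) (\<lambda>(t, y). b y t \<omega>)"
    "\<And>y. y \<in> E \<Longrightarrow> has_ito_differential P F W 0 T (\<lambda>t \<omega>. k (\<Xi> t \<omega>) y) (a y) (b y)"
    "has_ito_differential P F W 0 T A (\<lambda>t \<omega>. a (\<Upsilon> t \<omega>) t \<omega>) (\<lambda>t \<omega>. b (\<Upsilon> t \<omega>) t \<omega>)"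
    using A unfolding has_partial_differential_def by blast
  obtain a' b' where ab': "\<And>\<omega>. \<omega> \<in> space P \<Longrightarrow> continuous_on ({0..<T} \<times> E) (\<lambda>(t, y). a' y t \<omega>)"
    "\<And>\<omega>. \<omega> \<in> space P \<Longrightarrow> continuous_on ({0..<T} \<times> E) (\<lambda>(t, y). b' y t \<omega>)"
    "\<And>y. y \<in> E \<Longrightarrow> has_ito_differential P F W 0 T (\<lambda>t \<omega>. k (\<Xi> t \<omega>) y) (a' y) (b' y)"
    "has_ito_differential P F W 0 T A' (\<lambda>t \<omega>. a' (\<Upsilon> t \<omega>) t \<omega>) (\<lambda>t \<omega>. b' (\<Upsilon> t \<omega>) t \<omega>)"
    using A' unfolding has_partial_differential_def by blast
  have slice: "continuous_on {0..<T} (\<lambda>t. g y t \<omega>)"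
    if "continuous_on ({0..<T} \<times> E) (\<lambda>(t, y). g y t \<omega>)" "y \<in> E" for g :: "'y \<Rightarrow> real \<Rightarrow> 'a \<Rightarrow> real" and y \<omega>
  proof -
    have c: "continuous_on {0..<T} (\<lambda>t. (t, y))" by (intro continuous_intros)
    have "(\<lambda>t. (t, y)) ` {0..<T} \<subseteq> {0..<T} \<times> E" using that(2) by auto
    from continuous_on_compose2[OF that(1) c this] show ?thesis by simp
  qed
  have path: "continuous_on {0..<T} (\<lambda>t. g (\<Upsilon> t \<omega>) t \<omega>)"
    if "continuous_on ({0..<T} \<times> E) (\<lambda>(t, y). g y t \<omega>)" "\<omega> \<in> space P" for g :: "'y \<Rightarrow> real \<Rightarrow> 'a \<Rightarrow> real" and \<omega>
  proof -
    have c: "continuous_on {0..<T} (\<lambda>t. (t, \<Upsilon> t \<omega>))" by (intro continuous_on_Pair continuous_on_id \<Upsilon>(2)[OF that(2)])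
    have "(\<lambda>t. (t, \<Upsilon> t \<omega>)) ` {0..<T} \<subseteq> {0..<T} \<times> E" using \<Upsilon>(1) that(2) by auto
    from continuous_on_compose2[OF that(1) c this] show ?thesis by simp
  qed
  obtain D where D: "countable D" "D \<subseteq> E" "E \<subseteq> closure D" by (rule separable)
  have "AE \<omega> in P. \<forall>y\<in>D. \<forall>t\<in>{0..<T}. a y t \<omega> = a' y t \<omega> \<and> b y t \<omega> = b' y t \<omega>"
  proof (subst AE_ball_countable[OF D(1)], rule ballI)
    fix y assume "y \<in> D"
    then have y: "y \<in> E" using D(2) by auto
    note d = ito_differential_decomposition[OF ab(3)[OF y]] and d' = ito_differential_decomposition[OF ab'(3)[OF y]]
    have "ito_decomposition T (\<lambda>t \<omega>. k (\<Xi> t \<omega>) y) (a y) (b y)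
        (\<lambda>t \<omega>. k (\<Xi> t \<omega>) y - k (\<Xi> 0 \<omega>) y - (LINT s:{0..t}|lborel. a y s \<omega>))"
      by (rule d) (rule slice[OF ab(1) y] slice[OF ab(2) y], assumption)+
    moreover have "ito_decomposition T (\<lambda>t \<omega>. k (\<Xi> t \<omega>) y) (a' y) (b' y)
        (\<lambda>t \<omega>. k (\<Xi> t \<omega>) y - k (\<Xi> 0 \<omega>) y - (LINT s:{0..t}|lborel. a' y s \<omega>))"
      by (rule d') (rule slice[OF ab'(1) y] slice[OF ab'(2) y], assumption)+
    ultimately show "AE \<omega> in P. \<forall>t\<in>{0..<T}. a y t \<omega> = a' y t \<omega> \<and> b y t \<omega> = b' y t \<omega>"
      by (rule ito_decomposition_unique)
  qed
  then have eq: "AE \<omega> in P. \<forall>t\<in>{0..<T}. a (\<Upsilon> t \<omega>) t \<omega> = a' (\<Upsilon> t \<omega>) t \<omega> \<and> b (\<Upsilon> t \<omega>) t \<omega> = b' (\<Upsilon> t \<omega>) t \<omega>"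
    using AE_space
  proof eventually_elim
    case (elim \<omega>)
    have ext: "g y t \<omega> = g' y t \<omega>"
      if g: "continuous_on ({0..<T} \<times> E) (\<lambda>(t, y). g y t \<omega>)" "continuous_on ({0..<T} \<times> E) (\<lambda>(t, y). g' y t \<omega>)"
        and e: "\<And>y. y \<in> D \<Longrightarrow> g y t \<omega> = g' y t \<omega>" and y: "y \<in> E" and t: "t \<in> {0..<T}"
      for g g' :: "'y \<Rightarrow> real \<Rightarrow> 'a \<Rightarrow> real" and y t
    proof -
      obtain x where x: "\<And>n. x n \<in> D" "x \<longlonglongrightarrow> y"
        using y D(3) unfolding closure_sequential by (auto simp: subset_iff closure_sequential)
      have lim: "(\<lambda>n. (t, x n)) \<longlonglongrightarrow> (t, y)" by (intro tendsto_Pair tendsto_const x(2))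
      have "x n \<in> E" for n using subsetD[OF D(2) x(1)] .
      then have ty: "(t, y) \<in> {0..<T} \<times> E" "eventually (\<lambda>n. (t, x n) \<in> {0..<T} \<times> E) sequentially"
        using t y by simp_all
      have "(\<lambda>n. g (x n) t \<omega>) \<longlonglongrightarrow> g y t \<omega>"
        using continuous_on_tendsto_compose[OF g(1) lim ty] by simp
      moreover have "(\<lambda>n. g (x n) t \<omega>) \<longlonglongrightarrow> g' y t \<omega>"
        using continuous_on_tendsto_compose[OF g(2) lim ty] e[OF x(1)] by simp
      ultimately show ?thesis by (rule LIMSEQ_unique)
    qed
    show ?case
    proof (intro ballI conjI)
      fix t assume t: "t \<in> {0..<T}"
      then have y: "\<Upsilon> t \<omega> \<in> E" using \<Upsilon>(1) elim(2) by simp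
      show "a (\<Upsilon> t \<omega>) t \<omega> = a' (\<Upsilon> t \<omega>) t \<omega>"
        by (rule ext[of a a', OF ab(1)[OF elim(2)] ab'(1)[OF elim(2)] _ y t]) (use elim(1) t in simp)
      show "b (\<Upsilon> t \<omega>) t \<omega> = b' (\<Upsilon> t \<omega>) t \<omega>"
        by (rule ext[of b b', OF ab(2)[OF elim(2)] ab'(2)[OF elim(2)] _ y t]) (use elim(1) t in simp)
    qed
  qed
  have "ito_decomposition T A (\<lambda>t \<omega>. a (\<Upsilon> t \<omega>) t \<omega>) (\<lambda>t \<omega>. b (\<Upsilon> t \<omega>) t \<omega>)
      (\<lambda>t \<omega>. A t \<omega> - A 0 \<omega> - (LINT s:{0..t}|lborel. a (\<Upsilon> s \<omega>) s \<omega>))"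
  proof (rule ito_differential_decomposition[OF ab(4)])
    fix \<omega> assume \<omega>: "\<omega> \<in> space P"
    show "continuous_on {0..<T} (\<lambda>t. a (\<Upsilon> t \<omega>) t \<omega>)" by (rule path[of a \<omega>, OF ab(1)[OF \<omega>] \<omega>])
    show "continuous_on {0..<T} (\<lambda>t. b (\<Upsilon> t \<omega>) t \<omega>)" by (rule path[of b \<omega>, OF ab(2)[OF \<omega>] \<omega>])
  qed
  moreover have "ito_decomposition T A' (\<lambda>t \<omega>. a' (\<Upsilon> t \<omega>) t \<omega>) (\<lambda>t \<omega>. b' (\<Upsilon> t \<omega>) t \<omega>)
      (\<lambda>t \<omega>. A' t \<omega> - A' 0 \<omega> - (LINT s:{0..t}|lborel. a' (\<Upsilon> s \<omega>) s \<omega>))"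
  proof (rule ito_differential_decomposition[OF ab'(4)])
    fix \<omega> assume \<omega>: "\<omega> \<in> space P"
    show "continuous_on {0..<T} (\<lambda>t. a' (\<Upsilon> t \<omega>) t \<omega>)" by (rule path[of a' \<omega>, OF ab'(1)[OF \<omega>] \<omega>])
    show "continuous_on {0..<T} (\<lambda>t. b' (\<Upsilon> t \<omega>) t \<omega>)" by (rule path[of b' \<omega>, OF ab'(2)[OF \<omega>] \<omega>])
  qed
  ultimately show ?thesis using eq by (rule ito_decomposition_cong_AE)
qed

end

section \<open>The market equilibrium\<close>

context market_equilibrium
begin

text \<open>Together with \<open>sup_attained\<close> this makes \<open>(u_hat, c_hat)\<close> a
  maximiser, from which both first order conditions follow.\<close>

lemma A_nonpos:
  assumes tx: "(t, x) \<in> state_space T" and uc: "0 \<le> u" "0 \<le> c"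
  shows "U t x t c + A u c t x t x \<le> 0"
proof -
  have "ereal (U t x t c + A u c t x t x) \<le> (SUP (u, c) \<in> {0..} \<times> {0..}. ereal (U t x t c + A u c t x t x))"
    by (rule SUP_upper2[of "(u, c)"]) (use uc in auto)
  then show ?thesis unfolding sup_eq_0[OF tx] by simp
qed

text \<open>The first order condition for \<open>u\<close> at \<open>u_hat = 1\<close>, divided by
  \<open>x > 0\<close>.\<close>

lemma short_rate:
  assumes tx: "(t, x) \<in> state_space T"
  shows "(r t x - \<alpha>) * fx t x t x = \<sigma>\<^sup>2 * x * fxx t x t x"
proof -
  have x: "x > 0" using tx by (simp add: state_space_def)
  have u1: "u_hat t x = 1" and c0: "c_hat t x > 0" using market_clearing[OF tx] interior[OF tx] by auto
  let ?h = "\<lambda>u. U t x t (c_hat t x) + A u (c_hat t x) t x t x"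
  have "(?h has_real_derivative x * (\<alpha> - r t x) * fx t x t x + x\<^sup>2 * \<sigma>\<^sup>2 * fxx t x t x) (at 1)"
    unfolding A_def by (auto intro!: derivative_eq_intros simp: power2_eq_square)
  \<comment> \<open>Radius 1 around 1 stays inside the admissible set
    \<open>u \<ge> 0\<close>.\<close>
  moreover have "\<forall>y. \<bar>1 - y\<bar> < 1 \<longrightarrow> ?h y \<le> ?h 1"
    using A_nonpos[OF tx _ less_imp_le[OF c0]] sup_attained[OF tx] u1 by auto
  ultimately have "x * (\<alpha> - r t x) * fx t x t x + x\<^sup>2 * \<sigma>\<^sup>2 * fxx t x t x = 0"
    by (intro DERIV_local_max[of ?h _ 1 1]) auto
  then have "x * ((r t x - \<alpha>) * fx t x t x - \<sigma>\<^sup>2 * x * fxx t x t x) = 0"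
    by (simp add: power2_eq_square algebra_simps)
  then show ?thesis using x by simp
qed

text \<open>The first order condition for \<open>c\<close>, which enters \<open>A\<close> only
  through \<open>- c * fx\<close>; the maximum is compared on the interval of radius
  \<open>c_hat t x\<close>, where consumption is positive.\<close>

lemma marginal_utility:
  assumes tx: "(t, x) \<in> state_space T"
  shows "Uc t x t (c_hat t x) = fx t x t x"
proof -
  have c0: "c_hat t x > 0" "t \<in> {0..<T}" "u_hat t x > 0" using interior[OF tx] tx by (auto simp: state_space_def)
  let ?h = "\<lambda>c. U t x t c + A (u_hat t x) c t x t x"
  have "(?h has_real_derivative Uc t x t (c_hat t x) - fx t x t x) (at (c_hat t x))"
    unfolding A_def by (auto intro!: derivative_eq_intros U_c tx c0)
  moreover have "\<forall>y. \<bar>c_hat t x - y\<bar> < c_hat t x \<longrightarrow> ?h y \<le> ?h (c_hat t x)"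
    using A_nonpos[OF tx less_imp_le[OF c0(3)]] sup_attained[OF tx] by auto
  ultimately have "Uc t x t (c_hat t x) - fx t x t x = 0"
    using c0(1) by (intro DERIV_local_max[of ?h _ "c_hat t x" "c_hat t x"]) auto
  then show ?thesis by simp
qed

text \<open>The derivative in \<open>x\<close> of the value equation at fixed \<open>(s, y)\<close>, taken at \<open>(s, y) = (t, x)\<close>; the
  terms with the derivative of \<open>c_hat\<close> cancel by the first order condition for consumption.\<close>

lemma marginal_value_equation:
  assumes tx: "(t, x) \<in> state_space T"
  shows "ftx t x t x + fxx t x t x * (\<alpha> * x - c_hat t x) + fxxx t x t x / 2 * (x * \<sigma>)\<^sup>2 = - r t x * fx t x t x"
proof -
  have x: "x > 0" "t \<in> {0..<T}" using tx by (auto simp: state_space_def)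
  have c0: "c_hat t x > 0" using interior[OF tx] by simp
  obtain c' where c': "((\<lambda>x. c_hat t x) has_real_derivative c') (at x)"
    using c_hat_differentiable[OF tx] by (auto simp: real_differentiable_def)
  \<comment> \<open>With \<open>u_hat = 1\<close> the terms in \<open>r\<close> cancel at every
    \<open>z\<close>, so nothing unknown about \<open>r\<close> is differentiated. The value
    equation says that \<open>?V\<close> vanishes on all positive \<open>z\<close>, with the
    parameters held at \<open>(t, x)\<close>.\<close>
  let ?V = "\<lambda>z. ft t z t x + (\<alpha> * z - c_hat t z) * fx t z t x + 1 / 2 * z\<^sup>2 * \<sigma>\<^sup>2 * fxx t z t x + U t x t (c_hat t z)"
  have "((\<lambda>z. U t x t (c_hat t z)) has_real_derivative Uc t x t (c_hat t x) * c') (at x)"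
    by (rule DERIV_chain2[OF U_c[OF tx x(2) c0] c'])
  then have "(?V has_real_derivative ftx t x t x + ((\<alpha> - c') * fx t x t x + fxx t x t x * (\<alpha> * x - c_hat t x))
      + (x * \<sigma>\<^sup>2 * fxx t x t x + fxxx t x t x * (1 / 2 * x\<^sup>2 * \<sigma>\<^sup>2)) + Uc t x t (c_hat t x) * c') (at x)"
    by (auto intro!: derivative_eq_intros f_tx[OF tx tx] f_x[OF tx tx] f_xx[OF tx tx] f_xxx[OF tx tx] c')
  moreover have "(?V has_real_derivative 0) (at x)"
  proof (rule has_field_derivative_transform_within_open[where f="\<lambda>_. 0" and S="{0<..}"])
    fix z :: real assume "z \<in> {0<..}"
    then have tz: "(t, z) \<in> state_space T" using x by (simp add: state_space_def)
    from value_equation[OF tz tx] market_clearing[OF tz] show "0 = ?V z"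
      unfolding A_def by (simp add: algebra_simps)
  qed (use x in auto)
  ultimately have "ftx t x t x + ((\<alpha> - c') * fx t x t x + fxx t x t x * (\<alpha> * x - c_hat t x))
      + (x * \<sigma>\<^sup>2 * fxx t x t x + fxxx t x t x * (1 / 2 * x\<^sup>2 * \<sigma>\<^sup>2)) + Uc t x t (c_hat t x) * c' = 0"
    by (rule DERIV_unique)
  \<comment> \<open>\<open>marginal_utility\<close> removes the terms with \<open>c'\<close>, and
    \<open>short_rate\<close> combines \<open>\<alpha> * fx + x * \<sigma>\<^sup>2 * fxx\<close>
    into \<open>r * fx\<close>.\<close>
  then show ?thesis
    using short_rate[OF tx] marginal_utility[OF tx] by (simp add: power2_eq_square algebra_simps)
qed

text \<open>The drift that Ito's formula gives to \<open>ln fx\<close> at fixed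
  \<open>(s, y)\<close>, with the equilibrium wealth drift \<open>\<alpha> * x - c_hat t x\<close>
  and volatility \<open>x * \<sigma>\<close> inserted.\<close>

definition lnfx_drift :: "real \<Rightarrow> real \<Rightarrow> real \<Rightarrow> real \<Rightarrow> real" where
  "lnfx_drift t x s y = ftx t x s y / fx t x s y + fxx t x s y / fx t x s y * (\<alpha> * x - c_hat t x)
     + (fxxx t x s y / fx t x s y - (fxx t x s y / fx t x s y)\<^sup>2) / 2 * (x * \<sigma>)\<^sup>2"

definition lnfx_vol :: "real \<Rightarrow> real \<Rightarrow> real \<Rightarrow> real \<Rightarrow> real" where
  "lnfx_vol t x s y = fxx t x s y / fx t x s y * (x * \<sigma>)"

lemma lnfx_derivatives:
  assumes "(t, x) \<in> state_space T" "(s, y) \<in> state_space T"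
  shows "((\<lambda>t. ln (fx t x s y)) has_real_derivative ftx t x s y / fx t x s y) (at t within {0..<T})"
    and "((\<lambda>x. ln (fx t x s y)) has_real_derivative fxx t x s y / fx t x s y) (at x)"
    and "((\<lambda>x. fxx t x s y / fx t x s y) has_real_derivative
      fxxx t x s y / fx t x s y - (fxx t x s y / fx t x s y)\<^sup>2) (at x)"
proof -
  have pos: "fx t x s y > 0" using fx_pos[OF assms] .
  show "((\<lambda>t. ln (fx t x s y)) has_real_derivative ftx t x s y / fx t x s y) (at t within {0..<T})"
    using DERIV_chain2[OF DERIV_ln[OF pos] f_xt[OF assms]] by (simp add: field_simps)
  show "((\<lambda>x. ln (fx t x s y)) has_real_derivative fxx t x s y / fx t x s y) (at x)"
    using DERIV_chain2[OF DERIV_ln[OF pos] f_xx[OF assms]] by (simp add: field_simps)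
  have "((\<lambda>x. fxx t x s y / fx t x s y) has_real_derivative
      (fxxx t x s y * fx t x s y - fxx t x s y * fxx t x s y) / (fx t x s y * fx t x s y)) (at x)"
    by (rule DERIV_divide[OF f_xxx[OF assms] f_xx[OF assms]]) (use pos in simp)
  moreover have "(fxxx t x s y * fx t x s y - fxx t x s y * fxx t x s y) / (fx t x s y * fx t x s y)
      = fxxx t x s y / fx t x s y - (fxx t x s y / fx t x s y)\<^sup>2"
    using pos by (simp add: diff_divide_distrib power_divide power2_eq_square)
  ultimately show "((\<lambda>x. fxx t x s y / fx t x s y) has_real_derivative
      fxxx t x s y / fx t x s y - (fxx t x s y / fx t x s y)\<^sup>2) (at x)" by simp
qed

lemma lnfx_continuous:
  "continuous_on (state_space T \<times> state_space T) (\<lambda>((t, x), (s, y)). ln (fx t x s y))"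
  "continuous_on (state_space T \<times> state_space T) (\<lambda>((t, x), (s, y)). ftx t x s y / fx t x s y)"
  "continuous_on (state_space T \<times> state_space T) (\<lambda>((t, x), (s, y)). fxx t x s y / fx t x s y)"
  "continuous_on (state_space T \<times> state_space T) (\<lambda>((t, x), (s, y)). fxxx t x s y / fx t x s y - (fxx t x s y / fx t x s y)\<^sup>2)"
  "continuous_on (state_space T \<times> state_space T) (\<lambda>((t, x), (s, y)). lnfx_drift t x s y)"
  "continuous_on (state_space T \<times> state_space T) (\<lambda>((t, x), (s, y)). lnfx_vol t x s y)"
proof -
  let ?S = "state_space T \<times> state_space T"
  note c = continuous_derivatives[of fx] continuous_derivatives[of fxx] continuous_derivatives[of fxxx] continuous_derivatives[of ftx]
  have cont: "continuous_on ?S (\<lambda>p. fx (fst (fst p)) (snd (fst p)) (fst (snd p)) (snd (snd p)))"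
    "continuous_on ?S (\<lambda>p. fxx (fst (fst p)) (snd (fst p)) (fst (snd p)) (snd (snd p)))"
    "continuous_on ?S (\<lambda>p. fxxx (fst (fst p)) (snd (fst p)) (fst (snd p)) (snd (snd p)))"
    "continuous_on ?S (\<lambda>p. ftx (fst (fst p)) (snd (fst p)) (fst (snd p)) (snd (snd p)))"
    using c by (simp_all add: case_prod_beta)
  have pos: "fx (fst (fst p)) (snd (fst p)) (fst (snd p)) (snd (snd p)) > 0" if "p \<in> ?S" for p
    using that by (intro fx_pos) (auto simp: mem_Times_iff)
  have chat: "continuous_on ?S (\<lambda>p. c_hat (fst (fst p)) (snd (fst p)))"
    using continuous_on_compose2[OF c_hat_continuous continuous_on_fst[OF continuous_on_id], of ?S]
    by (simp add: case_prod_beta image_subset_iff mem_Times_iff)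
  have nz: "\<forall>p\<in>?S. fx (fst (fst p)) (snd (fst p)) (fst (snd p)) (snd (snd p)) \<noteq> 0" using pos by force
  have proj: "continuous_on ?S (\<lambda>p. snd (fst p))" by (intro continuous_intros)
  show "continuous_on ?S (\<lambda>((t, x), (s, y)). ln (fx t x s y))"
    unfolding case_prod_beta by (rule continuous_on_ln[OF cont(1) nz])
  show 1: "continuous_on ?S (\<lambda>((t, x), (s, y)). ftx t x s y / fx t x s y)"
    unfolding case_prod_beta by (rule continuous_on_divide[OF cont(4,1) nz])
  show 2: "continuous_on ?S (\<lambda>((t, x), (s, y)). fxx t x s y / fx t x s y)"
    unfolding case_prod_beta by (rule continuous_on_divide[OF cont(2,1) nz])
  show 3: "continuous_on ?S (\<lambda>((t, x), (s, y)). fxxx t x s y / fx t x s y - (fxx t x s y / fx t x s y)\<^sup>2)"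
    unfolding case_prod_beta
    by (rule continuous_on_diff[OF continuous_on_divide[OF cont(3,1) nz] continuous_on_power[OF continuous_on_divide[OF cont(2,1) nz]]])
  show "continuous_on ?S (\<lambda>((t, x), (s, y)). lnfx_vol t x s y)"
    unfolding lnfx_vol_def using 2 proj unfolding case_prod_beta by (intro continuous_on_mult continuous_on_const)
  show "continuous_on ?S (\<lambda>((t, x), (s, y)). lnfx_drift t x s y)"
    unfolding lnfx_drift_def unfolding case_prod_beta
    by (rule continuous_on_add[OF continuous_on_add[OF 1[unfolded case_prod_beta]
          continuous_on_mult[OF 2[unfolded case_prod_beta] continuous_on_diff[OF continuous_on_mult[OF continuous_on_const proj] chat]]]
        continuous_on_mult[OF continuous_on_divide[OF 3[unfolded case_prod_beta] continuous_on_const]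
          continuous_on_power[OF continuous_on_mult[OF proj continuous_on_const]]]]) simp
qed

text \<open>On the diagonal the first order condition reads
  \<open>r = \<alpha> + \<sigma> * lnfx_vol\<close>, so \<open>r\<close> inherits continuity from
  the derivatives of \<open>f\<close>.\<close>

lemma short_rate_continuous: "continuous_on (state_space T) (\<lambda>(t, x). r t x)"
proof -
  have "continuous_on (state_space T) (\<lambda>p. (p, p))" by (intro continuous_on_Pair continuous_on_id)
  from continuous_on_compose2[OF lnfx_continuous(6) this]
  have "continuous_on (state_space T) (\<lambda>p. lnfx_vol (fst p) (snd p) (fst p) (snd p))"
    by (simp add: case_prod_beta image_subset_iff)
  then have "continuous_on (state_space T) (\<lambda>p. \<alpha> + \<sigma> * lnfx_vol (fst p) (snd p) (fst p) (snd p))"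
    by (intro continuous_on_add continuous_on_mult continuous_on_const)
  then show ?thesis
  proof (rule continuous_on_eq)
    fix p assume "p \<in> state_space T"
    then have "(fst p, snd p) \<in> state_space T" by simp
    from short_rate[OF this] fx_pos[OF this this]
    show "\<alpha> + \<sigma> * lnfx_vol (fst p) (snd p) (fst p) (snd p) = (case p of (t, x) \<Rightarrow> r t x)"
      by (simp add: lnfx_vol_def case_prod_beta field_simps power2_eq_square)
  qed
qed

text \<open>The volatility comes from the first order condition after cancelling
  \<open>\<sigma>\<close>. The drift is the differentiated value equation divided by
  \<open>fx\<close>, which gives \<open>- r\<close>, less half the squared volatility contributed by
  the logarithm.\<close>

lemma girsanov_kernel:
  assumes "(t, x) \<in> state_space T" "r t x = \<alpha> + \<phi> * \<sigma>"
  shows "lnfx_vol t x t x = \<phi>" and "lnfx_drift t x t x = - r t x - \<phi>\<^sup>2 / 2"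
proof -
  have pos: "fx t x t x > 0" using fx_pos[OF assms(1,1)] .
  have "\<sigma> * (\<phi> * fx t x t x) = \<sigma> * (\<sigma> * x * fxx t x t x)"
    using short_rate[OF assms(1)] unfolding assms(2) by (simp add: power2_eq_square mult.assoc mult.left_commute)
  then have "\<phi> * fx t x t x = \<sigma> * x * fxx t x t x" using sigma_nonzero by simp
  then show vol: "lnfx_vol t x t x = \<phi>"
    using pos by (simp add: lnfx_vol_def field_simps)
  have "lnfx_drift t x t x = (ftx t x t x + fxx t x t x * (\<alpha> * x - c_hat t x) + fxxx t x t x / 2 * (x * \<sigma>)\<^sup>2) / fx t x t x
      - (lnfx_vol t x t x)\<^sup>2 / 2"
    using pos by (simp add: lnfx_drift_def lnfx_vol_def power2_eq_square divide_simps) (simp add: algebra_simps)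
  then show "lnfx_drift t x t x = - r t x - \<phi>\<^sup>2 / 2"
    unfolding marginal_value_equation[OF assms(1)] vol using pos by simp
qed

section \<open>Equilibrium wealth and the differential of the logarithm of \<open>fx\<close>\<close>

lemma wealth_state:
  assumes "wealth_process P F W T \<alpha> \<sigma> r u_hat c_hat 0 x0 X" "0 \<le> t" "t < T" "\<omega> \<in> space P"
  shows "(t, X t \<omega>) \<in> state_space T"
  using assms unfolding wealth_process_def state_space_def by simp

lemma wealth_path:
  assumes X: "wealth_process P F W T \<alpha> \<sigma> r u_hat c_hat 0 x0 X" and \<omega>: "\<omega> \<in> space P"
  shows "continuous_on {0..<T} (\<lambda>t. (t, X t \<omega>))"
  using assms unfolding wealth_process_def has_ito_differential_def by (intro continuous_on_Pair continuous_on_id) simp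

lemma wealth_path_compose:
  assumes X: "wealth_process P F W T \<alpha> \<sigma> r u_hat c_hat 0 x0 X" and \<omega>: "\<omega> \<in> space P"
    and g: "continuous_on (state_space T) (\<lambda>(t, x). g t x)"
  shows "continuous_on {0..<T} (\<lambda>t. g t (X t \<omega>))"
proof -
  have "(\<lambda>t. (t, X t \<omega>)) ` {0..<T} \<subseteq> state_space T" using wealth_state[OF X _ _ \<omega>] by auto
  from continuous_on_compose2[OF g wealth_path[OF X \<omega>] this] show ?thesis by simp
qed

lemma wealth_continuous_adapted:
  assumes X: "wealth_process P F W T \<alpha> \<sigma> r u_hat c_hat 0 x0 X"
    and g: "continuous_on (state_space T) (\<lambda>(t, x). g t x)"
  shows "continuous_adapted T (\<lambda>t \<omega>. g t (X t \<omega>))"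
proof (rule continuous_adapted_compose[where J="{0<..}" and H=X and g=g])
  show "continuous_adapted T X"
    using X unfolding wealth_process_def has_ito_differential_def continuous_adapted_def by simp
  show "continuous_on ({0..<T} \<times> {0<..}) (\<lambda>(t, x). g t x)" using g by (simp add: state_space_def)
  show "X t \<omega> \<in> {0<..}" if "0 \<le> t" "t < T" "\<omega> \<in> space P" for t \<omega>
    using wealth_state[OF X that] by (simp add: state_space_def)
qed simp

text \<open>With all wealth invested in production the short rate drops out of the wealth
  dynamics.\<close>

lemma wealth_decomposition:
  assumes X: "wealth_process P F W T \<alpha> \<sigma> r u_hat c_hat 0 x0 X"
  shows "\<exists>Y. ito_decomposition T X (\<lambda>t \<omega>. \<alpha> * X t \<omega> - c_hat t (X t \<omega>)) (\<lambda>t \<omega>. X t \<omega> * \<sigma>) Y"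
proof -
  let ?a = "\<lambda>t \<omega>. X t \<omega> * u_hat t (X t \<omega>) * (\<alpha> - r t (X t \<omega>)) + (r t (X t \<omega>) * X t \<omega> - c_hat t (X t \<omega>))"
  let ?b = "\<lambda>t \<omega>. X t \<omega> * u_hat t (X t \<omega>) * \<sigma>"
  have eq: "\<alpha> * X t \<omega> - c_hat t (X t \<omega>) = ?a t \<omega> \<and> X t \<omega> * \<sigma> = ?b t \<omega>"
    if "0 \<le> t" "t < T" "\<omega> \<in> space P" for t \<omega>
    using market_clearing[OF wealth_state[OF X that]] by (simp add: algebra_simps)
  have id: "continuous_on (state_space T) (\<lambda>(t, x). x)"
    unfolding case_prod_beta by (intro continuous_intros)
  have ca: "continuous_on (state_space T) (\<lambda>(t, x). \<alpha> * x - c_hat t x)"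
    using id c_hat_continuous unfolding case_prod_beta by (intro continuous_on_diff continuous_on_mult continuous_on_const)
  have cb: "continuous_on (state_space T) (\<lambda>(t, x). x * \<sigma>)"
    using id unfolding case_prod_beta by (intro continuous_on_mult continuous_on_const)
  have "ito_decomposition T X ?a ?b (\<lambda>t \<omega>. X t \<omega> - X 0 \<omega> - (LINT s:{0..t}|lborel. ?a s \<omega>))"
  proof (rule ito_differential_decomposition)
    show "has_ito_differential P F W 0 T X ?a ?b" using X unfolding wealth_process_def by simp
    show "continuous_on {0..<T} (\<lambda>t. ?a t \<omega>)" if \<omega>: "\<omega> \<in> space P" for \<omega>
      by (rule continuous_on_eq[OF wealth_path_compose[OF X \<omega> ca]]) (use eq \<omega> in simp)
    show "continuous_on {0..<T} (\<lambda>t. ?b t \<omega>)" if \<omega>: "\<omega> \<in> space P" for \<omega>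
      by (rule continuous_on_eq[OF wealth_path_compose[OF X \<omega> cb]]) (use eq \<omega> in simp)
  qed
  from ito_decomposition_cong[OF this eq] show ?thesis by blast
qed

text \<open>For each fixed \<open>(s, y)\<close> Ito's formula gives explicit coefficients, jointly
  continuous in time and parameter. They are therefore admissible versions for evaluation at the
  random parameter, which yields the coefficients assumed for \<open>B\<close>.\<close>

lemma lnfx_partial_differential:
  assumes X: "wealth_process P F W T \<alpha> \<sigma> r u_hat c_hat 0 x0 X"
    and B: "has_ito_differential P F W 0 T B (\<lambda>t \<omega>. lnfx_drift t (X t \<omega>) t (X t \<omega>)) (\<lambda>t \<omega>. lnfx_vol t (X t \<omega>) t (X t \<omega>))"
  shows "has_partial_differential P F W T (\<lambda>(t, x) (s, y). ln (fx t x s y)) (state_space T)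
    (\<lambda>t \<omega>. (t, X t \<omega>)) (\<lambda>t \<omega>. (t, X t \<omega>)) B"
proof -
  obtain Y where Y: "ito_decomposition T X (\<lambda>t \<omega>. \<alpha> * X t \<omega> - c_hat t (X t \<omega>)) (\<lambda>t \<omega>. X t \<omega> * \<sigma>) Y"
    using wealth_decomposition[OF X] by auto
  have joint: "continuous_on ({0..<T} \<times> state_space T) (\<lambda>(t, y). g t (X t \<omega>) (fst y) (snd y))"
    if g: "continuous_on (state_space T \<times> state_space T) (\<lambda>((t, x), (s, y)). g t x s y)" and \<omega>: "\<omega> \<in> space P" for g \<omega>
  proof -
    have "continuous_on ({0..<T} \<times> state_space T) (\<lambda>p. (fst p, X (fst p) \<omega>))"
      using continuous_on_compose2[OF wealth_path[OF X \<omega>] continuous_on_fst[OF continuous_on_id], of "{0..<T} \<times> state_space T"]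
      by (simp add: image_subset_iff)
    then have c: "continuous_on ({0..<T} \<times> state_space T) (\<lambda>p. ((fst p, X (fst p) \<omega>), snd p))"
      by (rule continuous_on_Pair[OF _ continuous_on_snd[OF continuous_on_id]])
    have "(\<lambda>p. ((fst p, X (fst p) \<omega>), snd p)) ` ({0..<T} \<times> state_space T) \<subseteq> state_space T \<times> state_space T"
      using wealth_state[OF X _ _ \<omega>] by auto
    from continuous_on_compose2[OF g c this] show ?thesis by (simp add: case_prod_beta)
  qed
  have slice: "continuous_on ({0..<T} \<times> {0<..}) (\<lambda>(t, x). g t x s y)"
    if g: "continuous_on (state_space T \<times> state_space T) (\<lambda>((t, x), (s, y)). g t x s y)" and sy: "(s, y) \<in> state_space T" for g s y
  proof -
    have c: "continuous_on (state_space T) (\<lambda>p. (p, (s, y)))" by (intro continuous_on_Pair continuous_on_id continuous_on_const)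
    have "(\<lambda>p. (p, (s, y))) ` state_space T \<subseteq> state_space T \<times> state_space T" using sy by auto
    from continuous_on_compose2[OF g c this] show ?thesis by (simp add: case_prod_beta state_space_def)
  qed
  have dy: "has_ito_differential P F W 0 T (\<lambda>t \<omega>. ln (fx t (X t \<omega>) s y))
      (\<lambda>t \<omega>. lnfx_drift t (X t \<omega>) s y) (\<lambda>t \<omega>. lnfx_vol t (X t \<omega>) s y)" if sy: "(s, y) \<in> state_space T" for s y
    unfolding lnfx_drift_def lnfx_vol_def
  proof (rule ito_formula[OF Y, where J="{0<..}"])
    show "X t \<omega> \<in> {0<..}" if "0 \<le> t" "t < T" "\<omega> \<in> space P" for t \<omega>
      using wealth_state[OF X that] by (simp add: state_space_def)
    fix t x :: real assume "t \<in> {0..<T}" "x \<in> {0<..}"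
    then have tx: "(t, x) \<in> state_space T" by (simp add: state_space_def)
    note d = lnfx_derivatives[OF tx sy]
    show "((\<lambda>t. ln (fx t x s y)) has_real_derivative ftx t x s y / fx t x s y) (at t within {0..<T})" by (rule d(1))
    show "((\<lambda>x. ln (fx t x s y)) has_real_derivative fxx t x s y / fx t x s y) (at x)" by (rule d(2))
    show "((\<lambda>x. fxx t x s y / fx t x s y) has_real_derivative fxxx t x s y / fx t x s y - (fxx t x s y / fx t x s y)\<^sup>2) (at x)"
      by (rule d(3))
  next
    show "continuous_on ({0..<T} \<times> {0<..}) (\<lambda>(t, x). ln (fx t x s y))" by (rule slice[OF lnfx_continuous(1) sy])
    show "continuous_on ({0..<T} \<times> {0<..}) (\<lambda>(t, x). ftx t x s y / fx t x s y)" by (rule slice[OF lnfx_continuous(2) sy])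
    show "continuous_on ({0..<T} \<times> {0<..}) (\<lambda>(t, x). fxx t x s y / fx t x s y)" by (rule slice[OF lnfx_continuous(3) sy])
    show "continuous_on ({0..<T} \<times> {0<..}) (\<lambda>(t, x). fxxx t x s y / fx t x s y - (fxx t x s y / fx t x s y)\<^sup>2)"
      by (rule slice[OF lnfx_continuous(4) sy])
  qed simp
  show ?thesis
    unfolding has_partial_differential_def
  proof (intro exI conjI ballI)
    show "continuous_on ({0..<T} \<times> state_space T) (\<lambda>(t, y). lnfx_drift t (X t \<omega>) (fst y) (snd y))"
      "continuous_on ({0..<T} \<times> state_space T) (\<lambda>(t, y). lnfx_vol t (X t \<omega>) (fst y) (snd y))" if "\<omega> \<in> space P" for \<omega>
      by (rule joint[OF lnfx_continuous(5) that] joint[OF lnfx_continuous(6) that])+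
    show "has_ito_differential P F W 0 T (\<lambda>t \<omega>. (case (t, X t \<omega>) of (t, x) \<Rightarrow> \<lambda>(s, y). ln (fx t x s y)) p)
        (\<lambda>t \<omega>. lnfx_drift t (X t \<omega>) (fst p) (snd p)) (\<lambda>t \<omega>. lnfx_vol t (X t \<omega>) (fst p) (snd p))" if "p \<in> state_space T" for p
      using dy[of "fst p" "snd p"] that by (simp add: case_prod_beta)
    show "has_ito_differential P F W 0 T B (\<lambda>t \<omega>. lnfx_drift t (X t \<omega>) (fst (t, X t \<omega>)) (snd (t, X t \<omega>)))
        (\<lambda>t \<omega>. lnfx_vol t (X t \<omega>) (fst (t, X t \<omega>)) (snd (t, X t \<omega>)))"
      using B by simp
  qed
qed

lemma lnfx_partial_differential_unique:
  assumes X: "wealth_process P F W T \<alpha> \<sigma> r u_hat c_hat 0 x0 X"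
    and B: "has_partial_differential P F W T (\<lambda>(t, x) (s, y). ln (fx t x s y)) (state_space T) (\<lambda>t \<omega>. (t, X t \<omega>)) (\<lambda>t \<omega>. (t, X t \<omega>)) B"
    and B': "has_partial_differential P F W T (\<lambda>(t, x) (s, y). ln (fx t x s y)) (state_space T) (\<lambda>t \<omega>. (t, X t \<omega>)) (\<lambda>t \<omega>. (t, X t \<omega>)) B'"
  shows "AE \<omega> in P. \<forall>t\<in>{0..<T}. B t \<omega> - B 0 \<omega> = B' t \<omega> - B' 0 \<omega>"
  by (rule partial_differential_unique[OF B B' wealth_state[OF X] wealth_path[OF X]])

text \<open>Ito's formula is applied to \<open>ln L\<close> alone, since discounting only adds a
  drift to it. The initial value of \<open>M\<close> is the discounting constant because
  \<open>L 0 = 1\<close>.\<close>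

lemma discount_factor_log:
  assumes X: "wealth_process P F W T \<alpha> \<sigma> r u_hat c_hat 0 x0 X"
    and sdf: "stochastic_discount_factor P F W T \<alpha> \<sigma> r X Q L \<phi> M"
  shows "has_ito_differential P F W 0 T (\<lambda>t \<omega>. ln (M t \<omega>))
      (\<lambda>t \<omega>. lnfx_drift t (X t \<omega>) t (X t \<omega>)) (\<lambda>t \<omega>. lnfx_vol t (X t \<omega>) t (X t \<omega>))"
    and "\<exists>k>0. \<forall>\<omega>\<in>space P. M 0 \<omega> = k \<and> (\<forall>t\<in>{0..<T}. M t \<omega> > 0)"
proof -
  interpret S: stochastic_discount_factor P F W T \<alpha> \<sigma> r X Q L \<phi> M by (rule sdf)
  obtain k where k: "k > 0" "\<And>\<omega> t. \<omega> \<in> space P \<Longrightarrow> t \<in> {0..<T} \<Longrightarrow>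
      M t \<omega> = k * exp (- (LINT s:{0..t}|lborel. r s (X s \<omega>))) * L t \<omega>"
    using S.discounting by auto
  have r: "continuous_adapted T (\<lambda>t \<omega>. r t (X t \<omega>))" by (rule wealth_continuous_adapted[OF X short_rate_continuous])
  \<comment> \<open>Since \<open>\<sigma> \<noteq> 0\<close>, the martingale condition can be solved
    for the kernel, which is thus as continuous as \<open>r\<close>.\<close>
  have \<phi>: "continuous_on (state_space T) (\<lambda>(t, x). \<phi> t x)"
  proof (rule continuous_on_eq)
    show "continuous_on (state_space T) (\<lambda>p. (r (fst p) (snd p) - \<alpha>) / \<sigma>)"
      using short_rate_continuous unfolding case_prod_beta
      by (intro continuous_on_divide continuous_on_diff continuous_on_const) (use sigma_nonzero in auto)
    show "(r (fst p) (snd p) - \<alpha>) / \<sigma> = (case p of (t, x) \<Rightarrow> \<phi> t x)" if "p \<in> state_space T" for p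
      using S.martingale_condition[of "fst p" "snd p"] that sigma_nonzero by (simp add: case_prod_beta)
  qed
  have L: "continuous_adapted T L"
    using S.likelihood_dynamics unfolding has_ito_differential_def continuous_adapted_def by simp
  have Lpath: "continuous_on {0..<T} (\<lambda>t. L t \<omega>)" if "\<omega> \<in> space P" for \<omega>
    using L that unfolding continuous_adapted_def by simp
  have "ito_decomposition T L (\<lambda>t \<omega>. 0) (\<lambda>t \<omega>. L t \<omega> * \<phi> t (X t \<omega>)) (\<lambda>t \<omega>. L t \<omega> - L 0 \<omega> - (LINT s:{0..t}|lborel. 0))"
    by (rule ito_differential_decomposition[OF S.likelihood_dynamics])
       (rule continuous_on_const continuous_on_mult[OF Lpath wealth_path_compose[OF X _ \<phi>]], assumption?)+
  then have "has_ito_differential P F W 0 T (\<lambda>t \<omega>. ln (L t \<omega>))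
      (\<lambda>t \<omega>. 0 + 1 / L t \<omega> * 0 + - 1 / (L t \<omega>)\<^sup>2 / 2 * (L t \<omega> * \<phi> t (X t \<omega>))\<^sup>2) (\<lambda>t \<omega>. 1 / L t \<omega> * (L t \<omega> * \<phi> t (X t \<omega>)))"
  proof (rule ito_formula[where J="{0<..}" and k="\<lambda>t. ln" and kt="\<lambda>t x. 0" and kx="\<lambda>t x. 1 / x" and kxx="\<lambda>t x. - 1 / x\<^sup>2"])
    show "L t \<omega> \<in> {0<..}" if "0 \<le> t" "t < T" "\<omega> \<in> space P" for t \<omega>
      using S.likelihood_pos that by simp
    show "(ln has_real_derivative 1 / x) (at x)" if "x \<in> {0<..}" for x :: real
      using DERIV_ln[of x] that by (simp add: inverse_eq_divide)
    show "((\<lambda>x. 1 / x) has_real_derivative - 1 / x\<^sup>2) (at x)" if "x \<in> {0<..}" for x :: real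
      using that by (auto intro!: derivative_eq_intros simp: power2_eq_square)
    show "continuous_on ({0..<T} \<times> {0<..}) (\<lambda>(t, x). ln (x :: real))"
      unfolding case_prod_beta by (intro continuous_intros) auto
    show "continuous_on ({0..<T} \<times> {0<..}) (\<lambda>(t, x). 1 / (x :: real))"
      unfolding case_prod_beta by (intro continuous_intros) auto
    show "continuous_on ({0..<T} \<times> {0<..}) (\<lambda>(t, x). - 1 / (x :: real)\<^sup>2)"
      unfolding case_prod_beta by (intro continuous_intros) auto
  qed auto
  then have lnL: "has_ito_differential P F W 0 T (\<lambda>t \<omega>. ln (L t \<omega>))
      (\<lambda>t \<omega>. - 1 / (L t \<omega>)\<^sup>2 / 2 * (L t \<omega> * \<phi> t (X t \<omega>))\<^sup>2) (\<lambda>t \<omega>. 1 / L t \<omega> * (L t \<omega> * \<phi> t (X t \<omega>)))"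
    by simp
  obtain Y where Y: "ito_decomposition T (\<lambda>t \<omega>. ln (L t \<omega>))
      (\<lambda>t \<omega>. - 1 / (L t \<omega>)\<^sup>2 / 2 * (L t \<omega> * \<phi> t (X t \<omega>))\<^sup>2) (\<lambda>t \<omega>. 1 / L t \<omega> * (L t \<omega> * \<phi> t (X t \<omega>))) Y"
  proof
    have nz: "\<forall>t\<in>{0..<T}. L t \<omega> \<noteq> 0" "\<forall>t\<in>{0..<T}. (L t \<omega>)\<^sup>2 \<noteq> 0" if "\<omega> \<in> space P" for \<omega>
      using S.likelihood_pos that by force+
    note p = wealth_path_compose[OF X _ \<phi>]
    show "ito_decomposition T (\<lambda>t \<omega>. ln (L t \<omega>))
      (\<lambda>t \<omega>. - 1 / (L t \<omega>)\<^sup>2 / 2 * (L t \<omega> * \<phi> t (X t \<omega>))\<^sup>2) (\<lambda>t \<omega>. 1 / L t \<omega> * (L t \<omega> * \<phi> t (X t \<omega>)))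
      (\<lambda>t \<omega>. ln (L t \<omega>) - ln (L 0 \<omega>) - (LINT s:{0..t}|lborel. - 1 / (L s \<omega>)\<^sup>2 / 2 * (L s \<omega> * \<phi> s (X s \<omega>))\<^sup>2))"
    proof (rule ito_differential_decomposition[OF lnL])
      fix \<omega> assume \<omega>: "\<omega> \<in> space P"
      show "continuous_on {0..<T} (\<lambda>t. - 1 / (L t \<omega>)\<^sup>2 / 2 * (L t \<omega> * \<phi> t (X t \<omega>))\<^sup>2)"
        by (rule continuous_on_mult[OF continuous_on_divide[OF continuous_on_divide[OF continuous_on_const continuous_on_power[OF Lpath[OF \<omega>]] nz(2)[OF \<omega>]] continuous_on_const]
            continuous_on_power[OF continuous_on_mult[OF Lpath[OF \<omega>] p[OF \<omega>]]]]) simp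
      show "continuous_on {0..<T} (\<lambda>t. 1 / L t \<omega> * (L t \<omega> * \<phi> t (X t \<omega>)))"
        by (rule continuous_on_mult[OF continuous_on_divide[OF continuous_on_const Lpath[OF \<omega>] nz(1)[OF \<omega>]] continuous_on_mult[OF Lpath[OF \<omega>] p[OF \<omega>]]])
    qed
  qed
  have mr: "continuous_adapted T (\<lambda>t \<omega>. - r t (X t \<omega>))"
    using continuous_adapted_mult[OF continuous_adapted_const[of T "- 1"] r] by simp
  have lnM: "ln (M t \<omega>) = ln k + (LINT s:{0..t}|lborel. - r s (X s \<omega>)) + ln (L t \<omega>)"
    if "0 \<le> t" "t < T" "\<omega> \<in> space P" for t \<omega>
  proof -
    have "(LINT s:{0..t}|lborel. - r s (X s \<omega>)) = - (LINT s:{0..t}|lborel. r s (X s \<omega>))"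
      by (simp add: set_lebesgue_integral_def)
    then show ?thesis
      using k(2)[of \<omega> t] k(1) S.likelihood_pos[of t \<omega>] that by (simp add: ln_mult)
  qed
  have "ito_decomposition T (\<lambda>t \<omega>. ln (M t \<omega>))
      (\<lambda>t \<omega>. - r t (X t \<omega>) + - 1 / (L t \<omega>)\<^sup>2 / 2 * (L t \<omega> * \<phi> t (X t \<omega>))\<^sup>2) (\<lambda>t \<omega>. 1 / L t \<omega> * (L t \<omega> * \<phi> t (X t \<omega>))) Y"
    by (rule ito_decomposition_add_drift[OF Y mr lnM])
  \<comment> \<open>The factors \<open>L\<close> cancel, leaving drift
    \<open>- r - \<phi>\<^sup>2 / 2\<close> and volatility \<open>\<phi>\<close>, which
    \<open>girsanov_kernel\<close> identifies on the diagonal.\<close>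
  then have "ito_decomposition T (\<lambda>t \<omega>. ln (M t \<omega>))
      (\<lambda>t \<omega>. lnfx_drift t (X t \<omega>) t (X t \<omega>)) (\<lambda>t \<omega>. lnfx_vol t (X t \<omega>) t (X t \<omega>)) Y"
  proof (rule ito_decomposition_cong)
    fix t \<omega> assume t: "0 \<le> t" "t < T" "\<omega> \<in> space P"
    note st = wealth_state[OF X t]
    have "L t \<omega> > 0" using S.likelihood_pos t by simp
    then show "lnfx_drift t (X t \<omega>) t (X t \<omega>) = - r t (X t \<omega>) + - 1 / (L t \<omega>)\<^sup>2 / 2 * (L t \<omega> * \<phi> t (X t \<omega>))\<^sup>2
      \<and> lnfx_vol t (X t \<omega>) t (X t \<omega>) = 1 / L t \<omega> * (L t \<omega> * \<phi> t (X t \<omega>))"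
      unfolding girsanov_kernel[OF st S.martingale_condition[OF st]] by (simp add: power_mult_distrib)
  qed
  then show "has_ito_differential P F W 0 T (\<lambda>t \<omega>. ln (M t \<omega>))
      (\<lambda>t \<omega>. lnfx_drift t (X t \<omega>) t (X t \<omega>)) (\<lambda>t \<omega>. lnfx_vol t (X t \<omega>) t (X t \<omega>))"
    by (rule ito_decomposition_differential)
  have "(LINT s:{0..0}|lborel. r s (X s \<omega>)) = 0" for \<omega> by (subst LINT_continuous) auto
  then have "M 0 \<omega> = k" if "\<omega> \<in> space P" for \<omega>
    using k(2)[OF that, of 0] T_pos S.likelihood_initial[OF that] by simp
  moreover have "M t \<omega> > 0" if "\<omega> \<in> space P" "t \<in> {0..<T}" for t \<omega>
    using k that S.likelihood_pos by simp
  ultimately show "\<exists>k>0. \<forall>\<omega>\<in>space P. M 0 \<omega> = k \<and> (\<forall>t\<in>{0..<T}. M t \<omega> > 0)"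
    using k(1) by (intro exI[of _ k]) simp
qed

end

text \<open>A differential leaves the initial random variable free, so both converse parts require
  an initial value that is almost surely constant; otherwise the ratio to \<open>M\<close> would
  only be random and fixed in time.\<close>

theorem theorem13p1:
  fixes P :: "'a measure" and F :: "real \<Rightarrow> 'a measure" and W :: "real \<Rightarrow> 'a \<Rightarrow> real"
    and T \<alpha> \<sigma> x0 :: real
    and f ft fx fxx fxxx ftx U Uc :: "real \<Rightarrow> real \<Rightarrow> real \<Rightarrow> real \<Rightarrow> real"
    and r u_hat c_hat \<phi> :: "real \<Rightarrow> real \<Rightarrow> real"
    and X L M :: "real \<Rightarrow> 'a \<Rightarrow> real" and Q :: "'a measure"
  assumes equilibrium:
      "market_equilibrium P F W T f ft fx fxx fxxx ftx \<alpha> \<sigma> U Uc r u_hat c_hat"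
    and wealth: "x0 > 0" "wealth_process P F W T \<alpha> \<sigma> r u_hat c_hat 0 x0 X"
    and sdf: "stochastic_discount_factor P F W T \<alpha> \<sigma> r X Q L \<phi> M"
  defines "dlnfx \<equiv> has_partial_differential P F W T (\<lambda>(t, x) (s, y). ln (fx t x s y)) (state_space T)
                     (\<lambda>t \<omega>. (t, X t \<omega>)) (\<lambda>t \<omega>. (t, X t \<omega>))"
    and "lnfx \<equiv> (\<lambda>t \<omega>. ln (fx t (X t \<omega>) t (X t \<omega>)))"
    and "UceZ \<equiv> (\<lambda>Z t \<omega>. Uc t (X t \<omega>) t (c_hat t (X t \<omega>)) * exp (Z t \<omega>))"
  shows
    "dlnfx (\<lambda>t \<omega>. ln (M t \<omega>))
     \<and> (\<forall>N. (\<forall>t\<in>{0..<T}. \<forall>\<omega>\<in>space P. N t \<omega> > 0) \<and> (\<exists>n0. AE \<omega> in P. N 0 \<omega> = n0) \<and>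
             dlnfx (\<lambda>t \<omega>. ln (N t \<omega>)) \<longrightarrow> proportional_processes P T N M)
     \<and> (\<exists>Z A. dlnfx A \<and> differential_diff P T Z A lnfx \<and>
             (\<forall>t\<in>{0..<T}. \<forall>\<omega>\<in>space P. M t \<omega> = UceZ Z t \<omega>))
     \<and> (\<forall>Z A. dlnfx A \<and> differential_diff P T Z A lnfx \<and> (\<exists>z0. AE \<omega> in P. Z 0 \<omega> = z0)
             \<longrightarrow> proportional_processes P T (UceZ Z) M)"
proof (intro conjI allI impI)
  interpret E: market_equilibrium P F W T f ft fx fxx fxxx ftx \<alpha> \<sigma> U Uc r u_hat c_hat
    "\<lambda>u c t x s y. ft t x s y + x * u * (\<alpha> - r t x) * fx t x s y
       + (r t x * x - c) * fx t x s y + 1 / 2 * x\<^sup>2 * u\<^sup>2 * \<sigma>\<^sup>2 * fxx t x s y"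
    by (rule equilibrium) simp
  note X = wealth(2)
  obtain k where k: "k > 0" "\<And>\<omega>. \<omega> \<in> space P \<Longrightarrow> M 0 \<omega> = k"
    and M_pos: "\<And>\<omega> t. \<omega> \<in> space P \<Longrightarrow> t \<in> {0..<T} \<Longrightarrow> M t \<omega> > 0"
    using E.discount_factor_log(2)[OF X sdf] by auto
  have zero: "0 \<in> {0..<T}" using E.T_pos by simp
  show lnM: "dlnfx (\<lambda>t \<omega>. ln (M t \<omega>))"
    unfolding dlnfx_def by (rule E.lnfx_partial_differential[OF X E.discount_factor_log(1)[OF X sdf]])
  have unique: "AE \<omega> in P. \<forall>t\<in>{0..<T}. B t \<omega> - B 0 \<omega> = ln (M t \<omega>) - ln (M 0 \<omega>)" if "dlnfx B" for B
    using E.lnfx_partial_differential_unique[OF X that[unfolded dlnfx_def] lnM[unfolded dlnfx_def]] .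
  show "proportional_processes P T N M"
    if N: "(\<forall>t\<in>{0..<T}. \<forall>\<omega>\<in>space P. N t \<omega> > 0) \<and> (\<exists>n0. AE \<omega> in P. N 0 \<omega> = n0) \<and> dlnfx (\<lambda>t \<omega>. ln (N t \<omega>))" for N
  proof -
    obtain n0 where n0: "AE \<omega> in P. N 0 \<omega> = n0" using N by blast
    \<comment> \<open>A constant that is positive almost surely on a probability space is
      positive.\<close>
    have "AE \<omega> in P. n0 > 0"
      using n0 AE_space by eventually_elim (use N zero in auto)
    then have "n0 > 0" by (simp add: E.AE_const)
    moreover have "AE \<omega> in P. \<forall>t\<in>{0..<T}. N t \<omega> = n0 / k * M t \<omega>"
      using n0 unique[OF N[THEN conjunct2, THEN conjunct2]] AE_space
    proof eventually_elim
      case (elim \<omega>)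
      show ?case
      proof
        fix t assume t: "t \<in> {0..<T}"
        have pos: "N t \<omega> > 0" "M t \<omega> > 0" using N M_pos t elim(3) by auto
        have "ln (N t \<omega>) = ln n0 + (ln (M t \<omega>) - ln k)"
          using elim(2) t elim(1) k(2)[OF elim(3)] by force
        also have "\<dots> = ln (n0 / k * M t \<omega>)"
          using pos k(1) \<open>n0 > 0\<close> by (simp add: ln_mult ln_div)
        finally show "N t \<omega> = n0 / k * M t \<omega>"
          using pos k(1) \<open>n0 > 0\<close> by (subst (asm) ln_inj_iff) simp_all
      qed
    qed
    ultimately show ?thesis
      unfolding proportional_processes_def using k(1) by (intro exI[of _ "n0 / k"]) simp
  qed
  have fx_pos: "fx t (X t \<omega>) t (X t \<omega>) > 0" if "t \<in> {0..<T}" "\<omega> \<in> space P" for t \<omega>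
    using E.wealth_state[OF X, of t \<omega>] that by (intro E.fx_pos) simp_all
  \<comment> \<open>By the first order condition for consumption, \<open>Uc\<close> along the
    equilibrium is \<open>exp\<close> of \<open>lnfx\<close>.\<close>
  have UceZ: "UceZ Z t \<omega> = exp (lnfx t \<omega> + Z t \<omega>)" if "t \<in> {0..<T}" "\<omega> \<in> space P" for Z t \<omega>
    using E.marginal_utility[OF E.wealth_state[OF X, of t \<omega>]] that fx_pos[OF that]
    unfolding UceZ_def lnfx_def by (simp add: exp_add)
  show "\<exists>Z A. dlnfx A \<and> differential_diff P T Z A lnfx \<and> (\<forall>t\<in>{0..<T}. \<forall>\<omega>\<in>space P. M t \<omega> = UceZ Z t \<omega>)"
  proof (intro exI conjI ballI)
    \<comment> \<open>The witnesses are \<open>ln M\<close> for \<open>A\<close> and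
      \<open>ln M - lnfx\<close> for \<open>Z\<close>, which also fixes the initial value so that
      equality holds everywhere.\<close>
    show "dlnfx (\<lambda>t \<omega>. ln (M t \<omega>))" by (rule lnM)
    show "differential_diff P T (\<lambda>t \<omega>. ln (M t \<omega>) - lnfx t \<omega>) (\<lambda>t \<omega>. ln (M t \<omega>)) lnfx"
      unfolding differential_diff_def by simp
    show "M t \<omega> = UceZ (\<lambda>t \<omega>. ln (M t \<omega>) - lnfx t \<omega>) t \<omega>" if "t \<in> {0..<T}" "\<omega> \<in> space P" for t \<omega>
      using M_pos[OF that(2,1)] by (simp add: UceZ[OF that])
  qed
  show "proportional_processes P T (UceZ Z) M"
    if Z: "dlnfx A \<and> differential_diff P T Z A lnfx \<and> (\<exists>z0. AE \<omega> in P. Z 0 \<omega> = z0)" for Z A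
  proof -
    obtain z0 where z0: "AE \<omega> in P. Z 0 \<omega> = z0" using Z by blast
    \<comment> \<open>The value at time \<open>0\<close> of \<open>lnfx + Z - ln M\<close>; this
      difference is constant in time and non-random because wealth starts at
      \<open>x0\<close>.\<close>
    define c where "c = z0 - ln k + ln (fx 0 x0 0 x0)"
    have diff: "AE \<omega> in P. \<forall>t\<in>{0..<T}. Z t \<omega> - Z 0 \<omega> = (A t \<omega> - A 0 \<omega>) - (lnfx t \<omega> - lnfx 0 \<omega>)"
      using Z unfolding differential_diff_def by simp
    have "AE \<omega> in P. \<forall>t\<in>{0..<T}. UceZ Z t \<omega> = exp c * M t \<omega>"
      using z0 diff unique[OF Z[THEN conjunct1]] AE_space
    proof eventually_elim
      case (elim \<omega>)
      have "X 0 \<omega> = x0" using X elim(4) unfolding wealth_process_def by simp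
      then have lnfx0: "lnfx 0 \<omega> = ln (fx 0 x0 0 x0)" by (simp add: lnfx_def)
      show ?case
      proof
        fix t assume t: "t \<in> {0..<T}"
        have "Z t \<omega> - Z 0 \<omega> = (A t \<omega> - A 0 \<omega>) - (lnfx t \<omega> - lnfx 0 \<omega>)" using elim(2) t by blast
        moreover have "A t \<omega> - A 0 \<omega> = ln (M t \<omega>) - ln (M 0 \<omega>)" using elim(3) t by blast
        ultimately have "lnfx t \<omega> + Z t \<omega> = c + ln (M t \<omega>)"
          using elim(1) lnfx0 k(2)[OF elim(4)] unfolding c_def by simp
        then show "UceZ Z t \<omega> = exp c * M t \<omega>"
          using M_pos[OF elim(4) t] by (simp add: UceZ[OF t elim(4)] exp_add)
      qed
    qed
    then show ?thesis
      unfolding proportional_processes_def by (intro exI[of _ "exp c"]) simp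
  qed
qed

end
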